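(* Let $q\in(0,1)$, $s\in(-1,0)$, $u_y,v_x\in[0,1)$ for $x,y\in\mathbb{Z}_{\ge1}$, and $\alpha,\beta\in[0,-s^{-1}]$ with $\alpha\beta<1$. Let $\boldsymbol\lambda=\{\lambda^{(x,y)}\}_{x,y\ge0}$ be the sHL/sHL Yang-Baxter field with $(\alpha,\beta)$-scaled geometric boundary conditions. Let $\mathcal{H}^{\mathrm{6V}}$ be the centered height function of the stochastic six vertex model with $(\alpha,\beta)$-stationary boundary conditions, and let $\mathcal{M}$ be a $q$-Poisson random variable with parameter $\alpha\beta$, i.e. $\mathrm{Prob}(\mathcal{M}=k)=\frac{(\alpha\beta)^k}{(q;q)_k}(\alpha\beta;q)_\infty$, $k\ge0$, independent of the six vertex model. Then the two random fields $\{y-\ell(\lambda^{(x,y)}):x,y\in\mathbb{Z}_{\ge0}\}$ and $\{\mathcal{H}^{\mathrm{6V}}(x,y)-\mathcal{M}:x,y\in\mathbb{Z}_{\ge0}\}$ are equal in distribution.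
   Context: **Notation.** $(a;q)_n=\prod_{i=1}^{n}(1-aq^{i-1})$ for $n\ge0$, $(a;q)_n=\prod_{i=n}^{-1}(1-aq^i)^{-1}$ for $n<0$, $(a;q)_\infty=\prod_{i\ge1}(1-aq^{i-1})$; ${}_{4}\overline\phi_3\bigl(q^{-n};a_1,a_2,a_3;\,b_1,b_2,b_3\,|\,q,z\bigr)=\sum_{j=0}^nz^j\frac{(q^{-n};q)_j}{(q;q)_j}\prod_{i=1}^3(a_i;q)_j(q^jb_i;q)_{n-j}$. A Young diagram $\lambda=1^{l_1}2^{l_2}\cdots$ has $l_i$ parts equal to $i$; $\ell(\lambda)=\sum_il_i$. **Fused weights** (rational in $q^J,q^I$, which are treated as independent parameters): $$w^{(J)}_{u}(i_1,j_1;i_2,j_2)=\mathbf{1}_{i_1+j_1=i_2+j_2}\frac{(-1)^{i_1+j_2}q^{\frac12i_1(i_1-1+2j_1)}s^{j_2-i_1}u^{i_1}(u/s;q)_{j_1-i_2}(q;q)_{j_1}}{(q;q)_{i_1}(q;q)_{j_2}(su;q)_{j_1+i_1}}\,{}_4\overline\phi_3\bigl(q^{-i_1};q^{-i_2},suq^J,qs/u;\,s^2,q^{1+j_2-i_1},q^{1-i_2-j_2+J}\,|\,q,q\bigr),$$ $$w^{*,(I)}_{v}(i_1,j_1;i_2,j_2)=\frac{(s^2;q)_{i_1}(q;q)_{i_2}}{(q;q)_{i_1}(s^2;q)_{i_2}}w^{(I)}_{v}(i_2,j_1;i_1,j_2),\qquad b^{(J)}_u(k)=(-uq^J)^k\frac{(q^{-J};q)_k}{(q;q)_k},$$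 $$R^{(I,J)}_z(i_1,j_1;i_2,j_2)=\mathbf{1}_{i_2+j_1=i_1+j_2}\frac{q^{i_1i_2+\frac12j_2(j_2-1)+j_2J}(-z)^{j_2}(q;q)_{j_1}}{(z;q)_{j_1+i_2}(q;q)_{j_2}(q;q)_{i_2}(q^{1-J}/z;q)_{i_1-j_1}}\,{}_4\overline\phi_3\bigl(q^{-i_2};q^{-i_1},zq^I,q^{1-J}/z;\,q^{-J},q^{1+j_2-i_2},q^{1-i_1-j_2+I}\,|\,q,q\bigr),$$ $$\Pi=\frac{(uvq^I;q)_\infty(uvq^J;q)_\infty}{(uv;q)_\infty(uvq^{I+J};q)_\infty}.$$ **Specializations.** A row specialization $\rho$ means a choice of $(u,q^J)$, and a column specialization $\rho^*$ a choice of $(v,q^I)$: $\mathrm{sHL}(u)$ is $(u,q)$ (i.e. $J=1$); $\mathrm{sg}(\alpha)$ is $(-\epsilon\alpha,1/\epsilon)$ with the limit $\epsilon\to0$ taken in all formulas; and similarly for columns: $\mathrm{sHL}(v)=(v,q)$, $\mathrm{sg}(\beta)=(-\epsilon\beta,1/\epsilon)$, $\epsilon\to0$. Denote the specialized weights by $w^\rho$, $w^{*,\rho^*}$, $b_\rho$, $b_{\rho^*}$ (the latter is $b^{(I)}_v$), $R^{\rho,\rho^*}$ (which is $R^{(I,J)}_{uv}$) and $\Pi_{\rho,\rho^*}$ (values at special parameter points are understood by continuity). Horizontal occupation numbers belonging to an sHL specialization are in $\{0,1\}$; those belonging to an sg specialization are in $\mathbb{Z}_{\ge0}$. In the stated parameter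 range all these weights are nonnegative and satisfy, for all boundary data $c=(a,a',m;b,b',l)$, the Yang-Baxter equation $$\sum_{k,p,p'}R(a,a';p',p)w^*(m,p;k,b)w(k,p';l,b')=\sum_{n,t,t'}w^*(n,a';l,t')w(m,a;n,t)R(t,t';b',b).\quad(\mathrm{YB}_c)$$ **Bijectivization.** For each pair $(\rho,\rho^* )$ and each $c$ with positive sums, fix a coupling of the two probability measures on triples $(k,p,p')$ and $(n,t,t')$ proportional to the summands on the two sides of $(\mathrm{YB}_c)$, and let $\mathbf{p}_c((k,p,p')\to(n,t,t'))$ be the conditional probability of $(n,t,t')$ given $(k,p,p')$. **Forward transition $\varkappa\to\nu$ given $\lambda,\mu$ with specializations $\rho,\rho^*$.** Let $\varkappa=1^{k_1}2^{k_2}\cdots$, $\mu=1^{m_1}2^{m_2}\cdots$, $\lambda=1^{l_1}2^{l_2}\cdots$, $i_h=\sum_{r>h}(m_r-k_r)$, $i'_h=\sum_{r>h}(l_r-k_r)$. Choose $(j_0,j_0')$ with probability $$\frac{b_{\rho^*}(j_0')\,b_\rho(j_0)\,R^{\rho,\rho^*}(j_0,j_0';i_0',i_0)}{\Pi_{\rho,\rho^*}\,b_{\rho^*}(i_0)\,b_\rho(i_0')}.$$ Then for $h=1,2,\dots$ choose $(n_h,j_h,j_h')$ with probability $\mathbf{p}_c((k_h,i_{h-1},i'_{h-1})\to(n_h,j_h,j'_h))$, $c=(j_{h-1},j'_{h-1},m_h;i_h,i'_h,l_h)$. Output $\nu=1^{n_1}2^{n_2}\cdots$. Couplings are chosen so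 that almost surely $j_h=j_h'=0$ for large $h$ (such couplings exist). **The field.** Put $\rho_0=\mathrm{sg}(\alpha)$, $\rho_y=\mathrm{sHL}(u_y)$ for $y\ge1$; $\rho^*_0=\mathrm{sg}(\beta)$, $\rho^*_x=\mathrm{sHL}(v_x)$ for $x\ge1$. Define $\eta^{(x,y)}$ for $x,y\ge-1$ by $\eta^{(x,-1)}=\eta^{(-1,y)}=\varnothing$ and, inductively in $x+y$ with independent randomness, $\eta^{(x,y)}$ ($x,y\ge0$) is the output of the forward transition with $\varkappa=\eta^{(x-1,y-1)}$, $\mu=\eta^{(x,y-1)}$, $\lambda=\eta^{(x-1,y)}$ and specializations $\rho_y,\rho^*_x$. Then $\boldsymbol\lambda$ is the restriction of $\boldsymbol\eta$ to $x,y\ge0$. "The" Yang-Baxter field means any field so obtained, for any choice (for each pair $(\rho,\rho^* )$ and each $c$ with positive sums) of couplings of the two probability measures proportional to the summands on the two sides of $(\mathrm{YB}_c)$ such that almost surely $j_h=j_h'=0$ for large $h$. **Stochastic six vertex model.** A random configuration of up-right directed paths on $\mathbb{Z}_{\ge0}^2$, at most one path per edge. Vertex $(x,y)$, $x,y\ge1$, has configuration $(i_1,j_1;i_2,j_2)$ ($i_1$: enters from below, $j_1$: enters from the left, $i_2$: exits up, $j_2$: exits right). Sequentially in $x+y$ and independently given the inputs, $(i_2,j_2)$ is chosen given $(i_1,j_1)$ with probability $\mathsf{L}_{u_yv_x}(i_1,j_1;i_2,j_2)$, where $\mathsf{L}_z(0,0;0,0)=\mathsf{L}_z(1,1;1,1)=1$,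 $\mathsf{L}_z(1,0;1,0)=\frac{q(1-z)}{1-qz}$, $\mathsf{L}_z(1,0;0,1)=\frac{1-q}{1-qz}$, $\mathsf{L}_z(0,1;0,1)=\frac{1-z}{1-qz}$, $\mathsf{L}_z(0,1;1,0)=\frac{z(1-q)}{1-qz}$. The $(\alpha,\beta)$-stationary boundary conditions: independent random variables $b^{\mathrm h}_x\in\{0,1\}$ with $\mathrm{Prob}(b^{\mathrm h}_x=1)=\frac{v_x\alpha}{1+v_x\alpha}$ (number of paths entering $(x,1)$ from below) and $b^{\mathrm v}_y\in\{0,1\}$ with $\mathrm{Prob}(b^{\mathrm v}_y=1)=\frac1{1+u_y\beta}$ (number of paths entering $(1,y)$ from the left). The centered height function is $$\mathcal{H}^{\mathrm{6V}}(x,y)=\#\{1\le k\le y:\text{ the horizontal edge }(x,k)\to(x+1,k)\text{ is occupied}\}-\sum_{k=1}^xb^{\mathrm h}_k.$$ *)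

theory Defs
  imports "HOL-Probability.Probability"
begin

definition qpoch :: "real \<Rightarrow> real \<Rightarrow> int \<Rightarrow> real" where
  "qpoch a q n = (if n \<ge> 0 then (\<Prod>i = 1..nat n. 1 - a * q ^ (i - 1))
                  else (\<Prod>i = n..-1. inverse (1 - a * q powi i)))"

definition qpoch_inf :: "real \<Rightarrow> real \<Rightarrow> real" where
  "qpoch_inf a q = prodinf (\<lambda>i. 1 - a * q ^ i)"

definition phi43_reg ::
  "nat \<Rightarrow> real \<Rightarrow> real \<Rightarrow> real \<Rightarrow> real \<Rightarrow> real \<Rightarrow> real \<Rightarrow> real \<Rightarrow> real \<Rightarrow> real" where
  "phi43_reg n a1 a2 a3 b1 b2 b3 q z =
     (\<Sum>j = 0..n. z ^ j * (qpoch (q powi (- int n)) q j / qpoch q q j) *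
        (qpoch a1 q j * qpoch (q ^ j * b1) q (int n - int j)) *
        (qpoch a2 q j * qpoch (q ^ j * b2) q (int n - int j)) *
        (qpoch a3 q j * qpoch (q ^ j * b3) q (int n - int j)))"

text \<open>
  In the weights below the arguments \<open>X\<close> and \<open>Y\<close> stand for the independent parameters
  $q^J$ and $q^I$.  The formulas are rational functions of the parameters; at points where a
  denominator vanishes the HOL value of the formula is not the intended one, and the weights
  are only used through the limits taken below.
\<close>

definition fused_w ::
  "real \<Rightarrow> real \<Rightarrow> real \<Rightarrow> real \<Rightarrow> nat \<Rightarrow> nat \<Rightarrow> nat \<Rightarrow> nat \<Rightarrow> real" where
  "fused_w q s u X i1 j1 i2 j2 =
     (if i1 + j1 = i2 + j2 then
        (-1) ^ (i1 + j2) * q ^ (i1 * (i1 - 1 + 2 * j1) div 2) * s powi (int j2 - int i1) * u ^ i1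
        * qpoch (u / s) q (int j1 - int i2) * qpoch q q j1
        / (qpoch q q i1 * qpoch q q j2 * qpoch (s * u) q (j1 + i1))
        * phi43_reg i1 (q powi (- int i2)) (s * u * X) (q * s / u)
            (s\<^sup>2) (q powi (1 + int j2 - int i1)) (q powi (1 - int i2 - int j2) * X) q q
      else 0)"

definition fused_b :: "real \<Rightarrow> real \<Rightarrow> real \<Rightarrow> nat \<Rightarrow> real" where
  "fused_b q u X k = (- u * X) ^ k * (qpoch (1 / X) q k / qpoch q q k)"

definition fused_R ::
  "real \<Rightarrow> real \<Rightarrow> real \<Rightarrow> real \<Rightarrow> nat \<Rightarrow> nat \<Rightarrow> nat \<Rightarrow> nat \<Rightarrow> real" where
  "fused_R q z Y X i1 j1 i2 j2 =
     (if i2 + j1 = i1 + j2 then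
        q ^ (i1 * i2 + j2 * (j2 - 1) div 2) * X ^ j2 * (- z) ^ j2 * qpoch q q j1
        / (qpoch z q (j1 + i2) * qpoch q q j2 * qpoch q q i2
           * qpoch (q / X / z) q (int i1 - int j1))
        * phi43_reg i2 (q powi (- int i1)) (z * Y) (q / X / z)
            (1 / X) (q powi (1 + int j2 - int i2)) (q powi (1 - int i1 - int j2) * Y) q q
      else 0)"

definition fused_Pi :: "real \<Rightarrow> real \<Rightarrow> real \<Rightarrow> real \<Rightarrow> real \<Rightarrow> real" where
  "fused_Pi q u X v Y =
     qpoch_inf (u * v * Y) q * qpoch_inf (u * v * X) q
     / (qpoch_inf (u * v) q * qpoch_inf (u * v * X * Y) q)"

datatype spec = sHL real | sg real

text \<open>
  \<open>near q \<rho>\<close> is the filter of parameter points $(u, q^J)$ (or $(v, q^I)$, for columns)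
  approximating the specialization.  For \<open>sg a\<close> they are $(-\epsilon a', 1/\epsilon)$ with
  $\epsilon \to 0+$.  The punctured neighbourhoods \<open>at u\<close> and \<open>at a\<close> implement the convention
  that values at special points (such as \<open>u = 0\<close> or \<open>a = 0\<close>, where the formulas divide by 0) are
  understood by continuity.
\<close>

fun near :: "real \<Rightarrow> spec \<Rightarrow> (real \<times> real) filter" where
  "near q (sHL u) = filtermap (\<lambda>u'. (u', q)) (at u)"
| "near q (sg a) = filtermap (\<lambda>(a', \<epsilon>). (- \<epsilon> * a', 1 / \<epsilon>)) (at a \<times>\<^sub>F at_right 0)"

fun occ :: "spec \<Rightarrow> nat set" where
  "occ (sHL u) = {0, 1}"
| "occ (sg a) = UNIV"

definition w_spec :: "real \<Rightarrow> real \<Rightarrow> spec \<Rightarrow> nat \<Rightarrow> nat \<Rightarrow> nat \<Rightarrow> nat \<Rightarrow> real" where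
  "w_spec q s \<rho> i1 j1 i2 j2 = Lim (near q \<rho>) (\<lambda>(u, X). fused_w q s u X i1 j1 i2 j2)"

definition wstar_spec :: "real \<Rightarrow> real \<Rightarrow> spec \<Rightarrow> nat \<Rightarrow> nat \<Rightarrow> nat \<Rightarrow> nat \<Rightarrow> real" where
  "wstar_spec q s \<rho>s i1 j1 i2 j2 =
     qpoch (s\<^sup>2) q i1 * qpoch q q i2 / (qpoch q q i1 * qpoch (s\<^sup>2) q i2) * w_spec q s \<rho>s i2 j1 i1 j2"

definition b_spec :: "real \<Rightarrow> spec \<Rightarrow> nat \<Rightarrow> real" where
  "b_spec q \<rho> k = Lim (near q \<rho>) (\<lambda>(u, X). fused_b q u X k)"

text \<open>
  The formula for \<open>R\<close> has removable singularities at $q^{1-J}/z = q^{-i}$, which for two sHL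
  specializations are also met at parameter points close to the limit point; hence the limit is
  taken along the points where no denominator vanishes.
\<close>

definition R_spec :: "real \<Rightarrow> spec \<Rightarrow> spec \<Rightarrow> nat \<Rightarrow> nat \<Rightarrow> nat \<Rightarrow> nat \<Rightarrow> real" where
  "R_spec q \<rho> \<rho>s i1 j1 i2 j2 =
     Lim (inf (near q \<rho> \<times>\<^sub>F near q \<rho>s)
           (principal {((u, X), (v, Y)). u * v \<noteq> 0 \<and> X \<noteq> 0 \<and> qpoch (u * v) q (j1 + i2) \<noteq> 0
                                       \<and> qpoch (q / X / (u * v)) q (int i1 - int j1) \<noteq> 0}))
         (\<lambda>((u, X), (v, Y)). fused_R q (u * v) Y X i1 j1 i2 j2)"

definition Pi_spec :: "real \<Rightarrow> spec \<Rightarrow> spec \<Rightarrow> real" where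
  "Pi_spec q \<rho> \<rho>s = Lim (near q \<rho> \<times>\<^sub>F near q \<rho>s) (\<lambda>((u, X), (v, Y)). fused_Pi q u X v Y)"

type_synonym triple = "nat \<times> nat \<times> nat"
type_synonym bdata = "nat \<times> nat \<times> nat \<times> nat \<times> nat \<times> nat"

fun yb_left :: "real \<Rightarrow> real \<Rightarrow> spec \<Rightarrow> spec \<Rightarrow> bdata \<Rightarrow> triple \<Rightarrow> real" where
  "yb_left q s \<rho> \<rho>s (a, a', m, b, b', l) (k, p, p') =
     (if p \<in> occ \<rho>s \<and> p' \<in> occ \<rho>
      then R_spec q \<rho> \<rho>s a a' p' p * wstar_spec q s \<rho>s m p k b * w_spec q s \<rho> k p' l b' else 0)"

fun yb_right :: "real \<Rightarrow> real \<Rightarrow> spec \<Rightarrow> spec \<Rightarrow> bdata \<Rightarrow> triple \<Rightarrow> real" where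
  "yb_right q s \<rho> \<rho>s (a, a', m, b, b', l) (n, t, t') =
     (if t \<in> occ \<rho> \<and> t' \<in> occ \<rho>s
      then wstar_spec q s \<rho>s n a' l t' * w_spec q s \<rho> m a n t * R_spec q \<rho> \<rho>s t t' b' b else 0)"

fun boundary_data :: "spec \<Rightarrow> spec \<Rightarrow> bdata \<Rightarrow> bool" where
  "boundary_data \<rho> \<rho>s (a, a', m, b, b', l) \<longleftrightarrow>
     a \<in> occ \<rho> \<and> a' \<in> occ \<rho>s \<and> b \<in> occ \<rho>s \<and> b' \<in> occ \<rho>"

definition positive_sums :: "real \<Rightarrow> real \<Rightarrow> spec \<Rightarrow> spec \<Rightarrow> bdata \<Rightarrow> bool" where
  "positive_sums q s \<rho> \<rho>s c \<longleftrightarrow>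
     (\<Sum>\<^sub>\<infinity>\<tau>. yb_left q s \<rho> \<rho>s c \<tau>) > 0 \<and> (\<Sum>\<^sub>\<infinity>\<sigma>. yb_right q s \<rho> \<rho>s c \<sigma>) > 0"

definition is_coupling ::
  "real \<Rightarrow> real \<Rightarrow> spec \<Rightarrow> spec \<Rightarrow> bdata \<Rightarrow> (triple \<times> triple) pmf \<Rightarrow> bool" where
  "is_coupling q s \<rho> \<rho>s c Q \<longleftrightarrow>
     (\<forall>\<tau>. pmf (map_pmf fst Q) \<tau> = yb_left q s \<rho> \<rho>s c \<tau> / (\<Sum>\<^sub>\<infinity>\<tau>'. yb_left q s \<rho> \<rho>s c \<tau>')) \<and>
     (\<forall>\<sigma>. pmf (map_pmf snd Q) \<sigma> = yb_right q s \<rho> \<rho>s c \<sigma> / (\<Sum>\<^sub>\<infinity>\<sigma>'. yb_right q s \<rho> \<rho>s c \<sigma>'))"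

definition cond_step :: "(triple \<times> triple) pmf \<Rightarrow> triple \<Rightarrow> triple \<Rightarrow> real" where
  "cond_step Q \<tau> \<sigma> = pmf Q (\<tau>, \<sigma>) / pmf (map_pmf fst Q) \<tau>"

text \<open>
  A Young diagram is the multiset of its (positive) parts: $l_i$ is \<open>count \<lambda> i\<close> and $\ell(\lambda)$
  is \<open>size \<lambda>\<close>.
\<close>

type_synonym diagram = "nat multiset"

definition tail_size :: "diagram \<Rightarrow> nat \<Rightarrow> nat" where
  "tail_size \<nu> h = size {# r \<in># \<nu>. h < r #}"

definition init_prob :: "real \<Rightarrow> spec \<Rightarrow> spec \<Rightarrow> nat \<Rightarrow> nat \<Rightarrow> nat \<times> nat \<Rightarrow> real" where
  "init_prob q \<rho> \<rho>s i i' = (\<lambda>(j, j').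
     if j \<in> occ \<rho> \<and> j' \<in> occ \<rho>s
     then b_spec q \<rho>s j' * b_spec q \<rho> j * R_spec q \<rho> \<rho>s j j' i' i
          / (Pi_spec q \<rho> \<rho>s * b_spec q \<rho>s i * b_spec q \<rho> i')
     else 0)"

text \<open>
  \<open>forward_prob q s \<rho> \<rho>s C \<kappa> \<mu> \<Lambda> \<nu> j H\<close> is the probability that the forward transition from
  \<open>\<kappa>\<close> given \<open>\<mu>\<close>, \<open>\<Lambda>\<close> selects \<open>(j\<^sub>h, j\<^sub>h') = j h\<close> for \<open>h \<le> H\<close> and \<open>n\<^sub>h = count \<nu> h\<close> for
  \<open>1 \<le> h \<le> H\<close>, where \<open>C c\<close> is the coupling used for the boundary data \<open>c\<close>.  The differences
  \<open>i h\<close>, \<open>i' h\<close> are nonnegative for all inputs that the field below takes with positive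
  probability, so that subtraction on the natural numbers is harmless.
\<close>

definition forward_prob ::
  "real \<Rightarrow> real \<Rightarrow> spec \<Rightarrow> spec \<Rightarrow> (bdata \<Rightarrow> (triple \<times> triple) pmf) \<Rightarrow>
   diagram \<Rightarrow> diagram \<Rightarrow> diagram \<Rightarrow> diagram \<Rightarrow> (nat \<Rightarrow> nat \<times> nat) \<Rightarrow> nat \<Rightarrow> real" where
  "forward_prob q s \<rho> \<rho>s C \<kappa> \<mu> \<Lambda> \<nu> j H =
     (let i = (\<lambda>h. tail_size \<mu> h - tail_size \<kappa> h);
          i' = (\<lambda>h. tail_size \<Lambda> h - tail_size \<kappa> h)
      in init_prob q \<rho> \<rho>s (i 0) (i' 0) (j 0) *
         (\<Prod>h = 1..H.
            cond_step
              (C (fst (j (h - 1)), snd (j (h - 1)), count \<mu> h, i h, i' h, count \<Lambda> h))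
              (count \<kappa> h, i (h - 1), i' (h - 1))
              (count \<nu> h, fst (j h), snd (j h))))"

text \<open>Extension of a configuration by empty diagrams to the indices \<open>x = -1\<close> and \<open>y = -1\<close>.\<close>

definition ext_empty :: "(nat \<Rightarrow> nat \<Rightarrow> diagram) \<Rightarrow> int \<Rightarrow> int \<Rightarrow> diagram" where
  "ext_empty f x y = (if x < 0 \<or> y < 0 then {#} else f (nat x) (nat y))"

text \<open>
  \<open>J x y h \<omega>\<close> is the pair \<open>(j\<^sub>h, j\<^sub>h')\<close> sampled in the forward transition producing \<open>\<eta> x y\<close>.  The
  probability formula is the sampling rule for the antidiagonal \<open>x + y = N\<close>: given the
  diagrams on the earlier antidiagonals, the diagrams on this one are independent outputs of the
  forward transition, each prescribed through its first \<open>H\<close> steps.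
\<close>

definition yb_field ::
  "'a measure \<Rightarrow> real \<Rightarrow> real \<Rightarrow> (nat \<Rightarrow> spec) \<Rightarrow> (nat \<Rightarrow> spec) \<Rightarrow>
   (nat \<Rightarrow> nat \<Rightarrow> 'a \<Rightarrow> diagram) \<Rightarrow> bool" where
  "yb_field M q s \<rho> \<rho>s \<eta> \<longleftrightarrow>
     prob_space M \<and>
     (\<forall>x y. \<eta> x y \<in> measurable M (count_space UNIV)) \<and>
     (\<forall>x y. \<forall>\<omega> \<in> space M. 0 \<notin># \<eta> x y \<omega>) \<and>
     (\<exists>C :: spec \<Rightarrow> spec \<Rightarrow> bdata \<Rightarrow> (triple \<times> triple) pmf.
      \<exists>J :: nat \<Rightarrow> nat \<Rightarrow> nat \<Rightarrow> 'a \<Rightarrow> nat \<times> nat.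
       (\<forall>x y c. boundary_data (\<rho> y) (\<rho>s x) c \<longrightarrow> positive_sums q s (\<rho> y) (\<rho>s x) c \<longrightarrow>
          is_coupling q s (\<rho> y) (\<rho>s x) c (C (\<rho> y) (\<rho>s x) c)) \<and>
       (\<forall>x y h. J x y h \<in> measurable M (count_space UNIV)) \<and>
       (AE \<omega> in M. \<forall>x y. \<forall>\<^sub>F h in sequentially. J x y h \<omega> = (0, 0)) \<and>
       (\<forall>N H f j.
          measure M {\<omega> \<in> space M.
              (\<forall>x y. x + y < N \<longrightarrow> \<eta> x y \<omega> = f x y) \<and>
              (\<forall>x y. x + y = N \<longrightarrow>
                 (\<forall>h \<in> {1..H}. count (\<eta> x y \<omega>) h = count (f x y) h) \<and>
                 (\<forall>h \<le> H. J x y h \<omega> = j x y h))}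
          = measure M {\<omega> \<in> space M. \<forall>x y. x + y < N \<longrightarrow> \<eta> x y \<omega> = f x y} *
            (\<Prod>(x, y) \<in> {(x, y). x + y = N}.
               forward_prob q s (\<rho> y) (\<rho>s x) (C (\<rho> y) (\<rho>s x))
                 (ext_empty f (int x - 1) (int y - 1)) (ext_empty f x (int y - 1))
                 (ext_empty f (int x - 1) y) (f x y) (j x y) H)))"

definition L6V :: "real \<Rightarrow> real \<Rightarrow> nat \<Rightarrow> nat \<Rightarrow> nat \<Rightarrow> nat \<Rightarrow> real" where
  "L6V q z i1 j1 i2 j2 =
     (if (i1, j1, i2, j2) = (0, 0, 0, 0) \<or> (i1, j1, i2, j2) = (1, 1, 1, 1) then 1
      else if (i1, j1, i2, j2) = (1, 0, 1, 0) then q * (1 - z) / (1 - q * z)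
      else if (i1, j1, i2, j2) = (1, 0, 0, 1) then (1 - q) / (1 - q * z)
      else if (i1, j1, i2, j2) = (0, 1, 0, 1) then (1 - z) / (1 - q * z)
      else if (i1, j1, i2, j2) = (0, 1, 1, 0) then z * (1 - q) / (1 - q * z)
      else 0)"

definition bern :: "real \<Rightarrow> nat \<Rightarrow> real" where
  "bern p k = (if k = 1 then p else if k = 0 then 1 - p else 0)"

text \<open>
  \<open>V x y\<close> and \<open>E x y\<close> are the numbers of paths entering the vertex \<open>(x, y)\<close>, \<open>x, y \<ge> 1\<close>, from below
  and from the left, so that the paths exiting it are \<open>V x (y + 1)\<close> (up) and \<open>E (x + 1) y\<close>
  (right).  Since the vertices are sampled independently given their inputs, the law of the
  configuration in a square is the product of the boundary and vertex probabilities.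
\<close>

definition six_vertex ::
  "'a measure \<Rightarrow> real \<Rightarrow> (nat \<Rightarrow> real) \<Rightarrow> (nat \<Rightarrow> real) \<Rightarrow> real \<Rightarrow> real \<Rightarrow>
   (nat \<Rightarrow> nat \<Rightarrow> 'a \<Rightarrow> nat) \<Rightarrow> (nat \<Rightarrow> nat \<Rightarrow> 'a \<Rightarrow> nat) \<Rightarrow> bool" where
  "six_vertex M q u v \<alpha> \<beta> V E \<longleftrightarrow>
     prob_space M \<and>
     (\<forall>x \<ge> 1. \<forall>y \<ge> 1. V x y \<in> measurable M (count_space UNIV) \<and>
                     E x y \<in> measurable M (count_space UNIV)) \<and>
     (\<forall>N f g.
        measure M {\<omega> \<in> space M.
            (\<forall>x \<in> {1..N}. V x 1 \<omega> = f x 1) \<and> (\<forall>y \<in> {1..N}. E 1 y \<omega> = g 1 y) \<and>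
            (\<forall>x \<in> {1..N}. \<forall>y \<in> {1..N}. V x (y + 1) \<omega> = f x (y + 1) \<and> E (x + 1) y \<omega> = g (x + 1) y)}
        = (\<Prod>x = 1..N. bern (v x * \<alpha> / (1 + v x * \<alpha>)) (f x 1)) *
          (\<Prod>y = 1..N. bern (1 / (1 + u y * \<beta>)) (g 1 y)) *
          (\<Prod>x = 1..N. \<Prod>y = 1..N.
             L6V q (u y * v x) (f x y) (g x y) (f x (y + 1)) (g (x + 1) y)))"

definition height_6V ::
  "(nat \<Rightarrow> nat \<Rightarrow> 'a \<Rightarrow> nat) \<Rightarrow> (nat \<Rightarrow> nat \<Rightarrow> 'a \<Rightarrow> nat) \<Rightarrow> nat \<Rightarrow> nat \<Rightarrow> 'a \<Rightarrow> int" where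
  "height_6V V E x y \<omega> = int (card {k \<in> {1..y}. E (x + 1) k \<omega> = 1}) - int (\<Sum>k = 1..x. V k 1 \<omega>)"

text \<open>
  Independence of random variables with different value types (the library's \<open>indep_var\<close>
  requires equal types), as independence of the generated sigma-algebras.
\<close>

definition indep_rv ::
  "'a measure \<Rightarrow> 'b measure \<Rightarrow> ('a \<Rightarrow> 'b) \<Rightarrow> 'c measure \<Rightarrow> ('a \<Rightarrow> 'c) \<Rightarrow> bool" where
  "indep_rv M S X T Y \<longleftrightarrow>
     X \<in> measurable M S \<and> Y \<in> measurable M T \<and>
     prob_space.indep_set M {X -` A \<inter> space M | A. A \<in> sets S} {Y -` B \<inter> space M | B. B \<in> sets T}"

end

theory Submission
  imports Defs
begin

text \<open>
  Only the lengths of the diagrams matter: conservation of paths gives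
  $\ell(\nu) = \ell(\mu) + j_0 = \ell(\lambda) + j_0'$, and $(j_0, j_0')$ is drawn from a law that
  depends on $i_0$, $i_0'$ alone, so that the lengths form a Markovian field with explicit transition
  probabilities.  For two sHL specializations these are the six vertex weights, read with
  $i_0$, $j_0'$ as vertical and $1 - i_0'$, $1 - j_0$ as horizontal edges.  On the two boundaries they
  are the Bernoulli weights, and at the origin the $q$-Poisson weight.

  Conservation is available only as long as the transition meets couplings of the two sides of the
  Yang-Baxter equation, that is, boundary data with positive sums.  The Yang-Baxter equation itself
  is not needed for this: the weights that occur are nonnegative with explicit supports, and
  positivity of a term on the left yields a positive term on the right by inspecting the occupation
  numbers.  The transition with given data has positive probability, hence this propagates from
  step to step.
\<close>

section \<open>Closed forms of the fused weights\<close>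

text \<open>The series in \<open>w\<close> and \<open>R\<close> never has to be summed. For an sHL
  specialization, and for sg on the boundary, where two of the three input diagrams are empty, all
  terms but one vanish, or the value is the limit of such a formula. The obstacle is degenerate
  parameters. For u_y = 0, v_x = 0, \<alpha> = 0 or \<beta> = 0 some weights vanish: a coupling is
  then available for part of the boundary data only, and the initial law divides by values of
  \<open>b\<close> that may be 0. The predicates \<open>wbad\<close> and \<open>Rbad\<close> list
  the vanishing entries, and \<open>adm\<close> says that two neighbouring diagrams avoid them and
  have positive \<open>b\<close>; this property is inherited by the output of a transition.
  Conservation at one level h relates a multiplicity to two successive occupation numbers. It yields
  the lengths only after summation from large h downwards, beyond all parts of the diagrams, where
  the occupation numbers are eventually 0 almost surely. The two laws are compared as products of
  one kernel \<open>kern\<close>, on triangles for the field and on squares for the vertex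
  model.\<close>

definition qp :: "real \<Rightarrow> real \<Rightarrow> nat \<Rightarrow> real" where
  "qp a q n = (\<Prod>i<n. 1 - a * q ^ i)"

lemma qp_0 [simp]: "qp a q 0 = 1"
  and qp_Suc: "qp a q (Suc n) = qp a q n * (1 - a * q ^ n)"
  by (simp_all add: qp_def)

lemma qpoch_of_nat: "qpoch a q (int n) = qp a q n"
proof -
  have "(\<Prod>i = 1..n. 1 - a * q ^ (i - 1)) = (\<Prod>i<n. 1 - a * q ^ i)"
    by (rule prod.reindex_bij_witness[of _ Suc "\<lambda>i. i - 1"]) auto
  then show ?thesis by (simp add: qpoch_def qp_def)
qed

lemma qpoch_diff: "m \<le> n \<Longrightarrow> qpoch a q (int n - int m) = qp a q (n - m)"
  using qpoch_of_nat[of a q "n - m"] by (simp add: of_nat_diff)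

lemma qpoch_0 [simp]: "qpoch a q 0 = 1"
  using qpoch_of_nat[of a q 0] by simp

lemma qpoch_neg:
  assumes "q \<noteq> 0"
  shows "qpoch a q (- int n) = (\<Prod>i<n. inverse (1 - a / q ^ Suc i))"
proof (cases "n = 0")
  case False
  have "(\<Prod>i = - int n..-1. inverse (1 - a * q powi i)) = (\<Prod>i<n. inverse (1 - a / q ^ Suc i))"
  proof (rule prod.reindex_bij_witness[of _ "\<lambda>i. - int (Suc i)" "\<lambda>i. nat (- i) - 1"])
    fix i assume i: "i \<in> {- int n..- 1}"
    then have "q powi i = inverse (q ^ Suc (nat (- i) - 1))"
      by (auto simp: power_int_def power_inverse simp del: power_Suc)
    then show "inverse (1 - a / q ^ Suc (nat (- i) - 1)) = inverse (1 - a * q powi i)"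
      by (simp add: divide_inverse)
  qed auto
  with False show ?thesis by (simp add: qpoch_def)
qed simp

lemma mult_power_less_one:
  assumes "0 < q" "q < 1" "a < (1::real)"
  shows "a * q ^ i < 1"
proof (cases "a \<le> 0")
  case True
  then have "a * q ^ i \<le> 0" using assms by (simp add: mult_nonpos_nonneg)
  then show ?thesis by simp
next
  case False
  have "a * q ^ i \<le> a * 1" using False assms by (intro mult_left_mono power_le_one) auto
  then show ?thesis using assms by simp
qed

lemma qp_q_pos: "0 < q \<Longrightarrow> q < 1 \<Longrightarrow> a < 1 \<Longrightarrow> 0 < qp a q n"
  unfolding qp_def by (intro prod_pos) (use mult_power_less_one[of q a] in simp)

lemma qp_q_neg: "0 < q \<Longrightarrow> a \<le> 0 \<Longrightarrow> 0 < qp a q n"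
proof (induction n)
  case (Suc n)
  then have "a * q ^ n \<le> 0" by (simp add: mult_nonpos_nonneg)
  with Suc show ?case by (simp add: qp_Suc)
qed simp

definition tri :: "nat \<Rightarrow> nat" where
  "tri n = n * (n - 1) div 2"

lemma tri_0 [simp]: "tri 0 = 0"
  by (simp add: tri_def)

lemma tri_Suc [simp]: "tri (Suc n) = tri n + n"
proof (cases n)
  case (Suc m)
  have "Suc n * n = n * (n - 1) + 2 * n" using Suc by (simp add: algebra_simps)
  then show ?thesis by (simp add: tri_def)
qed (simp add: tri_def)

lemma square_eq_tri: "n * n = n + 2 * tri n"
  by (induction n) auto

text \<open>Factor by factor 1 - q^(i - m) = - q^(i - m) (1 - q^(m - i)); the power q^(mn) on the
  left clears the negative exponents.\<close>

lemma qp_inverse_power: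
  assumes "q \<noteq> 0" "n \<le> m"
  shows "qp (q powi (- int m)) q n * q ^ (m * n) = (-1) ^ n * q ^ tri n * (\<Prod>i<n. 1 - q ^ (m - i))"
  using assms
proof (induction n)
  case (Suc n)
  have "q powi (- int m) * q ^ n * q ^ m = q ^ n"
    using Suc.prems by (simp add: power_int_minus field_simps)
  moreover have "q ^ m = q ^ n * q ^ (m - n)"
    using Suc.prems by (simp add: power_add[symmetric])
  ultimately have "(1 - q powi (- int m) * q ^ n) * q ^ m = - (q ^ n * (1 - q ^ (m - n)))"
    by (simp add: algebra_simps)
  note eq = this
  have "qp (q powi (- int m)) q (Suc n) * q ^ (m * Suc n)
      = (qp (q powi (- int m)) q n * q ^ (m * n)) * ((1 - q powi (- int m) * q ^ n) * q ^ m)"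
    by (simp only: qp_Suc mult_Suc_right power_add ac_simps)
  also have "\<dots> = ((-1) ^ n * q ^ tri n * (\<Prod>i<n. 1 - q ^ (m - i))) * - (q ^ n * (1 - q ^ (m - n)))"
    using Suc.IH Suc.prems by (simp add: eq)
  finally show ?case by (simp add: power_add)
qed simp

lemma qp_q_split: "n \<le> m \<Longrightarrow> (\<Prod>i<n. 1 - q ^ (m - i)) * qp q q (m - n) = qp q q m"
proof (induction n)
  case (Suc n)
  have "m - n = Suc (m - Suc n)" using Suc.prems by simp
  then have "qp q q (m - n) = qp q q (m - Suc n) * (1 - q ^ (m - n))"
    by (simp add: qp_Suc)
  with Suc show ?case by (simp add: algebra_simps)
qed simp

text \<open>The case m = n, where n * n = n + 2 * \<open>tri n\<close> lets one factor
  \<open>q ^ tri n\<close> cancel.\<close>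

lemma qp_inverse_power_self:
  assumes "q \<noteq> 0"
  shows "qp (q powi (- int n)) q n * q ^ (n + tri n) = (-1) ^ n * qp q q n"
proof -
  have split: "q ^ (n + tri n) * q ^ tri n = q ^ (n * n)"
    by (simp add: square_eq_tri power_add mult_2)
  have "qp (q powi (- int n)) q n * q ^ (n + tri n) * q ^ tri n
    = qp (q powi (- int n)) q n * q ^ (n * n)"
    by (simp only: split mult.assoc)
  also have "\<dots> = (-1) ^ n * q ^ tri n * (\<Prod>i<n. 1 - q ^ (n - i))"
    using assms by (rule qp_inverse_power) simp
  also have "(\<Prod>i<n. 1 - q ^ (n - i)) = qp q q n"
    using qp_q_split[of n n q] by simp
  finally have "qp (q powi (- int n)) q n * q ^ (n + tri n) * q ^ tri n = ((-1) ^ n * qp q q n) * q ^ tri n"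
    by (simp only: mult_ac)
  then show ?thesis by (rule mult_right_cancel[THEN iffD1, rotated]) (use assms in simp)
qed

lemma qp_eq_0: "k < n \<Longrightarrow> a * q ^ k = 1 \<Longrightarrow> qp a q n = 0"
  unfolding qp_def by (rule prod_zero) auto

lemma power_mult_power_int_eq_1:
  "q \<noteq> (0::real) \<Longrightarrow> int j + e + int k = 0 \<Longrightarrow> q ^ j * q powi e * q ^ k = 1"
proof -
  assume q: "q \<noteq> 0" and e: "int j + e + int k = 0"
  then have "e = - int (j + k)" by simp
  then have "q powi e = inverse (q ^ (j + k))" by (simp only: power_int_minus power_int_of_nat)
  with q show ?thesis by (simp add: power_add field_simps)
qed

text \<open>The factor of index k = - e - j is 1 - q^0. The two bounds say that 0 \<le> k < n - j,
  so it does occur in the product. This is what truncates the series.\<close>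

lemma qpoch_shift_eq_0:
  assumes "q \<noteq> 0" "int j + e \<le> 0" "int n + e > 0"
  shows "qpoch (q ^ j * q powi e) q (int n - int j) = 0"
proof -
  define k where "k = nat (- e - int j)"
  have k: "int j + e + int k = 0" using assms by (simp add: k_def)
  have "k < n - j" "j \<le> n" using k assms by linarith+
  then show ?thesis
    using qp_eq_0[of k "n - j" "q ^ j * q powi e" q] power_mult_power_int_eq_1[OF assms(1) k]
    by (simp add: qpoch_diff)
qed

text \<open>The factors with \<open>a1\<close>, \<open>b2\<close> and \<open>b3\<close> carry
  integer powers of q at the arguments that occur below, and together they annihilate every term
  except one.\<close>

lemma phi43_reg_single:
  assumes "k \<le> n"
    and "\<And>j. j \<le> n \<Longrightarrow> j \<noteq> k \<Longrightarrow>
      qpoch a1 q j * qpoch (q ^ j * b2) q (int n - int j) * qpoch (q ^ j * b3) q (int n - int j) = 0"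
  shows "phi43_reg n a1 a2 a3 b1 b2 b3 q z =
    z ^ k * (qp (q powi (- int n)) q k / qp q q k) * (qp a1 q k * qp (q ^ k * b1) q (n - k))
      * (qp a2 q k * qp (q ^ k * b2) q (n - k)) * (qp a3 q k * qp (q ^ k * b3) q (n - k))"
proof -
  let ?t = "\<lambda>j. z ^ j * (qpoch (q powi (- int n)) q j / qpoch q q j) *
        (qpoch a1 q j * qpoch (q ^ j * b1) q (int n - int j)) *
        (qpoch a2 q j * qpoch (q ^ j * b2) q (int n - int j)) *
        (qpoch a3 q j * qpoch (q ^ j * b3) q (int n - int j))"
  have "?t j = 0" if "j \<in> {0..n} - {k}" for j
    using assms(2)[of j] that by auto
  then have "sum ?t ({0..n} - {k}) = 0"
    by (intro sum.neutral) blast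
  then have "(\<Sum>j = 0..n. ?t j) = ?t k"
    using assms(1) by (subst sum.remove[of _ k]) (simp_all only: finite_atLeastAtMost atLeastAtMost_iff add_0_right le0 simp_thms)
  then show ?thesis using assms(1)
    by (simp add: phi43_reg_def qpoch_of_nat qpoch_diff)
qed

lemma phi43_reg_0: "phi43_reg 0 a1 a2 a3 b1 b2 b3 q z = 1"
  by (simp add: phi43_reg_def)

section \<open>Entries of the fused R matrix\<close>

lemma fused_R_right_zero:
  assumes q: "0 < q" "q < 1" and i: "i1 = i2 + j1"
    and z: "qpoch z q (int (j1 + i2)) \<noteq> 0" and a: "qpoch (q / X / z) q (int i1 - int j1) \<noteq> 0"
  shows "fused_R q z Y X i1 j1 i2 0 = qp q q i1 / qp q q i2 * qp (z * Y) q i2 / qp z q i1"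
proof -
  have q0: "q \<noteq> 0" using q by simp
  have a': "qp (q / X / z) q i2 \<noteq> 0" using a i by (simp add: qpoch_of_nat)
  have z': "qp z q i1 \<noteq> 0" using z i by (simp add: qpoch_of_nat add.commute del: of_nat_add)
  have pos: "qp q q n > 0" for n using q by (simp add: qp_q_pos)
  \<comment> \<open>With \<open>j2 = 0\<close> the parameter \<open>b2\<close> is q^(1 - i2), which
    kills all indices below \<open>i2\<close>. The factor (q/(Xz); q) of the last term cancels the
    one in the denominator of \<open>fused_R\<close>, since i1 - j1 = i2.\<close>
  have "phi43_reg i2 (q powi (- int i1)) (z * Y) (q / X / z) (1 / X) (q powi (1 + int 0 - int i2))
      (q powi (1 - int i1 - int 0) * Y) q q
    = q ^ i2 * (qp (q powi (- int i2)) q i2 / qp q q i2) * qp (q powi (- int i1)) q i2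
      * qp (z * Y) q i2 * qp (q / X / z) q i2"
    by (subst phi43_reg_single[of i2]) (use q0 in \<open>auto simp: qpoch_shift_eq_0\<close>)
  then have eq: "fused_R q z Y X i1 j1 i2 0 = qp q q j1 / (qp z q i1 * qp q q i2 * qp q q i2)
      * (q ^ (i1 * i2) * q ^ i2 * qp (q powi (- int i2)) q i2 * qp (q powi (- int i1)) q i2)
      * qp (z * Y) q i2"
    using a' i qpoch_of_nat[of z q "j1 + i2"] qpoch_of_nat[of "q / X / z" q i2]
    by (simp add: fused_R_def qpoch_of_nat add.commute[of j1])
  \<comment> \<open>The extra power \<open>q ^ tri i2\<close> makes both inverse power identities
    applicable; it is cancelled afterwards.\<close>
  have "q ^ tri i2 * (q ^ (i1 * i2) * q ^ i2 * qp (q powi (- int i2)) q i2 * qp (q powi (- int i1)) q i2)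
     = (qp (q powi (- int i2)) q i2 * q ^ (i2 + tri i2)) * (qp (q powi (- int i1)) q i2 * q ^ (i1 * i2))"
    by (simp add: power_add algebra_simps)
  also have "\<dots> = ((-1) ^ i2 * qp q q i2) * ((-1) ^ i2 * q ^ tri i2 * (\<Prod>i<i2. 1 - q ^ (i1 - i)))"
    using i by (subst qp_inverse_power_self[OF q0], subst qp_inverse_power[OF q0]) auto
  also have "\<dots> = q ^ tri i2 * (qp q q i2 * (\<Prod>i<i2. 1 - q ^ (i1 - i)))"
    by (simp add: power_mult_distrib[symmetric])
  finally have "q ^ (i1 * i2) * q ^ i2 * qp (q powi (- int i2)) q i2 * qp (q powi (- int i1)) q i2
     = qp q q i2 * (\<Prod>i<i2. 1 - q ^ (i1 - i))"
    using q0 by simp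
  moreover have "(\<Prod>i<i2. 1 - q ^ (i1 - i)) = qp q q i1 / qp q q j1"
    using qp_q_split[of i2 i1 q] pos[of j1] i by (simp add: field_simps)
  ultimately show ?thesis
    unfolding eq using pos[of i2] pos[of j1] z' by (simp add: field_simps)
qed

text \<open>For \<open>i2 = 0\<close> the series is 1. The symbol of index - \<open>j2\<close> in
  the denominator turns into the product of the factors 1 - q/(Xz)/q^(i + 1), and each of them times
  - q^i X z is 1 - zX q^i.\<close>

lemma fused_R_up_zero:
  assumes q: "0 < q" "q < 1" and i: "j1 = i1 + j2" and z0: "z \<noteq> 0" and X: "X \<noteq> 0"
    and z: "qpoch z q (int j1) \<noteq> 0" and a: "qpoch (q / X / z) q (int i1 - int j1) \<noteq> 0"
  shows "fused_R q z Y X i1 j1 0 j2 = qp q q j1 / qp q q j2 * qp (z * X) q j2 / qp z q j1"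
proof -
  have q0: "q \<noteq> 0" using q by simp
  have d: "int i1 - int j1 = - int j2" using i by simp
  have prod: "qpoch (q / X / z) q (int i1 - int j1) = (\<Prod>i<j2. inverse (1 - q / X / z / q ^ Suc i))"
    unfolding d using q0 by (rule qpoch_neg)
  have nz: "1 - q / X / z / q ^ Suc i \<noteq> 0" if "i < j2" for i
    using a that unfolding prod by auto
  have factor: "q ^ i * X * (- z) * (1 - q / X / z / q ^ Suc i) = 1 - z * X * q ^ i" if "i < j2" for i
    using q0 z0 X by (simp add: field_simps)
  have "q ^ tri n * X ^ n * (- z) ^ n * (\<Prod>i<n. 1 - q / X / z / q ^ Suc i) = qp (z * X) q n"
    if "n \<le> j2" for n
    using that
  proof (induction n)
    case (Suc n)
    have "q ^ tri (Suc n) * X ^ Suc n * (- z) ^ Suc n * (\<Prod>i<Suc n. 1 - q / X / z / q ^ Suc i)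
      = (q ^ tri n * X ^ n * (- z) ^ n * (\<Prod>i<n. 1 - q / X / z / q ^ Suc i))
        * (q ^ n * X * (- z) * (1 - q / X / z / q ^ Suc n))"
      by (simp only: tri_Suc power_add power_Suc prod.lessThan_Suc ac_simps)
    also have "q ^ n * X * (- z) * (1 - q / X / z / q ^ Suc n) = 1 - z * X * q ^ n"
      using Suc.prems by (intro factor) simp
    finally show ?case using Suc.IH Suc.prems
      by (simp only: qp_Suc)
  qed simp
  from this[of j2] have "q ^ tri j2 * X ^ j2 * (- z) ^ j2
      * inverse (qpoch (q / X / z) q (int i1 - int j1)) = qp (z * X) q j2"
    unfolding prod by (simp add: prod_inversef[symmetric] o_def del: power_Suc)
  moreover have "fused_R q z Y X i1 j1 0 j2 =
      (q ^ tri j2 * X ^ j2 * (- z) ^ j2 * inverse (qpoch (q / X / z) q (int i1 - int j1)))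
      * (qp q q j1 / (qp q q j2 * qp z q j1))"
    using i by (simp add: fused_R_def tri_def phi43_reg_0 qpoch_of_nat divide_inverse del: of_nat_add)
  ultimately show ?thesis by simp
qed

text \<open>The index 1 drops out because (q^0; q)_1 = 0.\<close>

lemma fused_R_00_11:
  assumes q: "0 < q" "q < 1"
  shows "fused_R q z q q 0 0 1 1 = z * (1 - q) / (1 - z)"
proof -
  have p1: "qpoch a q 1 = 1 - a" for a using qpoch_of_nat[of a q 1] by (simp add: qp_def)
  have "phi43_reg 1 (q powi (- int 0)) (z * q) (q / q / z) (1 / q) (q powi (1 + int 1 - int 1))
      (q powi (1 - int 0 - int 1) * q) q q = (1 - 1 / q) * (1 - q) * (1 - q)"
    by (subst phi43_reg_single[of 0]) (use q p1 in \<open>auto simp: le_Suc_eq qp_def\<close>)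
  then have "fused_R q z q q 0 0 1 1 = q * (- z) / ((1 - z) * (1 - q) * (1 - q)) * ((1 - 1 / q) * (1 - q) * (1 - q))"
    using qpoch_of_nat[of z q 1] qpoch_of_nat[of q q 1] by (simp add: fused_R_def qp_def)
  also have "1 - 1 / q = - (1 - q) / q" using q by (simp add: field_simps)
  finally have *: "fused_R q z q q 0 0 1 1 = q * (- z) / ((1 - z) * (1 - q) * (1 - q)) *
      (- (1 - q) / q * (1 - q) * (1 - q))" .
  have "q * (- z) / (x * w * w) * (- w / q * w * w) = z * w / x" if "w \<noteq> 0" for w x
    using that q by (cases "x = 0") (auto simp: field_simps)
  from this[of "1 - q" "1 - z"] show ?thesis
    unfolding * using q by linarith
qed

text \<open>The index 0 drops out: for Y = q the parameter \<open>b3\<close> is q^(-1) q = 1, so its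
  factor vanishes there.\<close>

lemma fused_R_11_11:
  assumes q: "0 < q" "q < 1" and z: "z \<noteq> 0" "z \<noteq> 1" "z * q \<noteq> 1"
  shows "fused_R q z q q 1 1 1 1 = q"
proof -
  have p1: "qpoch a q 1 = 1 - a" for a using qpoch_of_nat[of a q 1] by (simp add: qp_def)
  have p2: "qpoch a q 2 = (1 - a) * (1 - a * q)" for a
    using qpoch_of_nat[of a q 2] by (simp add: qp_def numeral_2_eq_2)
  have "phi43_reg 1 (q powi (- int 1)) (z * q) (q / q / z) (1 / q) (q powi (1 + int 1 - int 1))
      (q powi (1 - int 1 - int 1) * q) q q
     = q * ((1 - 1 / q) / (1 - q)) * (1 - 1 / q) * (1 - z * q) * (1 - 1 / z)"
    by (subst phi43_reg_single[of 1])
      (use q p1 in \<open>auto simp: le_Suc_eq qp_def power_int_minus inverse_eq_divide\<close>)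
  then have "fused_R q z q q 1 1 1 1 = q * q * (- z) * (1 - q) / ((1 - z) * (1 - z * q) * (1 - q) * (1 - q))
     * (q * ((1 - 1 / q) / (1 - q)) * (1 - 1 / q) * (1 - z * q) * (1 - 1 / z))"
    by (simp add: fused_R_def p1 p2)
  also have "\<dots> = q * q * (- z) / ((1 - z) * (1 - z * q) * (1 - q))
     * (q * ((1 - 1 / q) / (1 - q)) * (1 - 1 / q) * (1 - z * q) * (1 - 1 / z))"
    using q by simp
  also have "1 - 1 / q = - (1 - q) / q" using q by (simp add: field_simps)
  also have "1 - 1 / z = - (1 - z) / z" using z by (simp add: field_simps)
  finally have *: "fused_R q z q q 1 1 1 1 = q * q * (- z) / ((1 - z) * (1 - z * q) * (1 - q))
     * (q * (- (1 - q) / q / (1 - q)) * (- (1 - q) / q) * (1 - z * q) * (- (1 - z) / z))" .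
  have "q * q * (- z) / (x * y * w) * (q * (- w / q / w) * (- w / q) * y * (- x / z)) = q"
    if "w \<noteq> 0" "x \<noteq> 0" "y \<noteq> 0" for w x y
    using that q z by (simp add: field_simps)
  from this[of "1 - q" "1 - z" "1 - z * q"] show ?thesis
    unfolding * using q z by simp
qed

text \<open>The poles of the two Pochhammer symbols at \<open>u = 0\<close> cancel against \<open>u ^ g\<close>.\<close>

lemma qpoch_pole_cancel:
  assumes q: "0 < q" and s: "s \<noteq> 0" and u: "u \<noteq> 0" and nz: "\<And>i. i < g \<Longrightarrow> u \<noteq> s * q ^ Suc i"
  shows "u ^ g * qpoch (u / s) q (- int g) * qp (q * s / u) q g = (- s) ^ g * q ^ (tri g + g)"
proof -
  have eq: "qpoch (u / s) q (- int g) = (\<Prod>i<g. inverse (1 - u / s / q ^ Suc i))"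
    using q by (intro qpoch_neg) auto
  have "u ^ n * (\<Prod>i<n. inverse (1 - u / s / q ^ Suc i)) * qp (q * s / u) q n = (- s) ^ n * q ^ (tri n + n)"
    if "n \<le> g" for n
    using that
  proof (induction n)
    case (Suc n)
    have "u \<noteq> s * q ^ Suc n" using nz Suc.prems by auto
    moreover have "1 - u / s / q ^ Suc n = (s * q ^ Suc n - u) / (s * q ^ Suc n)"
      using q s by (simp add: field_simps)
    moreover have "u * (1 - q * s / u * q ^ n) = - (s * q ^ Suc n - u)"
      using u by (simp add: field_simps)
    moreover have "- (b - u) * inverse ((b - u) / b) = - b" if "u \<noteq> b" for b
      using that by (cases "b = 0") (auto simp: field_simps)
    ultimately have "(u * (1 - q * s / u * q ^ n)) * inverse (1 - u / s / q ^ Suc n) = - s * q ^ Suc n"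
      by (simp del: power_Suc)
    moreover have "u ^ Suc n * (\<Prod>i<Suc n. inverse (1 - u / s / q ^ Suc i)) * qp (q * s / u) q (Suc n)
      = (u ^ n * (\<Prod>i<n. inverse (1 - u / s / q ^ Suc i)) * qp (q * s / u) q n)
        * ((u * (1 - q * s / u * q ^ n)) * inverse (1 - u / s / q ^ Suc n))"
      by (simp only: qp_Suc power_Suc prod.lessThan_Suc ac_simps)
    ultimately have "u ^ Suc n * (\<Prod>i<Suc n. inverse (1 - u / s / q ^ Suc i)) * qp (q * s / u) q (Suc n)
      = (- s) ^ n * q ^ (tri n + n) * (- s * q ^ Suc n)"
      using Suc.IH Suc.prems by (simp only: Suc_leD)
    then show ?case by (simp add: power_add mult_ac del: prod.lessThan_Suc)
  qed simp
  then show ?thesis unfolding eq by blast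
qed

lemma fused_w_eq:
  "i1 + j1 = i2 + j2 \<Longrightarrow> fused_w q s u X i1 j1 i2 j2 =
     (-1) ^ (i1 + j2) * q ^ (i1 * (i1 - 1 + 2 * j1) div 2) * s powi (int j2 - int i1) * u ^ i1
        * qpoch (u / s) q (int j1 - int i2) * qp q q j1
        / (qp q q i1 * qp q q j2 * qp (s * u) q (j1 + i1))
        * phi43_reg i1 (q powi (- int i2)) (s * u * X) (q * s / u)
            (s\<^sup>2) (q powi (1 + int j2 - int i1)) (q powi (1 - int i2 - int j2) * X) q q"
  by (simp only: fused_w_def qpoch_of_nat simp_thms if_True)

context
  fixes q s u :: real
  assumes q: "0 < q" "q < 1" and s: "-1 < s" "s < 0" and u: "u \<noteq> 0"
begin

text \<open>In each of the four entries the term of index \<open>g\<close> is the only one left. The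
  condition \<open>nz\<close> excludes the poles of (u/s; q) at index - g, and \<open>su\<close>
  keeps the symbols (su; q) in the denominators positive.\<close>

lemma fused_w_sHL_closed:
  assumes nz: "\<And>i. i < g \<Longrightarrow> u \<noteq> s * q ^ Suc i" and su: "s * u < 1"
  shows fused_w_00: "fused_w q s u q g 0 g 0 = (1 - s * u * q ^ g) / (1 - s * u)"
    and fused_w_11: "fused_w q s u q g 1 g 1 = (u - s * q ^ g) / (1 - s * u)"
    and fused_w_10: "fused_w q s u q g 1 (Suc g) 0 = (1 - q ^ Suc g) / (1 - s * u)"
    and fused_w_01: "fused_w q s u q (Suc g) 0 g 1 = u * (1 - s\<^sup>2 * q ^ g) / (1 - s * u)"
proof -
  have q0: "q \<noteq> 0" using q by simp
  have pos: "qp q q n > 0" for n using q by (simp add: qp_q_pos)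
  have supos: "qp (s * u) q n > 0" for n using q su by (intro qp_q_pos) auto
  have p1: "qpoch a q 1 = 1 - a" for a using qpoch_of_nat[of a q 1] by (simp add: qp_def)
  have half: "g * (g - Suc 0) div 2 = tri g" "g * (g + 1) div 2 = tri g + g"
    using tri_Suc[of g] by (simp_all add: tri_def mult.commute)
  have shift: "qp (s * u * q) q g * (1 - s * u) = qp (s * u) q (Suc g)"
    unfolding qp_def by (subst prod.lessThan_Suc_shift) (simp add: mult_ac)
  have pole: "u ^ g * qpoch (u / s) q (- int g) * qp (q * s / u) q g = (- s) ^ g * q ^ (tri g + g)"
    using q s u nz by (intro qpoch_pole_cancel) auto
  \<comment> \<open>All four entries are rational in these letters. The relations below for
    \<open>A\<close>, \<open>B\<close>, \<open>S / U\<close> and for the product \<open>pole\<close>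
    are all that is needed to simplify them.\<close>
  define A where "A = qp (q powi (- int g)) q g"
  define B where "B = qp (q powi (- int (Suc g))) q g"
  define T where "T = q ^ tri g"
  define S where "S = qp (s * u * q) q g"
  define U where "U = qp (s * u) q g"
  define F where "F = qp q q g"
  define G where "G = q ^ g"
  define sg :: real where "sg = (-1) ^ g"
  have sgsg: "sg * sg = 1" by (simp add: sg_def flip: power_mult_distrib)
  have T: "T > 0" and G: "G > 0" and F: "F > 0" and U: "U > 0" 
    using q pos supos by (simp_all add: T_def G_def F_def U_def)
  have A: "A = sg * F / (G * T)"
    using qp_inverse_power_self[OF q0, of g] q0
    by (simp add: A_def sg_def F_def G_def T_def power_add field_simps)
  have B: "B = sg * F * (1 - q * G) / (1 - q) / (G * G * T)"
  proof -
    have "(\<Prod>i<g. 1 - q ^ (Suc g - i)) * qp q q 1 = qp q q (Suc g)"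
      using qp_q_split[of g "Suc g" q] by simp
    then have "(\<Prod>i<g. 1 - q ^ (Suc g - i)) = F * (1 - q * G) / (1 - q)"
      using q by (simp add: qp_Suc F_def G_def qp_def[of q q "Suc 0"] field_simps)
    moreover have "q ^ (Suc g * g) = G * G * T * T"
      by (simp add: square_eq_tri power_add mult_2 G_def T_def)
    ultimately have "B * (G * G * T * T) = sg * T * (F * (1 - q * G) / (1 - q))"
      using qp_inverse_power[OF q0, of g "Suc g"] by (simp add: B_def sg_def T_def)
    then have "T * (B * (G * G * T)) = T * (sg * F * (1 - q * G) / (1 - q))"
      by (simp add: mult_ac)
    then have "B * (G * G * T) = sg * F * (1 - q * G) / (1 - q)"
      by (rule mult_left_cancel[THEN iffD1, rotated]) (use T in simp)
    then show ?thesis using T G by (metis eq_divide_eq mult_pos_pos less_irrefl)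
  qed
  have US: "S * (1 - s * u) = U * (1 - s * u * G)"
    using shift by (simp add: S_def U_def G_def qp_Suc)
  have su': "1 - s * u \<noteq> 0" "1 - s * u * G \<noteq> 0"
  proof -
    show "1 - s * u \<noteq> 0" using su by simp
    have "qp (s * u) q (Suc g) \<noteq> 0" using supos[of "Suc g"] by simp
    then show "1 - s * u * G \<noteq> 0" by (simp add: qp_Suc G_def)
  qed
  have S: "S / U = (1 - s * u * G) / (1 - s * u)"
    using US su' U by (simp add: field_simps)
  have pole': "u ^ g * qpoch (u / s) q (- int g) * qp (q * s / u) q g = sg * s ^ g * T * G"
    unfolding pole by (simp add: sg_def T_def G_def power_add mult_ac flip: power_mult_distrib)
  have powi: "s powi (- int g) = inverse (s ^ g)" by (simp add: power_int_minus)
  have sne: "s \<noteq> 0" using s by simp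
  have half1: "q ^ (g * (g - 1 + 2 * 1) div 2) = T * G"
    using half by (cases g) (auto simp: T_def G_def power_add)
  have su1: "qp (s * u) q (1 + g) = U * (1 - s * u * G)"
    by (simp add: qp_Suc U_def G_def)
  have cancel: "x / y * a / x = a / y" if "x \<noteq> 0" for x y a :: real using that by simp
  define K where "K = 1 - q * G"
  define D where "D = 1 - s * u * G"
  have q1: "qp q q 1 = 1 - q" by (simp add: qp_def)
  show "fused_w q s u q g 0 g 0 = (1 - s * u * q ^ g) / (1 - s * u)"
  proof -
    have "phi43_reg g (q powi (- int g)) (s * u * q) (q * s / u) (s\<^sup>2) (q powi (1 + int 0 - int g))
        (q powi (1 - int g - int 0) * q) q q = G * (A / F) * A * S * qp (q * s / u) q g"
      by (subst phi43_reg_single[of g])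
        (use q0 in \<open>auto simp: qpoch_shift_eq_0 A_def F_def S_def G_def\<close>)
    then have "fused_w q s u q g 0 g 0 = sg * T * inverse (s ^ g) * u ^ g * qpoch (u / s) q (- int g)
       / (F * U) * (G * (A / F) * A * S * qp (q * s / u) q g)"
      by (simp add: fused_w_def half powi qpoch_of_nat F_def[symmetric] U_def[symmetric]
          T_def[symmetric] sg_def[symmetric])
    also have "\<dots> = sg * T * inverse (s ^ g) / F * (G * (A / F) * A)
        * (u ^ g * qpoch (u / s) q (- int g) * qp (q * s / u) q g) * (S / U)"
      by (simp add: divide_inverse mult_ac)
    also have "\<dots> = (sg * sg) * (sg * sg) * (S / U)"
      unfolding pole' A using T G F sne by (simp add: field_simps)
    finally show ?thesis by (simp add: sgsg S G_def)
  qed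
  show "fused_w q s u q g 1 g 1 = (u - s * q ^ g) / (1 - s * u)"
  proof -
    have "phi43_reg g (q powi (- int g)) (s * u * q) (q * s / u) (s\<^sup>2) (q powi (1 + int 1 - int g))
        (q powi (1 - int g - int 1) * q) q q = G * (A / F) * A * S * qp (q * s / u) q g"
    proof (subst phi43_reg_single[of g])
      fix j assume j: "j \<le> g" "j \<noteq> g"
      \<comment> \<open>Here \<open>b2\<close> is q^(2 - g), which misses the index g - 1. It is
        \<open>b3\<close> that equals q^(1 - g) and kills every index below g.\<close>
      have "q powi (1 - int g - int 1) * q = q powi (1 - int g)"
        using q0 by (simp add: power_int_minus power_int_diff field_simps)
      moreover have "qpoch (q ^ j * q powi (1 - int g)) q (int g - int j) = 0"
        using q0 j by (intro qpoch_shift_eq_0) auto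
      ultimately show "qpoch (q powi - int g) q (int j) * qpoch (q ^ j * q powi (1 + int 1 - int g)) q (int g - int j)
         * qpoch (q ^ j * (q powi (1 - int g - int 1) * q)) q (int g - int j) = 0" by simp
    qed (auto simp: A_def F_def S_def G_def)
    note phi = this
    \<comment> \<open>Passing from index - g to 1 - g removes the last inverse factor; for g = 0 it
      appends the first ordinary factor, with the same formula.\<close>
    have pole1: "qpoch (u / s) q (int 1 - int g) = qpoch (u / s) q (- int g) * (1 - u / s / G)"
    proof (cases g)
      case (Suc n)
      have "qpoch (u / s) q (- int g) * (1 - u / s / q ^ Suc n) = qpoch (u / s) q (- int n)"
        using nz[of n] s q unfolding Suc
        by (subst (1 2) qpoch_neg) (auto simp: field_simps)
      then show ?thesis by (simp add: Suc G_def)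
    qed (simp add: G_def p1)
    have exps: "(- 1 :: real) ^ (g + 1) = - sg" "s powi (int 1 - int g) = inverse (s ^ g) * s"
      using sne by (simp_all add: sg_def power_int_diff field_simps)
    have "fused_w q s u q g 1 g 1 = - sg * (T * G) * (inverse (s ^ g) * s) * u ^ g
        * (qpoch (u / s) q (- int g) * (1 - u / s / G)) * (1 - q)
       / (F * (1 - q) * (U * (1 - s * u * G))) * (G * (A / F) * A * S * qp (q * s / u) q g)"
      by (subst fused_w_eq, simp) (simp only: phi pole1 exps half1 su1 q1 F_def)
    also have "\<dots> = sg * (T * G) * inverse (s ^ g) / F * (G * (A / F) * A)
        * (u ^ g * qpoch (u / s) q (- int g) * qp (q * s / u) q g) * (S / U)
        * ((1 - q) / (1 - q)) * (- s * (1 - u / s / G) / (1 - s * u * G))"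
      by (simp add: divide_inverse mult_ac)
    also have "\<dots> = (sg * sg) * (sg * sg) * (S / U) * G * (- s * (1 - u / s / G) / (1 - s * u * G))"
      unfolding pole' A using T G F sne q by (simp add: field_simps)
    also have "\<dots> = G * (- s * (1 - u / s / G)) / (1 - s * u)"
      unfolding S sgsg using cancel[OF su'(2), of "1 - s * u" "G * (- s * (1 - u / s / G))"] by (simp add: mult_ac)
    also have "G * (- s * (1 - u / s / G)) = u - s * G"
      using G sne by (simp add: field_simps)
    finally show ?thesis by (simp add: G_def)
  qed
  show "fused_w q s u q g 1 (Suc g) 0 = (1 - q ^ Suc g) / (1 - s * u)"
  proof -
    have "phi43_reg g (q powi (- int (Suc g))) (s * u * q) (q * s / u) (s\<^sup>2) (q powi (1 + int 0 - int g))
        (q powi (1 - int (Suc g) - int 0) * q) q q = G * (A / F) * B * S * qp (q * s / u) q g"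
      by (subst phi43_reg_single[of g])
        (use q0 in \<open>auto simp: qpoch_shift_eq_0 A_def B_def F_def S_def G_def\<close>)
    note phi = this
    have exps: "(- 1 :: real) ^ (g + 0) = sg" "s powi (int 0 - int g) = inverse (s ^ g)"
      "qpoch (u / s) q (int 1 - int (Suc g)) = qpoch (u / s) q (- int g)"
      using powi by (simp_all add: sg_def)
    have "fused_w q s u q g 1 (Suc g) 0 = sg * (T * G) * inverse (s ^ g) * u ^ g * qpoch (u / s) q (- int g)
       * (1 - q) / (F * 1 * (U * (1 - s * u * G))) * (G * (A / F) * B * S * qp (q * s / u) q g)"
      by (subst fused_w_eq, simp) (simp only: phi exps half1 su1 q1 F_def qp_0)
    also have "\<dots> = sg * (T * G) * inverse (s ^ g) / F * (G * (A / F) * (B * (1 - q)))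
        * (u ^ g * qpoch (u / s) q (- int g) * qp (q * s / u) q g) * (S / U) / (1 - s * u * G)"
      by (simp add: divide_inverse mult_ac)
    also have "\<dots> = sg * (T * G) * inverse (s ^ g) / F * (G * (A / F) * (sg * F * K / (G * G * T)))
        * (u ^ g * qpoch (u / s) q (- int g) * qp (q * s / u) q g) * (S / U) / D"
      unfolding B K_def D_def using q by simp
    also have "\<dots> = (sg * sg) * (sg * sg) * (S / U) * K / D"
      unfolding pole' A using T G F sne by (simp add: field_simps)
    also have "\<dots> = (1 - q * G) / (1 - s * u)"
      unfolding S sgsg K_def D_def using cancel[OF su'(2), of "1 - s * u" "1 - q * G"] by simp
    finally show ?thesis by (simp add: G_def)
  qed
  show "fused_w q s u q (Suc g) 0 g 1 = u * (1 - s\<^sup>2 * q ^ g) / (1 - s * u)"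
  proof -
    have "phi43_reg (Suc g) (q powi (- int g)) (s * u * q) (q * s / u) (s\<^sup>2) (q powi (1 + int 1 - int (Suc g)))
        (q powi (1 - int g - int 1) * q) q q
        = G * (B / F) * (A * (1 - s\<^sup>2 * G)) * (S * (1 - q)) * (qp (q * s / u) q g * (1 - q))"
    proof (subst phi43_reg_single[of g])
      fix j assume j: "j \<le> Suc g" "j \<noteq> g"
      show "qpoch (q powi - int g) q (int j) * qpoch (q ^ j * q powi (1 + int 1 - int (Suc g))) q (int (Suc g) - int j)
         * qpoch (q ^ j * (q powi (1 - int g - int 1) * q)) q (int (Suc g) - int j) = 0"
      \<comment> \<open>Indices below g are killed by \<open>b2\<close>; the other one is g + 1,
        killed by \<open>a1\<close> = q^(- g).\<close>
      proof (cases "j < g")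
        case True
        then have "qpoch (q ^ j * q powi (1 - int g)) q (int (Suc g) - int j) = 0"
          using q0 by (intro qpoch_shift_eq_0) auto
        then show ?thesis by simp
      next
        case False
        then have "qpoch (q powi - int g) q (int j) = 0"
          using qp_eq_0[of g j "q powi - int g" q] j q0 by (simp add: qpoch_of_nat power_int_minus)
        then show ?thesis by simp
      qed
    next
      have "q ^ g * (q powi (1 + int 1 - int (Suc g))) = q"
        using q0 by (simp add: power_int_diff field_simps)
      moreover have "q ^ g * (q powi (1 - int g - int 1) * q) = q"
        using q0 by (simp add: power_int_diff power_int_minus field_simps)
      ultimately show "q ^ g * (qp (q powi - int (Suc g)) q g / qp q q g) *
          (qp (q powi - int g) q g * qp (q ^ g * s\<^sup>2) q (Suc g - g)) *
          (qp (s * u * q) q g * qp (q ^ g * q powi (1 + int 1 - int (Suc g))) q (Suc g - g)) *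
          (qp (q * s / u) q g * qp (q ^ g * (q powi (1 - int g - int 1) * q)) q (Suc g - g))
        = G * (B / F) * (A * (1 - s\<^sup>2 * G)) * (S * (1 - q)) * (qp (q * s / u) q g * (1 - q))"
        by (simp add: Suc_diff_le qp_Suc A_def B_def F_def S_def G_def mult_ac)
    qed auto
    note phi = this
    have exps: "(- 1 :: real) ^ (Suc g + 1) = sg" "s powi (int 1 - int (Suc g)) = inverse (s ^ g)"
      "qpoch (u / s) q (int 0 - int g) = qpoch (u / s) q (- int g)"
      "q ^ (Suc g * (Suc g - 1 + 2 * 0) div 2) = T * G" "qp (s * u) q (0 + Suc g) = U * (1 - s * u * G)"
      "qp q q (Suc g) = F * (1 - q * G)"
      using powi half by (simp_all add: sg_def T_def G_def U_def F_def power_add qp_Suc add.commute)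
    have "fused_w q s u q (Suc g) 0 g 1 = sg * (T * G) * inverse (s ^ g) * u ^ Suc g * qpoch (u / s) q (- int g) * 1
       / (F * (1 - q * G) * (1 - q) * (U * (1 - s * u * G)))
       * (G * (B / F) * (A * (1 - s\<^sup>2 * G)) * (S * (1 - q)) * (qp (q * s / u) q g * (1 - q)))"
      by (subst fused_w_eq, simp) (simp only: phi exps q1 qp_0)
    also have "u ^ Suc g = u * u ^ g" by simp
    finally have "fused_w q s u q (Suc g) 0 g 1 = sg * (T * G) * inverse (s ^ g) * (u * u ^ g) * qpoch (u / s) q (- int g)
       / (F * (1 - q * G) * (1 - q) * (U * (1 - s * u * G)))
       * (G * (B / F) * (A * (1 - s\<^sup>2 * G)) * (S * (1 - q)) * (qp (q * s / u) q g * (1 - q)))"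
      by simp
    also have "\<dots> = sg * (T * G) * inverse (s ^ g) / F * (G * (A / F) * (B * (1 - q) / (1 - q * G)))
        * (u ^ g * qpoch (u / s) q (- int g) * qp (q * s / u) q g) * (S / U) / (1 - s * u * G) 
        * ((1 - q) / (1 - q)) * u * (1 - s\<^sup>2 * G)"
      by (simp add: divide_inverse mult_ac)
    also have "B * (1 - q) / (1 - q * G) = sg * F / (G * G * T)"
    proof -
      have "1 - q * G \<noteq> 0" using pos[of "Suc g"] by (auto simp: qp_Suc G_def)
      moreover have "x * k / p / m * p / k = x / m" if "p \<noteq> 0" "k \<noteq> 0" for x k p m :: real
        using that by simp
      ultimately show ?thesis unfolding B using q by auto
    qed
    also have "sg * (T * G) * inverse (s ^ g) / F * (G * (A / F) * (sg * F / (G * G * T)))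
        * (u ^ g * qpoch (u / s) q (- int g) * qp (q * s / u) q g) * (S / U) / (1 - s * u * G) 
        * ((1 - q) / (1 - q)) * u * (1 - s\<^sup>2 * G)
      = (sg * sg) * (sg * sg) * (S / U) / (1 - s * u * G) * u * (1 - s\<^sup>2 * G)"
      unfolding pole' A using T G F sne q by (simp add: field_simps)
    also have "\<dots> = u * (1 - s\<^sup>2 * G) / (1 - s * u)"
      unfolding S sgsg using cancel[OF su'(2), of "1 - s * u" "u * (1 - s\<^sup>2 * G)"] su'(2)
      by (simp add: mult_ac)
    finally show ?thesis by (simp add: G_def)
  qed
qed

end

lemma fused_w_left_zero:
  assumes "q \<noteq> 0" "s \<noteq> 0"
  shows "fused_w q s u X 0 j1 i2 j2 =
    (if j1 = i2 + j2 then (- s) ^ j2 * qp (u / s) q j2 * qp q q j1 / (qp q q j2 * qp (s * u) q j1) else 0)"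
  using qpoch_of_nat[of q q "i2 + j2"] qpoch_of_nat[of "s * u" q "i2 + j2"]
  by (simp add: fused_w_def phi43_reg_0 qpoch_of_nat flip: power_mult_distrib)

section \<open>Limits along the specializations\<close>

lemma tendsto_qp [tendsto_intros]:
  "(f \<longlongrightarrow> a) F \<Longrightarrow> ((\<lambda>x. qp (f x) q n) \<longlongrightarrow> qp a q n) F"
  unfolding qp_def by (intro tendsto_intros)

lemma qp_zero [simp]: "qp 0 q n = 1"
  by (simp add: qp_def)

lemma convergent_prod_qpoch:
  assumes "0 < q" "q < 1"
  shows "convergent_prod (\<lambda>i. 1 - a * q ^ i :: real)"
proof -
  have "summable (\<lambda>i. norm (- (a * q ^ i)))"
    using assms by (auto simp: abs_mult power_abs intro!: summable_mult summable_geometric)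
  then have "abs_convergent_prod (\<lambda>i. 1 - a * q ^ i)"
    by (intro summable_imp_abs_convergent_prod) simp
  then show ?thesis
    by (rule abs_convergent_prod_imp_convergent_prod)
qed

lemma qpoch_inf_pos:
  assumes "0 < q" "q < 1" "a < 1"
  shows "0 < qpoch_inf a q"
  unfolding qpoch_inf_def
  by (intro less_0_prodinf convergent_prod_qpoch assms) (use mult_power_less_one[OF assms] in simp)

lemma qpoch_inf_split:
  assumes "0 < q" "q < 1" "a < 1"
  shows "qpoch_inf a q = (1 - a) * qpoch_inf (a * q) q"
proof -
  have "1 - a * q ^ i \<noteq> 0" for i using mult_power_less_one[OF assms, of i] by linarith
  then have "(\<Prod>i. 1 - a * q ^ Suc i) = qpoch_inf a q / (1 - a * q ^ 0)"
    using convergent_prod_qpoch[OF assms(1,2), of a] assms(3) unfolding qpoch_inf_def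
    by (intro prodinf_split_head) auto
  then have "qpoch_inf a q / (1 - a) = qpoch_inf (a * q) q" by (simp add: qpoch_inf_def mult_ac)
  then show ?thesis using assms by (simp add: field_simps)
qed

text \<open>On a closed interval around \<open>a\<close> the partial products converge uniformly, by
  the M-test with majorant (|a| + 1) q^n, and a uniform limit of continuous functions is
  continuous.\<close>

lemma isCont_qpoch_inf:
  assumes q: "0 < q" "q < 1" and a: "a < 1"
  shows "isCont (\<lambda>x. qpoch_inf x q) a"
proof -
  \<comment> \<open>Halfway between \<open>a\<close> and 1: the interval has \<open>a\<close> in its
    interior and stays below 1.\<close>
  define c where "c = (a + 1) / 2"
  let ?X = "{a - 1..c}"
  have c: "a < c" "c < 1" using a by (auto simp: c_def)
  have le: "\<bar>x\<bar> \<le> \<bar>a\<bar> + 1" if "x \<in> ?X" for x using that c by auto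
  have "uniformly_convergent_on ?X (\<lambda>N x. \<Sum>n<N. norm ((1 - x * q ^ n) - 1))"
  proof (rule Weierstrass_m_test'[where M = "\<lambda>n. (\<bar>a\<bar> + 1) * q ^ n"])
    fix n x assume "x \<in> ?X"
    with le q show "norm (norm ((1 - x * q ^ n) - 1)) \<le> (\<bar>a\<bar> + 1) * q ^ n"
      by (auto simp: abs_mult power_abs intro!: mult_right_mono)
  next
    show "summable (\<lambda>n. (\<bar>a\<bar> + 1) * q ^ n)"
      using q by (intro summable_mult summable_geometric) auto
  qed
  then have "uniformly_convergent_on ?X (\<lambda>N x. \<Prod>n<N. 1 - x * q ^ n)"
    by (intro uniformly_convergent_on_prod' continuous_intros) auto
  then have "uniform_limit ?X (\<lambda>N x. \<Prod>n<N. 1 - x * q ^ n) (\<lambda>x. lim (\<lambda>N. \<Prod>n<N. 1 - x * q ^ n)) sequentially"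
    by (simp add: uniformly_convergent_uniform_limit_iff)
  also have "?this \<longleftrightarrow> uniform_limit ?X (\<lambda>N x. \<Prod>n<N. 1 - x * q ^ n) (\<lambda>x. qpoch_inf x q) sequentially"
  proof (rule uniform_limit_cong')
    fix x assume "x \<in> ?X"
    then have "1 - x * q ^ i \<noteq> 0" for i using mult_power_less_one[OF q, of x i] c by simp
    then show "lim (\<lambda>N. \<Prod>n<N. 1 - x * q ^ n) = qpoch_inf x q"
      using convergent_prod_LIMSEQ[OF convergent_prod_qpoch[OF q, of x]]
      unfolding qpoch_inf_def by (intro limI) (simp add: LIMSEQ_lessThan_iff_atMost)
  qed simp
  finally have "continuous_on ?X (\<lambda>x. qpoch_inf x q)"
    by (rule uniform_limit_theorem[rotated]) (auto intro!: always_eventually continuous_intros)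
  then show ?thesis
    by (rule continuous_on_interior) (use c in \<open>simp add: interior_atLeastAtMost_real\<close>)
qed

lemma near_nontrivial: "near q \<rho> \<noteq> bot"
  by (cases \<rho>) (auto simp: filtermap_bot_iff prod_filter_eq_bot)

text \<open>Along sg the parameter X diverges, but u, uX and 1/X all have limits. The closed forms
  of \<open>b\<close>, \<open>R\<close> and Pi used below are continuous in these quantities, taken
  for the row and for the column.\<close>

fun lim_u :: "spec \<Rightarrow> real" where
  "lim_u (sHL u) = u"
| "lim_u (sg a) = 0"

fun lim_uX :: "real \<Rightarrow> spec \<Rightarrow> real" where
  "lim_uX q (sHL u) = u * q"
| "lim_uX q (sg a) = - a"

fun lim_Xinv :: "real \<Rightarrow> spec \<Rightarrow> real" where
  "lim_Xinv q (sHL u) = 1 / q"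
| "lim_Xinv q (sg a) = 0"

lemma sg_limits:
  "((\<lambda>p. fst p) \<longlongrightarrow> (a::real)) (at a \<times>\<^sub>F at_right (0::real))"
  "((\<lambda>p. snd p) \<longlongrightarrow> (0::real)) (at a \<times>\<^sub>F at_right (0::real))"
  "\<forall>\<^sub>F p in at a \<times>\<^sub>F at_right (0::real). snd p > 0"
  "\<forall>\<^sub>F p in at a \<times>\<^sub>F at_right (0::real). fst p \<noteq> a"
proof -
  show "((\<lambda>p. fst p) \<longlongrightarrow> (a::real)) (at a \<times>\<^sub>F at_right (0::real))"
    by (rule filterlim_compose[OF tendsto_ident_at filterlim_fst])
  show "((\<lambda>p. snd p) \<longlongrightarrow> (0::real)) (at a \<times>\<^sub>F at_right (0::real))"
    by (rule filterlim_compose[OF tendsto_ident_at filterlim_snd])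
  show "\<forall>\<^sub>F p in at a \<times>\<^sub>F at_right (0::real). snd p > 0"
    by (rule eventually_compose_filterlim[OF eventually_at_right_less filterlim_snd])
  show "\<forall>\<^sub>F p in at a \<times>\<^sub>F at_right (0::real). fst p \<noteq> a"
    by (rule eventually_compose_filterlim[OF eventually_neq_at_within filterlim_fst])
qed

lemma near_limits:
  shows near_lim_u: "((\<lambda>p. fst p) \<longlongrightarrow> lim_u \<rho>) (near q \<rho>)"
    and near_lim_uX: "((\<lambda>p. fst p * snd p) \<longlongrightarrow> lim_uX q \<rho>) (near q \<rho>)"
    and near_lim_Xinv: "((\<lambda>p. 1 / snd p) \<longlongrightarrow> lim_Xinv q \<rho>) (near q \<rho>)"
proof -
  have "((\<lambda>p. fst p) \<longlongrightarrow> lim_u \<rho>) (near q \<rho>) \<and> ((\<lambda>p. fst p * snd p) \<longlongrightarrow> lim_uX q \<rho>) (near q \<rho>)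
    \<and> ((\<lambda>p. 1 / snd p) \<longlongrightarrow> lim_Xinv q \<rho>) (near q \<rho>)"
  proof (cases \<rho>)
    case (sHL u)
    then show ?thesis by (auto simp: filterlim_filtermap intro!: tendsto_intros)
  next
    case (sg a)
    have "((\<lambda>p. - snd p * fst p) \<longlongrightarrow> - 0 * a) (at a \<times>\<^sub>F at_right (0::real))"
      by (intro tendsto_intros sg_limits)
    moreover have "((\<lambda>p. - fst p) \<longlongrightarrow> - a) (at a \<times>\<^sub>F at_right (0::real))"
      by (intro tendsto_intros sg_limits)
    then have "((\<lambda>p. - snd p * fst p * (1 / snd p)) \<longlongrightarrow> - a) (at a \<times>\<^sub>F at_right (0::real))"
      by (rule Lim_transform_eventually) (use sg_limits(3)[of a] in \<open>auto elim!: eventually_mono\<close>)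
    moreover have "((\<lambda>p. 1 / (1 / snd p)) \<longlongrightarrow> 0) (at a \<times>\<^sub>F at_right (0::real))"
      using sg_limits(2)[of a] by simp
    ultimately show ?thesis
      using sg by (simp add: filterlim_filtermap case_prod_unfold)
  qed
  then show "((\<lambda>p. fst p) \<longlongrightarrow> lim_u \<rho>) (near q \<rho>)" "((\<lambda>p. fst p * snd p) \<longlongrightarrow> lim_uX q \<rho>) (near q \<rho>)"
    "((\<lambda>p. 1 / snd p) \<longlongrightarrow> lim_Xinv q \<rho>) (near q \<rho>)" by auto
qed

lemma near_X: "q \<noteq> 0 \<Longrightarrow> \<forall>\<^sub>F p in near q \<rho>. snd p \<noteq> 0"
proof (cases \<rho>)
  case (sg a)
  then show ?thesis using sg_limits(3)[of a]
    by (auto simp: eventually_filtermap case_prod_unfold elim!: eventually_mono)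
qed (auto simp: eventually_filtermap)

lemma b_spec_eq: "b_spec q \<rho> k = (- lim_uX q \<rho>) ^ k * (qp (lim_Xinv q \<rho>) q k / qp q q k)"
  unfolding b_spec_def
proof (rule tendsto_Lim[OF near_nontrivial])
  have "((\<lambda>p. (- (fst p * snd p)) ^ k * (qp (1 / snd p) q k * inverse (qp q q k)))
     \<longlongrightarrow> (- lim_uX q \<rho>) ^ k * (qp (lim_Xinv q \<rho>) q k * inverse (qp q q k))) (near q \<rho>)"
    by (intro tendsto_intros near_limits)
  then show "((\<lambda>(u, X). fused_b q u X k) \<longlongrightarrow> (- lim_uX q \<rho>) ^ k * (qp (lim_Xinv q \<rho>) q k / qp q q k)) (near q \<rho>)"
    by (simp add: fused_b_def case_prod_unfold qpoch_of_nat divide_inverse)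
qed

lemma b_spec_sg: "b_spec q (sg a) k = a ^ k / qp q q k"
  by (simp add: b_spec_eq)

text \<open>For k = 1 this is - uq (1 - 1/q) / (1 - q) = u.\<close>

lemma b_spec_sHL:
  assumes "0 < q" "q < 1" "k \<in> {0, 1}"
  shows "b_spec q (sHL u) k = u ^ k"
  using assms by (auto simp: b_spec_eq qp_def field_simps)

section \<open>Limit of the normalization Pi\<close>

definition prod_lim :: "real \<Rightarrow> spec \<Rightarrow> spec \<Rightarrow> real" where
  "prod_lim q \<rho> \<rho>s = qpoch_inf (lim_u \<rho> * lim_uX q \<rho>s) q * qpoch_inf (lim_uX q \<rho> * lim_u \<rho>s) q
     / (qpoch_inf (lim_u \<rho> * lim_u \<rho>s) q * qpoch_inf (lim_uX q \<rho> * lim_uX q \<rho>s) q)"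

lemma near_prod_lims:
  shows "((\<lambda>p. fst (fst p) * fst (snd p)) \<longlongrightarrow> lim_u \<rho> * lim_u \<rho>s) (near q \<rho> \<times>\<^sub>F near q \<rho>s)"
    and "((\<lambda>p. fst (fst p) * (fst (snd p) * snd (snd p))) \<longlongrightarrow> lim_u \<rho> * lim_uX q \<rho>s) (near q \<rho> \<times>\<^sub>F near q \<rho>s)"
    and "((\<lambda>p. (fst (fst p) * snd (fst p)) * fst (snd p)) \<longlongrightarrow> lim_uX q \<rho> * lim_u \<rho>s) (near q \<rho> \<times>\<^sub>F near q \<rho>s)"
    and "((\<lambda>p. (fst (fst p) * snd (fst p)) * (fst (snd p) * snd (snd p))) \<longlongrightarrow> lim_uX q \<rho> * lim_uX q \<rho>s) (near q \<rho> \<times>\<^sub>F near q \<rho>s)"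
  by (intro tendsto_mult filterlim_compose[OF near_lim_u filterlim_fst] filterlim_compose[OF near_lim_u filterlim_snd]
      filterlim_compose[OF near_lim_uX filterlim_fst] filterlim_compose[OF near_lim_uX filterlim_snd])+

lemma Pi_spec_eq:
  assumes q: "0 < q" "q < 1"
    and less: "lim_u \<rho> * lim_u \<rho>s < 1" "lim_u \<rho> * lim_uX q \<rho>s < 1" "lim_uX q \<rho> * lim_u \<rho>s < 1" "lim_uX q \<rho> * lim_uX q \<rho>s < 1"
  shows "Pi_spec q \<rho> \<rho>s = prod_lim q \<rho> \<rho>s"
  unfolding Pi_spec_def
proof (rule tendsto_Lim)
  have nz: "qpoch_inf a q \<noteq> 0" if "a < 1" for a
    using qpoch_inf_pos[OF q that] by simp
  have "((\<lambda>p. qpoch_inf (fst (fst p) * (fst (snd p) * snd (snd p))) q * qpoch_inf ((fst (fst p) * snd (fst p)) * fst (snd p)) q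
     / (qpoch_inf (fst (fst p) * fst (snd p)) q * qpoch_inf ((fst (fst p) * snd (fst p)) * (fst (snd p) * snd (snd p))) q))
     \<longlongrightarrow> prod_lim q \<rho> \<rho>s) (near q \<rho> \<times>\<^sub>F near q \<rho>s)"
    unfolding prod_lim_def
    by (intro tendsto_intros isCont_tendsto_compose[OF isCont_qpoch_inf] near_prod_lims q less)
      (simp add: nz less)
  then show "((\<lambda>((u, X), v, Y). fused_Pi q u X v Y) \<longlongrightarrow> prod_lim q \<rho> \<rho>s) (near q \<rho> \<times>\<^sub>F near q \<rho>s)"
    by (simp add: fused_Pi_def case_prod_unfold mult_ac)
qed (simp add: prod_filter_eq_bot near_nontrivial)

text \<open>
  Along this approach_path the singularities of the formula for \<open>R\<close> are avoided, which makes the filter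
  in the definition of \<open>R_spec\<close> proper.
\<close>

fun approach_path :: "real \<Rightarrow> spec \<Rightarrow> real \<Rightarrow> real \<times> real" where
  "approach_path q (sHL u) t = (u + t, q)"
| "approach_path q (sg a) t = (- t * (a + t), 1 / t)"

text \<open>The index n stands for i1 - j1 in the last denominator of \<open>fused_R\<close>. The
  other symbol (uv; q) is handled separately: it is positive as soon as uv < 1.\<close>

abbreviation regular_along_path :: "real \<Rightarrow> spec \<Rightarrow> spec \<Rightarrow> int \<Rightarrow> bool" where
  "regular_along_path q \<rho> \<rho>s n \<equiv> \<forall>\<^sub>F t in at_right 0.
     fst (approach_path q \<rho> t) * fst (approach_path q \<rho>s t) \<noteq> 0 \<and>
     qpoch (q / snd (approach_path q \<rho> t) / (fst (approach_path q \<rho> t) * fst (approach_path q \<rho>s t))) q n \<noteq> 0"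

lemma filterlim_pathI: "filterlim g F G \<Longrightarrow> filterlim (f \<circ> g) (filtermap f F) G"
  unfolding filterlim_def by (subst filtermap_compose) (rule filtermap_mono)

lemma path_near: "filterlim (approach_path q \<rho>) (near q \<rho>) (at_right 0)"
proof -
  have shift: "filterlim (\<lambda>t. a + t) (at a) (at_right 0)" for a :: real
  proof -
    have "((\<lambda>t. a + t) \<longlongrightarrow> a + 0) (at_right 0)"
      by (intro tendsto_intros)
    moreover have "\<forall>\<^sub>F t in at_right 0. a + t \<in> UNIV \<and> a + t \<noteq> a"
      using eventually_at_right_less[of "0::real"] by eventually_elim simp
    ultimately show ?thesis by (simp add: filterlim_at)
  qed
  show ?thesis
  proof (cases \<rho>)
    case (sHL u)
    have eq: "approach_path q (sHL u) = (\<lambda>u'. (u', q)) \<circ> (\<lambda>t. u + t)"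
      by (rule ext) simp
    show ?thesis
      unfolding sHL near.simps eq by (rule filterlim_pathI[OF shift])
  next
    case (sg a)
    have eq: "approach_path q (sg a) = (\<lambda>(a', \<epsilon>). (- \<epsilon> * a', 1 / \<epsilon>)) \<circ> (\<lambda>t. (a + t, t))"
      by (rule ext) simp
    show ?thesis
      unfolding sg near.simps eq by (intro filterlim_pathI filterlim_Pair shift filterlim_ident)
  qed
qed

text \<open>Limits along a trivial filter are not unique. Besides a limit for g one therefore needs
  points off the singular set arbitrarily close to the specialization; \<open>ev\<close> provides
  them along the path. The predicate \<open>Q\<close> carries facts that hold near the limit point,
  such as X = q for sHL.\<close>

lemma R_spec_eqI:
  fixes g :: "(real \<times> real) \<times> real \<times> real \<Rightarrow> real"
  assumes lim: "(g \<longlongrightarrow> L) (near q \<rho> \<times>\<^sub>F near q \<rho>s)"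
    and eq: "\<And>u X v Y. u * v \<noteq> 0 \<Longrightarrow> X \<noteq> 0 \<Longrightarrow> qpoch (u * v) q (int (j1 + i2)) \<noteq> 0 \<Longrightarrow>
       qpoch (q / X / (u * v)) q (int i1 - int j1) \<noteq> 0 \<Longrightarrow> Q ((u, X), (v, Y)) \<Longrightarrow>
       fused_R q (u * v) Y X i1 j1 i2 j2 = g ((u, X), (v, Y))"
    and Q: "\<forall>\<^sub>F p in near q \<rho> \<times>\<^sub>F near q \<rho>s. Q p"
    and ev: "\<forall>\<^sub>F t in at_right 0. fst (approach_path q \<rho> t) * fst (approach_path q \<rho>s t) \<noteq> 0 \<and> snd (approach_path q \<rho> t) \<noteq> 0
       \<and> qpoch (fst (approach_path q \<rho> t) * fst (approach_path q \<rho>s t)) q (int (j1 + i2)) \<noteq> 0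
       \<and> qpoch (q / snd (approach_path q \<rho> t) / (fst (approach_path q \<rho> t) * fst (approach_path q \<rho>s t))) q (int i1 - int j1) \<noteq> 0"
  shows "R_spec q \<rho> \<rho>s i1 j1 i2 j2 = L"
  unfolding R_spec_def
proof (rule tendsto_Lim)
  let ?F = "near q \<rho> \<times>\<^sub>F near q \<rho>s"
  let ?P = "{((u, X), (v, Y)). u * v \<noteq> 0 \<and> X \<noteq> 0 \<and> qpoch (u * v) q (int (j1 + i2)) \<noteq> 0
     \<and> qpoch (q / X / (u * v)) q (int i1 - int j1) \<noteq> 0}"
  have path_lim: "filterlim (\<lambda>t. (approach_path q \<rho> t, approach_path q \<rho>s t)) ?F (at_right 0)"
    by (intro filterlim_Pair path_near)
  show "inf ?F (principal ?P) \<noteq> bot"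
  proof
    assume "inf ?F (principal ?P) = bot"
    then have "\<forall>\<^sub>F x in ?F. x \<notin> ?P"
      by (simp add: trivial_limit_def eventually_inf_principal)
    then have "\<forall>\<^sub>F t in at_right (0::real). (approach_path q \<rho> t, approach_path q \<rho>s t) \<notin> ?P"
      by (rule eventually_compose_filterlim[OF _ path_lim])
    with ev have "\<forall>\<^sub>F t in at_right (0::real). False"
      by eventually_elim (auto simp: case_prod_unfold)
    then show False by simp
  qed
  have "(g \<longlongrightarrow> L) (inf ?F (principal ?P))"
    using lim by (rule tendsto_mono[OF inf_le1])
  moreover have "\<forall>\<^sub>F p in ?F. p \<in> ?P \<longrightarrow> g p = (\<lambda>((u, X), v, Y). fused_R q (u * v) Y X i1 j1 i2 j2) p"
    using Q
  proof eventually_elim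
    case (elim p)
    obtain u X v Y where p: "p = ((u, X), (v, Y))"
      by (cases p, cases "fst p", cases "snd p") auto
    show ?case
      using elim unfolding p mem_Collect_eq prod.case
      by (intro impI, elim conjE, intro eq[symmetric])
  qed
  then have "\<forall>\<^sub>F p in inf ?F (principal ?P). g p = (\<lambda>((u, X), v, Y). fused_R q (u * v) Y X i1 j1 i2 j2) p"
    unfolding eventually_inf_principal .
  ultimately show "((\<lambda>((u, X), v, Y). fused_R q (u * v) Y X i1 j1 i2 j2) \<longlongrightarrow> L) (inf ?F (principal ?P))"
    by (rule Lim_transform_eventually)
qed

lemma path_limits:
  shows "((\<lambda>t. fst (approach_path q \<rho> t)) \<longlongrightarrow> lim_u \<rho>) (at_right 0)"
  by (rule filterlim_compose[OF near_lim_u path_near])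

text \<open>On the lines \<open>j2 = 0\<close> and \<open>i2 = 0\<close> the closed forms no longer
  contain the symbol with the removable singularities, and they are continuous wherever uv <
  1.\<close>

lemma R_spec_along_path:
  assumes q: "0 < q" "q < 1" and less: "lim_u \<rho> * lim_u \<rho>s < 1"
    and ev: "regular_along_path q \<rho> \<rho>s (int i1 - int j1)"
  shows R_spec_right_zero_gen: "i1 = i2 + j1 \<Longrightarrow> R_spec q \<rho> \<rho>s i1 j1 i2 0 =
      qp q q i1 / qp q q i2 * qp (lim_u \<rho> * lim_uX q \<rho>s) q i2 / qp (lim_u \<rho> * lim_u \<rho>s) q i1"
    and R_spec_up_zero_gen: "j1 = i1 + j2 \<Longrightarrow> R_spec q \<rho> \<rho>s i1 j1 0 j2 =
      qp q q j1 / qp q q j2 * qp (lim_uX q \<rho> * lim_u \<rho>s) q j2 / qp (lim_u \<rho> * lim_u \<rho>s) q j1"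
proof -
  have pos: "qp (lim_u \<rho> * lim_u \<rho>s) q n \<noteq> 0" for n
    using qp_q_pos[OF q less, of n] by simp
  have "((\<lambda>t. fst (approach_path q \<rho> t) * fst (approach_path q \<rho>s t)) \<longlongrightarrow> lim_u \<rho> * lim_u \<rho>s) (at_right 0)"
    by (intro tendsto_intros path_limits)
  then have "\<forall>\<^sub>F t in at_right 0. fst (approach_path q \<rho> t) * fst (approach_path q \<rho>s t) < 1"
    using less by (rule order_tendstoD)
  then have nz: "\<forall>\<^sub>F t in at_right 0. qpoch (fst (approach_path q \<rho> t) * fst (approach_path q \<rho>s t)) q (int n) \<noteq> 0" for n
  proof eventually_elim
    case (elim t)
    then show ?case using qp_q_pos[OF q elim, of n] by (simp only: qpoch_of_nat)
  qed
  have X: "\<forall>\<^sub>F t in at_right 0. snd (approach_path q \<rho> t) \<noteq> 0"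
    using q by (intro eventually_compose_filterlim[OF near_X path_near]) auto
  have ev': "\<forall>\<^sub>F t in at_right 0. fst (approach_path q \<rho> t) * fst (approach_path q \<rho>s t) \<noteq> 0 \<and> snd (approach_path q \<rho> t) \<noteq> 0
       \<and> qpoch (fst (approach_path q \<rho> t) * fst (approach_path q \<rho>s t)) q (int n) \<noteq> 0
       \<and> qpoch (q / snd (approach_path q \<rho> t) / (fst (approach_path q \<rho> t) * fst (approach_path q \<rho>s t))) q (int i1 - int j1) \<noteq> 0" for n
    using ev nz[of n] X by eventually_elim blast
  show "R_spec q \<rho> \<rho>s i1 j1 i2 0 =
      qp q q i1 / qp q q i2 * qp (lim_u \<rho> * lim_uX q \<rho>s) q i2 / qp (lim_u \<rho> * lim_u \<rho>s) q i1"
    if i: "i1 = i2 + j1"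
  proof -
    let ?g = "\<lambda>p. qp q q i1 / qp q q i2 * qp (fst (fst p) * (fst (snd p) * snd (snd p))) q i2
        / qp (fst (fst p) * fst (snd p)) q i1"
    have g: "(?g \<longlongrightarrow>
      qp q q i1 / qp q q i2 * qp (lim_u \<rho> * lim_uX q \<rho>s) q i2 / qp (lim_u \<rho> * lim_u \<rho>s) q i1)
      (near q \<rho> \<times>\<^sub>F near q \<rho>s)"
      by (intro tendsto_intros near_prod_lims pos)
    have "fused_R q (u * v) Y X i1 j1 i2 0 = ?g ((u, X), v, Y)"
      if "qpoch (u * v) q (int (j1 + i2)) \<noteq> 0" "qpoch (q / X / (u * v)) q (int i1 - int j1) \<noteq> 0"
      for u X v Y
      using fused_R_right_zero[OF q i that] by (simp only: fst_conv snd_conv mult.assoc)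
    then show ?thesis
      by (rule R_spec_eqI[where Q = "\<lambda>_. True", OF g _ always_eventually ev']) simp_all
  qed
  show "R_spec q \<rho> \<rho>s i1 j1 0 j2 =
      qp q q j1 / qp q q j2 * qp (lim_uX q \<rho> * lim_u \<rho>s) q j2 / qp (lim_u \<rho> * lim_u \<rho>s) q j1"
    if i: "j1 = i1 + j2"
  proof -
    let ?g = "\<lambda>p. qp q q j1 / qp q q j2 * qp (fst (fst p) * snd (fst p) * fst (snd p)) q j2
        / qp (fst (fst p) * fst (snd p)) q j1"
    have g: "(?g \<longlongrightarrow>
      qp q q j1 / qp q q j2 * qp (lim_uX q \<rho> * lim_u \<rho>s) q j2 / qp (lim_u \<rho> * lim_u \<rho>s) q j1)
      (near q \<rho> \<times>\<^sub>F near q \<rho>s)"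
      by (intro tendsto_intros near_prod_lims pos)
    have "fused_R q (u * v) Y X i1 j1 0 j2 = ?g ((u, X), v, Y)"
      if "u * v \<noteq> 0" "X \<noteq> 0" "qpoch (u * v) q (int (j1 + 0)) \<noteq> 0" "qpoch (q / X / (u * v)) q (int i1 - int j1) \<noteq> 0"
      for u X v Y
    proof -
      have "u * X * v = u * v * X" by (simp only: ac_simps)
      then show ?thesis
        using fused_R_up_zero[OF q i that(1,2), of Y] that(3,4) by (simp only: fst_conv snd_conv add_0_right simp_thms)
    qed
    then show ?thesis
      by (rule R_spec_eqI[where Q = "\<lambda>_. True", OF g _ always_eventually ev']) simp_all
  qed
qed

text \<open>For a < 0 each factor 1 - a q^i exceeds 1, whatever the sign of i.\<close>

lemma qpoch_pos_of_neg:
  assumes "0 < q" "a < 0"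
  shows "0 < qpoch a q n"
proof (cases "n \<ge> 0")
  case True
  then show ?thesis
    using qp_q_neg[of q a "nat n"] qpoch_of_nat[of a q "nat n"] assms by simp
next
  case False
  have "0 < 1 - a / q ^ i" for i
    using divide_neg_pos[of a "q ^ i"] assms zero_less_power[of q i] by linarith
  then have "0 < (\<Prod>i<nat (- n). inverse (1 - a / q ^ Suc i))"
    by (intro prod_pos) (simp only: inverse_positive_iff_positive)
  then show ?thesis
    using qpoch_neg[of q a "nat (- n)"] False assms by simp
qed

lemma qpoch_nz_of_neg: "0 < q \<Longrightarrow> a < 0 \<Longrightarrow> qpoch a q n \<noteq> 0"
  using qpoch_pos_of_neg[of q a n] by simp

text \<open>Signs on the paths: u is negative for sg and positive for sHL, and X is positive for
  both. Hence q/(X uv) is negative for a mixed pair, which then meets no singularity at any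
  index.\<close>

lemma path_sg_fst_neg:
  assumes "0 \<le> a"
  shows "\<forall>\<^sub>F t in at_right 0. fst (approach_path q (sg a) t) < 0 \<and> snd (approach_path q (sg a) t) > 0"
  using eventually_at_right_less[of 0]
proof eventually_elim
  case (elim t)
  then have "- t * (a + t) < 0" using assms by (intro mult_neg_pos) auto
  then show ?case using elim by simp
qed

lemma path_sHL_fst_pos:
  assumes "0 \<le> u" "0 < q"
  shows "\<forall>\<^sub>F t in at_right 0. fst (approach_path q (sHL u) t) > 0 \<and> snd (approach_path q (sHL u) t) > 0"
  using eventually_at_right_less[of 0]
proof eventually_elim
  case (elim t)
  then show ?case using assms by simp
qed

lemma R_spec_sg_sg:
  assumes "0 < q" "q < 1" "0 \<le> \<alpha>" "0 \<le> \<beta>"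
  shows "R_spec q (sg \<alpha>) (sg \<beta>) k k 0 0 = qp q q k"
proof -
  have "\<forall>\<^sub>F t in at_right 0. fst (approach_path q (sg \<alpha>) t) * fst (approach_path q (sg \<beta>) t) \<noteq> 0"
    using path_sg_fst_neg[OF assms(3), of q] path_sg_fst_neg[OF assms(4), of q] by eventually_elim auto
  then show ?thesis
    using assms by (subst R_spec_right_zero_gen) auto
qed

lemma R_spec_sg_sHL:
  assumes "0 < q" "q < 1" "0 \<le> \<alpha>" "0 \<le> v"
  shows "R_spec q (sg \<alpha>) (sHL v) (i + j) j i 0 = qp q q (i + j) / qp q q i"
proof -
  have "regular_along_path q (sg \<alpha>) (sHL v) (int (i + j) - int j)"
    using path_sg_fst_neg[OF assms(3), of q] path_sHL_fst_pos[OF assms(4,1)]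
    by eventually_elim (intro conjI qpoch_nz_of_neg divide_pos_neg mult_neg_pos divide_pos_pos,
      use assms in \<open>simp_all del: approach_path.simps\<close>)
  then show ?thesis
    using assms by (subst R_spec_right_zero_gen) auto
qed

lemma R_spec_sHL_sg:
  assumes "0 < q" "q < 1" "0 \<le> \<beta>" "0 \<le> u"
  shows "R_spec q (sHL u) (sg \<beta>) j (j + i) 0 i = qp q q (j + i) / qp q q i"
proof -
  have "regular_along_path q (sHL u) (sg \<beta>) (int j - int (j + i))"
    using path_sg_fst_neg[OF assms(3), of q] path_sHL_fst_pos[OF assms(4,1)]
    by eventually_elim (intro conjI qpoch_nz_of_neg divide_pos_neg mult_pos_neg divide_pos_pos,
      use assms in \<open>simp_all del: approach_path.simps\<close>)
  then show ?thesis
    using assms by (subst R_spec_up_zero_gen) auto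
qed

lemma mult_less_one: "0 \<le> u \<Longrightarrow> u < 1 \<Longrightarrow> 0 \<le> v \<Longrightarrow> v < 1 \<Longrightarrow> u * v < (1::real)"
  using mult_strict_mono[of u 1 v 1] by (cases "v = 0") auto

context
  fixes q u v :: real
  assumes q: "0 < q" "q < 1" and u: "0 \<le> u" "u < 1" and v: "0 \<le> v" "v < 1"
begin

text \<open>Here X = q, so the symbol is (1/z; q)_n with 1/z > 1. Occupation numbers in {0, 1}
  differ by -1, 0 or 1, and for these indices only 1 - 1/z and 1 - 1/(zq) matter.\<close>

lemma path_sHL_sHL:
  assumes "n \<in> {-1, 0, 1}"
  shows "regular_along_path q (sHL u) (sHL v) n"
proof -
  have "((\<lambda>t. (u + t) * (v + t)) \<longlongrightarrow> (u + 0) * (v + 0)) (at_right (0::real))"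
    by (intro tendsto_intros)
  then have "\<forall>\<^sub>F t in at_right 0. (u + t) * (v + t) < 1"
    by (rule order_tendstoD) (use u v mult_less_one[of u v] in simp)
  with eventually_at_right_less[of 0] show ?thesis
  proof eventually_elim
    case (elim t)
    define z where "z = (u + t) * (v + t)"
    have z: "0 < z" "z < 1" using elim u v by (auto simp: z_def add_nonneg_pos)
    have "1 / z > 1" using z by simp
    moreover have "1 / z / q > 1" using z q mult_less_one[of z q] by (simp add: field_simps)
    moreover have "qpoch (1 / z) q 1 = 1 - 1 / z" "qpoch (1 / z) q (-1) = inverse (1 - 1 / z / q)"
      using qpoch_of_nat[of "1 / z" q 1] qpoch_neg[of q "1 / z" 1] q by (simp_all add: qp_def)
    ultimately have "qpoch (1 / z) q n \<noteq> 0" using assms by auto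
    then show ?case using z q elim u v by (auto simp: z_def)
  qed
qed

lemma R_spec_sHL_sHL:
  shows "R_spec q (sHL u) (sHL v) 0 0 0 0 = 1"
    and "R_spec q (sHL u) (sHL v) 1 1 0 0 = (1 - q) / (1 - u * v)"
    and "R_spec q (sHL u) (sHL v) 0 1 0 1 = (1 - u * v * q) / (1 - u * v)"
    and "R_spec q (sHL u) (sHL v) 1 0 1 0 = (1 - u * v * q) / (1 - u * v)"
    and "R_spec q (sHL u) (sHL v) 0 0 1 1 = u * v * (1 - q) / (1 - u * v)"
    and "R_spec q (sHL u) (sHL v) 1 1 1 1 = q"
proof -
  have z: "u * v < 1" using mult_less_one[of u v] u v by simp
  have qp1: "qp a q 1 = 1 - a" for a by (simp add: qp_def)
  show "R_spec q (sHL u) (sHL v) 0 0 0 0 = 1"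
    using R_spec_right_zero_gen[OF q _ path_sHL_sHL, of 0 0 0] z by simp
  show "R_spec q (sHL u) (sHL v) 1 1 0 0 = (1 - q) / (1 - u * v)"
    using R_spec_right_zero_gen[OF q _ path_sHL_sHL, of 1 1 0] z qp1 by simp
  show "R_spec q (sHL u) (sHL v) 0 1 0 1 = (1 - u * v * q) / (1 - u * v)"
    using R_spec_up_zero_gen[OF q _ path_sHL_sHL, of 0 1 1] z qp1 q by (simp add: mult_ac)
  show "R_spec q (sHL u) (sHL v) 1 0 1 0 = (1 - u * v * q) / (1 - u * v)"
    using R_spec_right_zero_gen[OF q _ path_sHL_sHL, of 1 0 1] z qp1 q by (simp add: mult_ac)
  \<comment> \<open>The last two entries lie on neither of the two lines. Their closed forms require
    X = Y = q, which holds throughout the neighbourhoods of sHL points.\<close>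
  have lim: "((\<lambda>p. fst (fst p) * fst (snd p)) \<longlongrightarrow> u * v) (near q (sHL u) \<times>\<^sub>F near q (sHL v))"
    using near_prod_lims(1)[of "sHL u" "sHL v"] by simp
  have path0: "((\<lambda>t. fst (approach_path q (sHL u) t) * fst (approach_path q (sHL v) t)) \<longlongrightarrow> u * v) (at_right 0)"
    using tendsto_mult[OF path_limits[of q "sHL u"] path_limits[of q "sHL v"]] by simp
  have ev: "\<forall>\<^sub>F t in at_right 0. fst (approach_path q (sHL u) t) * fst (approach_path q (sHL v) t) \<noteq> 0
       \<and> snd (approach_path q (sHL u) t) \<noteq> 0
       \<and> qpoch (fst (approach_path q (sHL u) t) * fst (approach_path q (sHL v) t)) q (int n) \<noteq> 0
       \<and> qpoch (q / snd (approach_path q (sHL u) t) / (fst (approach_path q (sHL u) t) * fst (approach_path q (sHL v) t))) q 0 \<noteq> 0" for n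
    using path_sHL_sHL[of 0, simplified] order_tendstoD(2)[OF path0 z]
  proof eventually_elim
    case (elim t)
    then show ?case
      using q qp_q_pos[OF q, of "fst (approach_path q (sHL u) t) * fst (approach_path q (sHL v) t)" n]
      by (simp add: qpoch_of_nat del: mult_eq_0_iff)
  qed
  have X: "\<forall>\<^sub>F p in near q (sHL u). snd p = q" for u
    by (simp add: eventually_filtermap)
  have "\<forall>\<^sub>F p in near q (sHL u) \<times>\<^sub>F near q (sHL v). snd (fst p) = q"
    by (rule eventually_compose_filterlim[OF X filterlim_fst])
  moreover have "\<forall>\<^sub>F p in near q (sHL u) \<times>\<^sub>F near q (sHL v). snd (snd p) = q"
    by (rule eventually_compose_filterlim[OF X filterlim_snd])
  ultimately have Q: "\<forall>\<^sub>F p in near q (sHL u) \<times>\<^sub>F near q (sHL v).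
      snd (fst p) = q \<and> snd (snd p) = q \<and> fst (fst p) * fst (snd p) < 1"
    using order_tendstoD(2)[OF lim z] by eventually_elim (intro conjI)
  show "R_spec q (sHL u) (sHL v) 0 0 1 1 = u * v * (1 - q) / (1 - u * v)"
  proof -
    let ?g = "\<lambda>p. fst (fst p) * fst (snd p) * (1 - q) / (1 - fst (fst p) * fst (snd p))"
    have g: "(?g \<longlongrightarrow> u * v * (1 - q) / (1 - u * v)) (near q (sHL u) \<times>\<^sub>F near q (sHL v))"
      by (intro tendsto_intros lim) (use z in simp)
    have "fused_R q (u' * v') q q 0 0 1 1 = u' * v' * (1 - q) / (1 - u' * v')" for u' v'
      by (rule fused_R_00_11[OF q])
    then show ?thesis
      using ev[of 1] by (intro R_spec_eqI[OF g _ Q]) simp_all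
  qed
  show "R_spec q (sHL u) (sHL v) 1 1 1 1 = q"
  proof -
    have "fused_R q (u' * v') q q 1 1 1 1 = q" if "u' * v' \<noteq> 0" "u' * v' < 1" for u' v'
      using that q mult_power_less_one[of q "u' * v'" 1] by (intro fused_R_11_11) auto
    then show ?thesis
      using ev[of 2] by (intro R_spec_eqI[OF tendsto_const _ Q]) simp_all
  qed
qed

end

lemma w_spec_sHL_eqI:
  assumes "\<forall>\<^sub>F u' in at u. fused_w q s u' q i1 j1 i2 j2 = f u'" "(f \<longlongrightarrow> L) (at u)"
  shows "w_spec q s (sHL u) i1 j1 i2 j2 = L"
  unfolding w_spec_def
proof (rule tendsto_Lim[OF near_nontrivial])
  have "((\<lambda>u'. fused_w q s u' q i1 j1 i2 j2) \<longlongrightarrow> L) (at u)"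
    using assms(2) by (rule Lim_transform_eventually) (use assms(1) in \<open>simp add: eq_commute\<close>)
  then show "((\<lambda>(u, X). fused_w q s u X i1 j1 i2 j2) \<longlongrightarrow> L) (near q (sHL u))"
    by (simp add: filterlim_filtermap)
qed

lemma w_spec_not_conserved:
  assumes "i1 + j1 \<noteq> i2 + j2"
  shows "w_spec q s \<rho> i1 j1 i2 j2 = 0"
proof -
  have eq: "(\<lambda>(u, X). fused_w q s u X i1 j1 i2 j2) = (\<lambda>_. 0)"
    using assms by (auto simp: fused_w_def)
  show ?thesis
    unfolding w_spec_def eq by (rule tendsto_Lim[OF near_nontrivial tendsto_const])
qed

section \<open>Signs and zeros of the specialized weights\<close>

definition valid :: "spec \<Rightarrow> bool" where
  "valid \<rho> = (case \<rho> of sHL u \<Rightarrow> 0 \<le> u \<and> u < 1 | sg a \<Rightarrow> 0 \<le> a)"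

lemma valid_simps [simp]: "valid (sHL u) \<longleftrightarrow> 0 \<le> u \<and> u < 1" "valid (sg a) \<longleftrightarrow> 0 \<le> a"
  by (simp_all add: valid_def)

fun is_sg :: "spec \<Rightarrow> bool" where
  "is_sg (sHL u) = False"
| "is_sg (sg a) = True"


text \<open>Among the conserved entries in use this is the one that can vanish: it carries the
  factor u, see \<open>w_spec_01\<close>.\<close>

definition wbad :: "spec \<Rightarrow> nat \<Rightarrow> nat \<Rightarrow> bool" where
  "wbad \<rho> j1 j2 \<longleftrightarrow> \<rho> = sHL 0 \<and> j1 = 0 \<and> j2 = 1"

text \<open>The entry (0, 0; 1, 1) equals uv (1 - q) / (1 - uv); no other entry in use has a factor
  that vanishes at u = 0 or v = 0.\<close>

definition Rbad :: "spec \<Rightarrow> spec \<Rightarrow> nat \<Rightarrow> nat \<Rightarrow> nat \<Rightarrow> nat \<Rightarrow> bool" where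
  "Rbad \<rho> \<rho>s i1 j1 i2 j2 \<longleftrightarrow> \<not> is_sg \<rho> \<and> \<not> is_sg \<rho>s \<and> (\<rho> = sHL 0 \<or> \<rho>s = sHL 0)
     \<and> i1 = 0 \<and> j1 = 0 \<and> i2 = 1 \<and> j2 = 1"

locale yb_params =
  fixes q s :: real
  assumes q: "0 < q" "q < 1" and s: "-1 < s" "s < 0"
begin

lemma w_spec_sHL:
  assumes u: "0 \<le> u"
  shows w_spec_00: "w_spec q s (sHL u) g 0 g 0 = (1 - s * u * q ^ g) / (1 - s * u)"
    and w_spec_11: "w_spec q s (sHL u) g 1 g 1 = (u - s * q ^ g) / (1 - s * u)"
    and w_spec_10: "w_spec q s (sHL u) g 1 (Suc g) 0 = (1 - q ^ Suc g) / (1 - s * u)"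
    and w_spec_01: "w_spec q s (sHL u) (Suc g) 0 g 1 = u * (1 - s\<^sup>2 * q ^ g) / (1 - s * u)"
proof -
  have id: "((\<lambda>u'. u') \<longlongrightarrow> u) (at u)" by (rule tendsto_ident_at)
  have "((\<lambda>u'. s * u') \<longlongrightarrow> s * u) (at u)" by (intro tendsto_intros)
  moreover have su: "s * u < 1"
    using u s mult_nonpos_nonneg[of s u] by simp
  ultimately have "\<forall>\<^sub>F u' in at u. s * u' < 1" by (rule order_tendstoD)
  \<comment> \<open>All poles s q^(i + 1) with i < g lie below this negative number, so a
    neighbourhood of u \<ge> 0 avoids them.\<close>
  moreover have "s * q ^ Suc g < u"
    using mult_neg_pos[OF s(2), of "q ^ Suc g"] q u by simp
  then have "\<forall>\<^sub>F u' in at u. s * q ^ Suc g < u'" by (rule order_tendstoD(1)[OF id])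
  moreover have "\<forall>\<^sub>F u' in at u. u' \<noteq> 0"
  proof (cases "u = 0")
    case True
    then show ?thesis using eventually_neq_at_within[of 0 "0::real" UNIV] by simp
  next
    case False
    then show ?thesis by (rule tendsto_imp_eventually_ne[OF id])
  qed
  ultimately have ev: "\<forall>\<^sub>F u' in at u. u' \<noteq> 0 \<and> (\<forall>i<g. u' \<noteq> s * q ^ Suc i) \<and> s * u' < 1"
  proof eventually_elim
    case (elim u')
    have "u' \<noteq> s * q ^ Suc i" if "i < g" for i
    proof -
      have "q ^ Suc g \<le> q ^ Suc i"
        using that q by (intro power_decreasing) auto
      then have "s * q ^ Suc i \<le> s * q ^ Suc g"
        using s by (intro mult_left_mono_neg) auto
      then show ?thesis using elim by linarith
    qed
    then show ?case using elim by blast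
  qed
  have nz: "1 - s * u \<noteq> 0" using su by simp
  have closed: "fused_w q s u' q g 0 g 0 = (1 - s * u' * q ^ g) / (1 - s * u')"
    if "u' \<noteq> 0 \<and> (\<forall>i<g. u' \<noteq> s * q ^ Suc i) \<and> s * u' < 1" for u'
    using that q s by (intro fused_w_00) auto
  have lim: "((\<lambda>u'. (1 - s * u' * q ^ g) / (1 - s * u')) \<longlongrightarrow> (1 - s * u * q ^ g) / (1 - s * u)) (at u)"
    by (intro tendsto_intros nz)
  show "w_spec q s (sHL u) g 0 g 0 = (1 - s * u * q ^ g) / (1 - s * u)"
    by (rule w_spec_sHL_eqI[OF eventually_mono[OF ev closed] lim])
  have closed: "fused_w q s u' q g 1 g 1 = (u' - s * q ^ g) / (1 - s * u')"
    if "u' \<noteq> 0 \<and> (\<forall>i<g. u' \<noteq> s * q ^ Suc i) \<and> s * u' < 1" for u'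
    using that q s by (intro fused_w_11) auto
  have lim: "((\<lambda>u'. (u' - s * q ^ g) / (1 - s * u')) \<longlongrightarrow> (u - s * q ^ g) / (1 - s * u)) (at u)"
    by (intro tendsto_intros nz)
  show "w_spec q s (sHL u) g 1 g 1 = (u - s * q ^ g) / (1 - s * u)"
    by (rule w_spec_sHL_eqI[OF eventually_mono[OF ev closed] lim])
  have closed: "fused_w q s u' q g 1 (Suc g) 0 = (1 - q ^ Suc g) / (1 - s * u')"
    if "u' \<noteq> 0 \<and> (\<forall>i<g. u' \<noteq> s * q ^ Suc i) \<and> s * u' < 1" for u'
    using that q s by (intro fused_w_10) auto
  have lim: "((\<lambda>u'. (1 - q ^ Suc g) / (1 - s * u')) \<longlongrightarrow> (1 - q ^ Suc g) / (1 - s * u)) (at u)"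
    by (intro tendsto_intros nz)
  show "w_spec q s (sHL u) g 1 (Suc g) 0 = (1 - q ^ Suc g) / (1 - s * u)"
    by (rule w_spec_sHL_eqI[OF eventually_mono[OF ev closed] lim])
  have closed: "fused_w q s u' q (Suc g) 0 g 1 = u' * (1 - s\<^sup>2 * q ^ g) / (1 - s * u')"
    if "u' \<noteq> 0 \<and> (\<forall>i<g. u' \<noteq> s * q ^ Suc i) \<and> s * u' < 1" for u'
    using that q s by (intro fused_w_01) auto
  have lim: "((\<lambda>u'. u' * (1 - s\<^sup>2 * q ^ g) / (1 - s * u')) \<longlongrightarrow> u * (1 - s\<^sup>2 * q ^ g) / (1 - s * u)) (at u)"
    by (intro tendsto_intros nz)
  show "w_spec q s (sHL u) (Suc g) 0 g 1 = u * (1 - s\<^sup>2 * q ^ g) / (1 - s * u)"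
    by (rule w_spec_sHL_eqI[OF eventually_mono[OF ev closed] lim])
qed

lemma w_spec_sg_left_zero:
  "w_spec q s (sg a) 0 (i2 + j2) i2 j2 = (- s) ^ j2 * qp q q (i2 + j2) / qp q q j2"
  unfolding w_spec_def
proof (rule tendsto_Lim[OF near_nontrivial])
  have s0: "s \<noteq> 0" using s by simp
  have pos: "qp q q n \<noteq> 0" for n using q qp_q_pos[of q q n] by simp
  have "((\<lambda>p. (- s) ^ j2 * qp (fst p / s) q j2 * qp q q (i2 + j2) / (qp q q j2 * qp (s * fst p) q (i2 + j2)))
     \<longlongrightarrow> (- s) ^ j2 * qp (0 / s) q j2 * qp q q (i2 + j2) / (qp q q j2 * qp (s * 0) q (i2 + j2))) (near q (sg a))"
    using near_lim_u[of "sg a" q] s0 pos by (intro tendsto_intros) auto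
  then show "((\<lambda>(u, X). fused_w q s u X 0 (i2 + j2) i2 j2) \<longlongrightarrow> (- s) ^ j2 * qp q q (i2 + j2) / qp q q j2) (near q (sg a))"
    using q s0 by (simp add: fused_w_left_zero case_prod_unfold)
qed

text \<open>An sg specialization belongs to the boundary row or column, where the diagram whose
  multiplicity enters as \<open>i1\<close> is empty. For sHL the sign is read off from the four
  closed forms.\<close>

lemma w_spec_nonneg_pos:
  assumes "valid \<rho>" "j1 \<in> occ \<rho>" "j2 \<in> occ \<rho>" "is_sg \<rho> \<Longrightarrow> i1 = 0" "i1 + j1 = i2 + j2"
  shows "0 \<le> w_spec q s \<rho> i1 j1 i2 j2 \<and> (0 < w_spec q s \<rho> i1 j1 i2 j2 \<longleftrightarrow> \<not> wbad \<rho> j1 j2)"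
proof (cases \<rho>)
  case (sg a)
  have "0 < w_spec q s (sg a) 0 (i2 + j2) i2 j2"
    unfolding w_spec_sg_left_zero using s q by (intro divide_pos_pos mult_pos_pos zero_less_power qp_q_pos) auto
  then show ?thesis using assms sg by (auto simp: wbad_def)
next
  case (sHL u)
  with assms have u: "0 \<le> u" and j: "j1 = 0 \<or> j1 = 1" "j2 = 0 \<or> j2 = 1" by auto
  have su: "s * u * x \<le> 0" if "0 \<le> x" for x
    using s u that by (simp add: mult_nonpos_nonneg)
  have d: "1 - s * u > 0" using su[of 1] by simp
  have q1: "q ^ n \<le> 1" "0 < q ^ n" for n using q by (auto intro: power_le_one)
  consider "j1 = 0" "j2 = 0" "i2 = i1" | "j1 = 1" "j2 = 1" "i2 = i1" | "j1 = 1" "j2 = 0" "i2 = Suc i1"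
    | "j1 = 0" "j2 = 1" "i1 = Suc i2" using j assms(5) by auto
  then show ?thesis
  proof cases
    case 1
    have "1 - s * u * q ^ i1 > 0" using su[of "q ^ i1"] q1[of i1] by simp
    then show ?thesis using 1 sHL u d by (simp add: w_spec_00 wbad_def)
  next
    case 2
    have "u - s * q ^ i1 > 0" using mult_neg_pos[OF s(2), of "q ^ i1"] q1[of i1] u by simp
    then show ?thesis using 2 sHL d by (simp add: w_spec_11[OF u, simplified] wbad_def)
  next
    case 3
    have "1 - q * q ^ i1 > 0" using q power_Suc_less_one[of q i1] by simp
    then show ?thesis using 3 sHL d by (simp add: w_spec_10[OF u, simplified] wbad_def)
  next
    case 4
    have "s\<^sup>2 < 1" using s by (simp add: abs_square_less_1)
    then have "s\<^sup>2 * q ^ i2 < 1" by (rule mult_power_less_one[OF q])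
    then show ?thesis using 4 sHL u d by (auto simp: w_spec_01[OF u, simplified] wbad_def zero_less_mult_iff)
  qed
qed

lemma wstar_spec_nonneg_pos:
  assumes "valid \<rho>" "j1 \<in> occ \<rho>" "j2 \<in> occ \<rho>" "is_sg \<rho> \<Longrightarrow> i2 = 0" "i2 + j1 = i1 + j2"
  shows "0 \<le> wstar_spec q s \<rho> i1 j1 i2 j2 \<and> (0 < wstar_spec q s \<rho> i1 j1 i2 j2 \<longleftrightarrow> \<not> wbad \<rho> j1 j2)"
proof -
  have "s\<^sup>2 < 1" using s by (simp add: abs_square_less_1)
  then have "0 < qpoch (s\<^sup>2) q (int i1) * qpoch q q (int i2) / (qpoch q q (int i1) * qpoch (s\<^sup>2) q (int i2))"
    using q by (intro divide_pos_pos mult_pos_pos) (simp_all add: qpoch_of_nat qp_q_pos)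
  moreover have "wstar_spec q s \<rho> i1 j1 i2 j2 = qpoch (s\<^sup>2) q (int i1) * qpoch q q (int i2)
      / (qpoch q q (int i1) * qpoch (s\<^sup>2) q (int i2)) * w_spec q s \<rho> i2 j1 i1 j2"
    by (simp add: wstar_spec_def)
  ultimately show ?thesis
    using w_spec_nonneg_pos[OF assms] by (metis mult_nonneg_nonneg less_imp_le zero_less_mult_iff less_asym)
qed

lemma wstar_spec_not_conserved:
  "i2 + j1 \<noteq> i1 + j2 \<Longrightarrow> wstar_spec q s \<rho> i1 j1 i2 j2 = 0"
  by (simp add: wstar_spec_def w_spec_not_conserved)

text \<open>For a pair with sg the side conditions put the entry on one of the lines
  \<open>j2 = 0\<close>, \<open>i2 = 0\<close>. For two sHL specializations conservation leaves the
  six entries computed above.\<close>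

lemma R_spec_nonneg_pos:
  assumes "valid \<rho>" "valid \<rho>s" "i1 \<in> occ \<rho>" "j1 \<in> occ \<rho>s" "i2 \<in> occ \<rho>" "j2 \<in> occ \<rho>s"
    and sg: "is_sg \<rho> \<Longrightarrow> j2 = 0" "is_sg \<rho>s \<Longrightarrow> i2 = 0" and cons: "i2 + j1 = i1 + j2"
  shows "0 \<le> R_spec q \<rho> \<rho>s i1 j1 i2 j2 \<and> (0 < R_spec q \<rho> \<rho>s i1 j1 i2 j2 \<longleftrightarrow> \<not> Rbad \<rho> \<rho>s i1 j1 i2 j2)"
proof -
  have pos: "0 < qp q q n" for n using q by (simp add: qp_q_pos)
  show ?thesis
  proof (cases \<rho>; cases \<rho>s)
    fix \<alpha> \<beta> assume "\<rho> = sg \<alpha>" "\<rho>s = sg \<beta>"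
    then show ?thesis using assms pos[of i1] R_spec_sg_sg[OF q, of \<alpha> \<beta> i1] by (auto simp: Rbad_def)
  next
    fix \<alpha> v assume "\<rho> = sg \<alpha>" "\<rho>s = sHL v"
    then show ?thesis using assms pos[of i1] pos[of i2] R_spec_sg_sHL[OF q, of \<alpha> v i2 j1]
      by (simp add: Rbad_def)
  next
    fix u \<beta> assume "\<rho> = sHL u" "\<rho>s = sg \<beta>"
    then show ?thesis using assms pos[of j1] pos[of j2] R_spec_sHL_sg[OF q, of \<beta> u i1 j2]
      by (simp add: Rbad_def)
  next
    fix u v assume eq: "\<rho> = sHL u" "\<rho>s = sHL v"
    have uv: "0 \<le> u" "u < 1" "0 \<le> v" "v < 1" using assms(1,2) eq by auto
    have z: "u * v < 1" using mult_less_one uv by blast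
    have zq: "u * v * q < 1" using mult_power_less_one[OF q z, of 1] by simp
    note R = R_spec_sHL_sHL[OF q uv]
    have "(i1, j1, i2, j2) \<in> {(0,0,0,0), (1,1,0,0), (0,1,0,1), (1,0,1,0), (0,0,1,1), (1,1,1,1)}"
      using assms(3-6) cons eq by auto
    then consider "i1 = 0" "j1 = 0" "i2 = 0" "j2 = 0" | "i1 = 1" "j1 = 1" "i2 = 0" "j2 = 0"
      | "i1 = 0" "j1 = 1" "i2 = 0" "j2 = 1" | "i1 = 1" "j1 = 0" "i2 = 1" "j2 = 0"
      | "i1 = 0" "j1 = 0" "i2 = 1" "j2 = 1" | "i1 = 1" "j1 = 1" "i2 = 1" "j2 = 1" by auto
    then show ?thesis
    proof cases
      case 5
      then show ?thesis unfolding 5 eq R(5) using uv q z by (auto simp: Rbad_def zero_less_mult_iff)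
    qed (use R q z zq in \<open>auto simp: eq Rbad_def\<close>)
  qed
qed

end

section \<open>One step of the forward transition\<close>

lemma infsum_pos_finite_support:
  fixes f :: "'a \<Rightarrow> real"
  assumes "finite A" "\<And>x. x \<notin> A \<Longrightarrow> f x = 0" "\<And>x. 0 \<le> f x" "0 < f y"
  shows "0 < (\<Sum>\<^sub>\<infinity>x. f x)"
proof -
  have "(\<Sum>\<^sub>\<infinity>x. f x) = (\<Sum>\<^sub>\<infinity>x\<in>A. f x)"
    by (rule infsum_cong_neutral) (use assms(2) in auto)
  also have "\<dots> = sum f A" using assms(1) by simp
  also have "0 < \<dots>"
    using assms(2,3,4) by (intro sum_pos2[OF assms(1), of y]) (auto, metis less_irrefl)
  finally show ?thesis .
qed

text \<open>Turns the occupation numbers of a positive left term into those of a positive right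
  term. For two sHL specializations t = t' = 0 is tried first; t or t' is switched on only when b' +
  t' = t + b or a vanishing entry of \<open>R\<close> demands it.\<close>

lemma yb_witness:
  assumes occ: "a \<in> occ \<rho>" "a' \<in> occ \<rho>s" "b \<in> occ \<rho>s" "b' \<in> occ \<rho>" "p \<in> occ \<rho>s" "p' \<in> occ \<rho>"
    and cons: "p' + a' = a + p" "k + p = m + b" "k + p' = l + b'"
    and sg: "is_sg \<rho> \<Longrightarrow> m = 0 \<and> b = 0" "is_sg \<rho>s \<Longrightarrow> l = 0 \<and> b' = 0"
    and bad: "\<not> Rbad \<rho> \<rho>s a a' p' p" "\<not> wbad \<rho>s p b" "\<not> wbad \<rho> p' b'"
  shows "\<exists>n t t'. t \<in> occ \<rho> \<and> t' \<in> occ \<rho>s \<and> n + t = m + a \<and> n + t' = l + a' \<and> b' + t' = t + b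
    \<and> \<not> wbad \<rho>s a' t' \<and> \<not> wbad \<rho> a t \<and> \<not> Rbad \<rho> \<rho>s t t' b' b"
proof (cases \<rho>; cases \<rho>s)
  fix \<alpha> \<beta> assume eq: "\<rho> = sg \<alpha>" "\<rho>s = sg \<beta>"
  then have "m = 0" "b = 0" "l = 0" "b' = 0" using sg by simp_all
  then show ?thesis using cons eq
    by - (rule exI[where x = 0], rule exI[where x = a], rule exI[where x = a'], simp add: wbad_def Rbad_def)
next
  fix \<alpha> v assume eq: "\<rho> = sg \<alpha>" "\<rho>s = sHL v"
  then have "m = 0" "b = 0" using sg by simp_all
  then show ?thesis using cons eq
    by - (rule exI[where x = "a' + l"], rule exI[where x = b'], rule exI[where x = 0], simp add: wbad_def Rbad_def)
next
  fix u \<beta> assume eq: "\<rho> = sHL u" "\<rho>s = sg \<beta>"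
  then have "l = 0" "b' = 0" using sg by simp_all
  then show ?thesis using cons eq
    by - (rule exI[where x = "a + m"], rule exI[where x = 0], rule exI[where x = b], simp add: wbad_def Rbad_def)
next
  fix u v assume eq: "\<rho> = sHL u" "\<rho>s = sHL v"
  have bits: "a \<le> 1" "a' \<le> 1" "b \<le> 1" "b' \<le> 1" "p \<le> 1" "p' \<le> 1"
    using occ eq by auto
  have bad': "u = 0 \<or> v = 0 \<Longrightarrow> a \<noteq> 0 \<or> a' \<noteq> 0 \<or> p = 0 \<or> p' = 0"
      "v = 0 \<Longrightarrow> p = 0 \<Longrightarrow> b \<noteq> 1" "u = 0 \<Longrightarrow> p' = 0 \<Longrightarrow> b' \<noteq> 1"
    using bad bits unfolding eq wbad_def Rbad_def by auto
  \<comment> \<open>For u = 0 and b' = 1 positivity of the left term forces p' = 1. With a = 0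
    conservation would give a' = 0 and p = 1, the vanishing entry of \<open>R\<close>. The fact
    \<open>R2\<close> is the mirror image.\<close>
  have R1: "u = 0 \<Longrightarrow> b' = 1 \<Longrightarrow> a = 1"
  proof -
    assume "u = 0" "b' = 1"
    then have "p' = 1" "a \<noteq> 0 \<or> a' \<noteq> 0 \<or> p = 0" using bad' bits by fastforce+
    then show "a = 1" using cons(1) bits by linarith
  qed
  have R2: "v = 0 \<Longrightarrow> b = 1 \<Longrightarrow> a' = 1"
  proof -
    assume "v = 0" "b = 1"
    then have "p = 1" "a \<noteq> 0 \<or> a' \<noteq> 0 \<or> p' = 0" using bad' bits by fastforce+
    then show "a' = 1" using cons(1) bits by linarith
  qed
  consider "b' = 0" "b = 0" | "b' = 0" "b = 1" | "b' = 1" "b = 0"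
    | "b' = 1" "b = 1" "u \<noteq> 0 \<and> v \<noteq> 0" | "b' = 1" "b = 1" "u = 0 \<or> v = 0"
    using bits by linarith
  then show ?thesis
  proof cases
    case 1
    then show ?thesis using cons
      by - (rule exI[where x = "m + a"], rule exI[where x = 0], rule exI[where x = 0], simp add: eq wbad_def Rbad_def)
  next
    case 2
    then show ?thesis using cons R2
      by - (rule exI[where x = "m + a"], rule exI[where x = 0], rule exI[where x = 1], fastforce simp: eq wbad_def Rbad_def)
  next
    case 3
    then show ?thesis using cons R1
      by - (rule exI[where x = "l + a'"], rule exI[where x = 1], rule exI[where x = 0], fastforce simp: eq wbad_def Rbad_def)
  next
    case 4
    then show ?thesis using cons
      by - (rule exI[where x = "m + a"], rule exI[where x = 0], rule exI[where x = 0], simp add: eq wbad_def Rbad_def)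
  next
    \<comment> \<open>The entry of \<open>R\<close> with t = t' = 0 vanishes now, so both are set to
      1. This takes one path away from n, which is possible because m + a = l + a' is at least
      1.\<close>
    case 5
    then have "a = 1 \<or> a' = 1" using R1 R2 by blast
    then have "m + a \<ge> 1" using 5 cons R1 bits by linarith
    moreover have "m + a = l + a'" using 5 cons by linarith
    ultimately show ?thesis using 5 R1 R2
      by - (rule exI[where x = "m + a - 1"], rule exI[where x = 1], rule exI[where x = 1], fastforce simp: eq wbad_def Rbad_def)
  qed
qed

context yb_params
begin

context
  fixes \<rho> \<rho>s :: spec and a a' m b b' l k p p' :: nat
  assumes valid: "valid \<rho>" "valid \<rho>s"
    and occ: "a \<in> occ \<rho>" "a' \<in> occ \<rho>s" "b \<in> occ \<rho>s" "b' \<in> occ \<rho>" "p \<in> occ \<rho>s" "p' \<in> occ \<rho>"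
    and cons: "p' + a' = a + p" "k + p = m + b" "k + p' = l + b'"
    and sg: "is_sg \<rho> \<Longrightarrow> m = 0 \<and> b = 0" "is_sg \<rho>s \<Longrightarrow> l = 0 \<and> b' = 0"
begin

lemma yb_left_term:
  assumes p: "p1 \<in> occ \<rho>s" "p1' \<in> occ \<rho>" and c1: "k1 + p1 = m + b" "k1 + p1' = l + b'"
  shows "0 \<le> R_spec q \<rho> \<rho>s a a' p1' p1 * wstar_spec q s \<rho>s m p1 k1 b * w_spec q s \<rho> k1 p1' l b' \<and>
    (0 < R_spec q \<rho> \<rho>s a a' p1' p1 * wstar_spec q s \<rho>s m p1 k1 b * w_spec q s \<rho> k1 p1' l b' \<longleftrightarrow>
     \<not> Rbad \<rho> \<rho>s a a' p1' p1 \<and> \<not> wbad \<rho>s p1 b \<and> \<not> wbad \<rho> p1' b')"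
proof -
  have "0 \<le> R_spec q \<rho> \<rho>s a a' p1' p1 \<and> (0 < R_spec q \<rho> \<rho>s a a' p1' p1 \<longleftrightarrow> \<not> Rbad \<rho> \<rho>s a a' p1' p1)"
    using valid occ p c1 cons sg by (intro R_spec_nonneg_pos) auto
  moreover have "0 \<le> wstar_spec q s \<rho>s m p1 k1 b \<and> (0 < wstar_spec q s \<rho>s m p1 k1 b \<longleftrightarrow> \<not> wbad \<rho>s p1 b)"
    using valid occ p c1 cons sg by (intro wstar_spec_nonneg_pos) auto
  moreover have "0 \<le> w_spec q s \<rho> k1 p1' l b' \<and> (0 < w_spec q s \<rho> k1 p1' l b' \<longleftrightarrow> \<not> wbad \<rho> p1' b')"
    using valid occ p c1 cons sg by (intro w_spec_nonneg_pos) auto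
  ultimately show ?thesis by (auto simp: zero_less_mult_iff)
qed

lemma yb_right_term:
  assumes t: "t \<in> occ \<rho>" "t' \<in> occ \<rho>s" and c1: "n + t' = l + a'" "n + t = m + a"
  shows "0 \<le> wstar_spec q s \<rho>s n a' l t' * w_spec q s \<rho> m a n t * R_spec q \<rho> \<rho>s t t' b' b \<and>
    (0 < wstar_spec q s \<rho>s n a' l t' * w_spec q s \<rho> m a n t * R_spec q \<rho> \<rho>s t t' b' b \<longleftrightarrow>
     \<not> wbad \<rho>s a' t' \<and> \<not> wbad \<rho> a t \<and> \<not> Rbad \<rho> \<rho>s t t' b' b)"
proof -
  have "0 \<le> R_spec q \<rho> \<rho>s t t' b' b \<and> (0 < R_spec q \<rho> \<rho>s t t' b' b \<longleftrightarrow> \<not> Rbad \<rho> \<rho>s t t' b' b)"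
    using valid occ t c1 cons sg by (intro R_spec_nonneg_pos) auto
  moreover have "0 \<le> wstar_spec q s \<rho>s n a' l t' \<and> (0 < wstar_spec q s \<rho>s n a' l t' \<longleftrightarrow> \<not> wbad \<rho>s a' t')"
    using valid occ t c1 cons sg by (intro wstar_spec_nonneg_pos) auto
  moreover have "0 \<le> w_spec q s \<rho> m a n t \<and> (0 < w_spec q s \<rho> m a n t \<longleftrightarrow> \<not> wbad \<rho> a t)"
    using valid occ t c1 cons sg by (intro w_spec_nonneg_pos) auto
  ultimately show ?thesis by (auto simp: zero_less_mult_iff)
qed

lemma yb_left_nonneg: "0 \<le> yb_left q s \<rho> \<rho>s (a, a', m, b, b', l) \<tau>"
proof (cases \<tau>)
  case (fields k1 p1 p1')
  show ?thesis
  proof (cases "p1 \<in> occ \<rho>s \<and> p1' \<in> occ \<rho> \<and> k1 + p1 = m + b \<and> k1 + p1' = l + b'")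
    case True
    then show ?thesis using yb_left_term fields by simp
  next
    case False
    then show ?thesis using fields by (auto simp: w_spec_not_conserved wstar_spec_not_conserved)
  qed
qed

lemma yb_right_nonneg: "0 \<le> yb_right q s \<rho> \<rho>s (a, a', m, b, b', l) \<sigma>"
proof (cases \<sigma>)
  case (fields n t t')
  show ?thesis
  proof (cases "t \<in> occ \<rho> \<and> t' \<in> occ \<rho>s \<and> n + t' = l + a' \<and> n + t = m + a")
    case True
    then show ?thesis using yb_right_term fields by simp
  next
    case False
    then show ?thesis using fields by (auto simp: w_spec_not_conserved wstar_spec_not_conserved)
  qed
qed

lemma yb_right_nonzero:
  assumes "yb_right q s \<rho> \<rho>s (a, a', m, b, b', l) (n, t, t') \<noteq> 0"
  shows "t \<in> occ \<rho> \<and> t' \<in> occ \<rho>s \<and> n + t' = l + a' \<and> n + t = m + a \<and> b' + t' = t + b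
    \<and> \<not> wbad \<rho>s a' t' \<and> \<not> wbad \<rho> a t \<and> \<not> Rbad \<rho> \<rho>s t t' b' b"
proof -
  have "t \<in> occ \<rho>" "t' \<in> occ \<rho>s"
    using assms by (simp_all split: if_splits)
  moreover have "n + t' = l + a'"
  proof (rule ccontr)
    assume "n + t' \<noteq> l + a'"
    then have "l + a' \<noteq> n + t'" by simp
    with assms show False by (simp add: wstar_spec_not_conserved split: if_splits)
  qed
  moreover have "n + t = m + a"
  proof (rule ccontr)
    assume "n + t \<noteq> m + a"
    then have "m + a \<noteq> n + t" by simp
    with assms show False by (simp add: w_spec_not_conserved split: if_splits)
  qed
  ultimately have c: "t \<in> occ \<rho>" "t' \<in> occ \<rho>s" "n + t' = l + a'" "n + t = m + a" by blast+
  have "yb_right q s \<rho> \<rho>s (a, a', m, b, b', l) (n, t, t') > 0"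
    using assms yb_right_nonneg[of "(n, t, t')"] by linarith
  then show ?thesis using yb_right_term[OF c] c cons by auto
qed

text \<open>Conservation bounds the indices of the nonzero terms, so both sums are finite sums of
  nonnegative terms. The given triple is a positive term on the left, \<open>yb_witness\<close>
  supplies one on the right.\<close>

lemma yb_positive_sums:
  assumes bad: "\<not> Rbad \<rho> \<rho>s a a' p' p" "\<not> wbad \<rho>s p b" "\<not> wbad \<rho> p' b'"
  shows "positive_sums q s \<rho> \<rho>s (a, a', m, b, b', l)"
proof -
  obtain n t t' where w: "t \<in> occ \<rho>" "t' \<in> occ \<rho>s" "n + t = m + a" "n + t' = l + a'"
      "\<not> wbad \<rho>s a' t'" "\<not> wbad \<rho> a t" "\<not> Rbad \<rho> \<rho>s t t' b' b"
    using yb_witness[of a \<rho> a' \<rho>s b b' p p' k m l] occ cons sg bad by blast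
  have "0 < (\<Sum>\<^sub>\<infinity>\<tau>. yb_left q s \<rho> \<rho>s (a, a', m, b, b', l) \<tau>)"
  proof (rule infsum_pos_finite_support)
    show "finite ({..m + b} \<times> {..m + b} \<times> {..l + b'})" by simp
    show "0 < yb_left q s \<rho> \<rho>s (a, a', m, b, b', l) (k, p, p')"
      using yb_left_term[OF occ(5,6) cons(2,3)] bad occ by simp
    fix \<tau> :: triple
    assume "\<tau> \<notin> {..m + b} \<times> {..m + b} \<times> {..l + b'}"
    then have "snd (snd \<tau>) > l + b' \<or> fst \<tau> + fst (snd \<tau>) \<noteq> m + b" by (cases \<tau>) auto
    then have "fst \<tau> + fst (snd \<tau>) \<noteq> m + b \<or> fst \<tau> + snd (snd \<tau>) \<noteq> l + b'" by auto
    then show "yb_left q s \<rho> \<rho>s (a, a', m, b, b', l) \<tau> = 0"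
      by (cases \<tau>) (auto simp: w_spec_not_conserved wstar_spec_not_conserved)
  qed (rule yb_left_nonneg)
  moreover have "0 < (\<Sum>\<^sub>\<infinity>\<sigma>. yb_right q s \<rho> \<rho>s (a, a', m, b, b', l) \<sigma>)"
  proof (rule infsum_pos_finite_support)
    show "finite ({..m + a} \<times> {..m + a} \<times> {..l + a'})" by simp
    show "0 < yb_right q s \<rho> \<rho>s (a, a', m, b, b', l) (n, t, t')"
      using yb_right_term[OF w(1,2,4,3)] w by simp
    fix \<sigma> :: triple
    assume "\<sigma> \<notin> {..m + a} \<times> {..m + a} \<times> {..l + a'}"
    then have "snd (snd \<sigma>) > l + a' \<or> fst \<sigma> + fst (snd \<sigma>) \<noteq> m + a" by (cases \<sigma>) auto
    then have "fst \<sigma> + fst (snd \<sigma>) \<noteq> m + a \<or> fst \<sigma> + snd (snd \<sigma>) \<noteq> l + a'" by auto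
    then show "yb_right q s \<rho> \<rho>s (a, a', m, b, b', l) \<sigma> = 0"
      by (cases \<sigma>) (auto simp: w_spec_not_conserved wstar_spec_not_conserved)
  qed (rule yb_right_nonneg)
  ultimately show ?thesis by (simp add: positive_sums_def)
qed

text \<open>A transition of nonzero conditional probability lies in the support of the coupling. Its
  target is then in the support of the second marginal, that is, a nonzero term of the right
  side.\<close>

lemma cond_step_nonzero:
  assumes C: "is_coupling q s \<rho> \<rho>s (a, a', m, b, b', l) Q"
    and nz: "cond_step Q \<tau> (n, t, t') \<noteq> 0"
  shows "t \<in> occ \<rho> \<and> t' \<in> occ \<rho>s \<and> n + t' = l + a' \<and> n + t = m + a \<and> b' + t' = t + b
    \<and> \<not> wbad \<rho>s a' t' \<and> \<not> wbad \<rho> a t \<and> \<not> Rbad \<rho> \<rho>s t t' b' b"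
proof -
  have "(\<tau>, n, t, t') \<in> set_pmf Q"
    using nz by (auto simp: cond_step_def set_pmf_iff)
  then have "(n, t, t') \<in> set_pmf (map_pmf snd Q)"
    by (force simp: set_map_pmf)
  then have "pmf (map_pmf snd Q) (n, t, t') \<noteq> 0" by (simp only: set_pmf_iff not_False_eq_True)
  then have "yb_right q s \<rho> \<rho>s (a, a', m, b, b', l) (n, t, t') \<noteq> 0"
    using C unfolding is_coupling_def by auto
  then show ?thesis by (rule yb_right_nonzero)
qed

end

end

text \<open>If a q^N > 1 then a q^i > 1 for every i \<le> N, negative i included, so no factor of
  the symbol is 0.\<close>

lemma qpoch_nz_of_large:
  assumes q: "0 < q" "q < 1" and a: "1 < a * q ^ N" and N: "\<bar>n\<bar> \<le> int N"
  shows "qpoch a q n \<noteq> 0"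
proof -
  have a0: "0 < a" using a q by (metis less_trans zero_less_one zero_less_mult_pos2 zero_less_power)
  show ?thesis
  proof (cases "n \<ge> 0")
    case True
    have "1 - a * q ^ i \<noteq> 0" if "i < nat n" for i
    proof -
      have "a * q ^ N \<le> a * q ^ i"
        using that N a0 q by (intro mult_left_mono power_decreasing) auto
      then show ?thesis using a by linarith
    qed
    then have "qp a q (nat n) \<noteq> 0" unfolding qp_def by (subst prod_zero_iff) auto
    then show ?thesis using qpoch_of_nat[of a q "nat n"] True by simp
  next
    case False
    have "1 - a / q ^ i \<noteq> 0" for i
    proof -
      have "a * q ^ N \<le> a" using a0 q by (simp add: power_le_one)
      moreover have "a \<le> a / q ^ i" using a0 q by (simp add: field_simps power_le_one)
      ultimately show ?thesis using a by linarith
    qed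
    then have "(\<Prod>i<nat (- n). inverse (1 - a / q ^ Suc i)) \<noteq> 0"
      by (subst prod_zero_iff) (auto simp del: power_Suc)
    then show ?thesis using qpoch_neg[of q a "nat (- n)"] q False by simp
  qed
qed

text \<open>On the path uv and X are positive while uXv tends to 0, so q/(X uv) exceeds every bound
  and the preceding lemma applies at any index.\<close>

lemma path_sg_sg:
  assumes q: "0 < q" "q < 1" and ab: "0 \<le> \<alpha>" "0 \<le> \<beta>"
  shows "regular_along_path q (sg \<alpha>) (sg \<beta>) n"
proof -
  define N where "N = nat \<bar>n\<bar>"
  have "((\<lambda>t. (fst (approach_path q (sg \<alpha>) t) * snd (approach_path q (sg \<alpha>) t)) * fst (approach_path q (sg \<beta>) t))
     \<longlongrightarrow> lim_uX q (sg \<alpha>) * lim_u (sg \<beta>)) (at_right 0)"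
    by (intro tendsto_mult filterlim_compose[OF near_lim_uX path_near] path_limits)
  then have "((\<lambda>t. (fst (approach_path q (sg \<alpha>) t) * snd (approach_path q (sg \<alpha>) t)) * fst (approach_path q (sg \<beta>) t)) \<longlongrightarrow> 0) (at_right 0)"
    by simp
  then have "\<forall>\<^sub>F t in at_right 0. (fst (approach_path q (sg \<alpha>) t) * snd (approach_path q (sg \<alpha>) t)) * fst (approach_path q (sg \<beta>) t) < q * q ^ N"
    by (rule order_tendstoD) (use q in simp)
  with path_sg_fst_neg[OF ab(1), of q] path_sg_fst_neg[OF ab(2), of q] show ?thesis
  proof eventually_elim
    case (elim t)
    define X where "X = snd (approach_path q (sg \<alpha>) t)"
    define z where "z = fst (approach_path q (sg \<alpha>) t) * fst (approach_path q (sg \<beta>) t)"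
    have z: "0 < z" and X: "0 < X" using elim by (auto simp: z_def X_def intro: mult_neg_neg simp del: approach_path.simps)
    have "z * X < q * q ^ N" using elim(3) by (simp add: z_def X_def mult_ac del: approach_path.simps)
    then have "1 < q / X / z * q ^ N"
      using z X by (simp add: field_simps)
    then have "qpoch (q / X / z) q n \<noteq> 0"
      by (rule qpoch_nz_of_large[OF q]) (simp add: N_def)
    moreover have "z \<noteq> 0" using z by simp
    ultimately show ?case unfolding z_def X_def by (intro conjI)
  qed
qed

text \<open>The formula is identically 0 off conservation, but for the value of the limit the filter
  must also be proper. Hence the check of the path for every pair of specializations.\<close>

lemma R_spec_not_conserved:
  assumes q: "0 < q" "q < 1" and valid: "valid \<rho>" "valid \<rho>s"
    and occ: "i1 \<in> occ \<rho>" "j1 \<in> occ \<rho>s" and cons: "i2 + j1 \<noteq> i1 + j2"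
  shows "R_spec q \<rho> \<rho>s i1 j1 i2 j2 = 0"
proof -
  have regular: "regular_along_path q \<rho> \<rho>s (int i1 - int j1)"
  proof (cases \<rho>; cases \<rho>s)
    fix \<alpha> \<beta> assume "\<rho> = sg \<alpha>" "\<rho>s = sg \<beta>"
    then show ?thesis using path_sg_sg[OF q, of \<alpha> \<beta>] valid by simp
  next
    fix \<alpha> v assume eq: "\<rho> = sg \<alpha>" "\<rho>s = sHL v"
    then have "0 \<le> \<alpha>" "0 \<le> v" using valid by auto
    from path_sg_fst_neg[OF this(1), of q] path_sHL_fst_pos[OF this(2) q(1)] show ?thesis
      unfolding eq by eventually_elim (intro conjI qpoch_nz_of_neg divide_pos_neg mult_neg_pos divide_pos_pos,
        use q in \<open>simp_all del: approach_path.simps\<close>)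
  next
    fix u \<beta> assume eq: "\<rho> = sHL u" "\<rho>s = sg \<beta>"
    then have "0 \<le> \<beta>" "0 \<le> u" using valid by auto
    from path_sg_fst_neg[OF this(1), of q] path_sHL_fst_pos[OF this(2) q(1)] show ?thesis
      unfolding eq by eventually_elim (intro conjI qpoch_nz_of_neg divide_pos_neg mult_pos_neg divide_pos_pos,
        use q in \<open>simp_all del: approach_path.simps\<close>)
  next
    fix u v assume eq: "\<rho> = sHL u" "\<rho>s = sHL v"
    then have uv: "0 \<le> u" "u < 1" "0 \<le> v" "v < 1" using valid by auto
    have "int i1 - int j1 \<in> {-1, 0, 1}" using occ eq by auto
    from path_sHL_sHL[OF q uv this] show ?thesis unfolding eq .
  qed
  have z: "((\<lambda>t. fst (approach_path q \<rho> t) * fst (approach_path q \<rho>s t)) \<longlongrightarrow> lim_u \<rho> * lim_u \<rho>s) (at_right 0)"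
    by (intro tendsto_intros path_limits)
  have "lim_u \<rho> * lim_u \<rho>s < 1"
    using valid mult_less_one by (cases \<rho>; cases \<rho>s) auto
  with z have "\<forall>\<^sub>F t in at_right 0. fst (approach_path q \<rho> t) * fst (approach_path q \<rho>s t) < 1"
    by (rule order_tendstoD)
  moreover have "\<forall>\<^sub>F t in at_right 0. snd (approach_path q \<rho> t) \<noteq> 0"
    using q by (intro eventually_compose_filterlim[OF near_X path_near]) auto
  ultimately have ev: "\<forall>\<^sub>F t in at_right 0. fst (approach_path q \<rho> t) * fst (approach_path q \<rho>s t) \<noteq> 0 \<and> snd (approach_path q \<rho> t) \<noteq> 0
       \<and> qpoch (fst (approach_path q \<rho> t) * fst (approach_path q \<rho>s t)) q (int (j1 + i2)) \<noteq> 0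
       \<and> qpoch (q / snd (approach_path q \<rho> t) / (fst (approach_path q \<rho> t) * fst (approach_path q \<rho>s t))) q (int i1 - int j1) \<noteq> 0"
    using regular
  proof eventually_elim
    case (elim t)
    then show ?case using qp_q_pos[OF q elim(1), of "j1 + i2"] by (simp only: qpoch_of_nat) simp
  qed
  show ?thesis
    by (rule R_spec_eqI[where Q = "\<lambda>_. True", OF tendsto_const _ always_eventually ev])
      (use cons in \<open>simp_all add: fused_R_def\<close>)
qed

lemma b_spec_nonneg:
  assumes q: "0 < q" "q < 1" and "valid \<rho>" "k \<in> occ \<rho>"
  shows "0 \<le> b_spec q \<rho> k"
proof (cases \<rho>)
  case (sHL u)
  then have "b_spec q \<rho> k = u ^ k" using assms by (simp only: b_spec_sHL occ.simps)
  then show ?thesis using assms sHL by simp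
next
  case (sg a)
  then show ?thesis using assms qp_q_pos[OF q q(2), of k] by (simp add: b_spec_sg)
qed

text \<open>The law of n plus a Bernoulli variable with parameter p. Away from the origin each
  length arises in this way from the larger of its neighbours.\<close>

definition step_prob :: "real \<Rightarrow> nat \<Rightarrow> nat \<Rightarrow> real" where
  "step_prob p n k = (if k = Suc n then p else if k = n then 1 - p else 0)"

context yb_params
begin

lemma init_prob_nonzero:
  assumes valid: "valid \<rho>" "valid \<rho>s" and occ: "i \<in> occ \<rho>s" "i' \<in> occ \<rho>"
    and sg: "is_sg \<rho> \<Longrightarrow> i = 0" "is_sg \<rho>s \<Longrightarrow> i' = 0"
    and nz: "init_prob q \<rho> \<rho>s i i' (j, j') \<noteq> 0"
  shows "j \<in> occ \<rho> \<and> j' \<in> occ \<rho>s \<and> i' + j' = j + i \<and> 0 < b_spec q \<rho> j \<and> 0 < b_spec q \<rho>s j'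
    \<and> \<not> Rbad \<rho> \<rho>s j j' i' i"
proof -
  have o: "j \<in> occ \<rho>" "j' \<in> occ \<rho>s" and nz': "b_spec q \<rho> j \<noteq> 0" "b_spec q \<rho>s j' \<noteq> 0" "R_spec q \<rho> \<rho>s j j' i' i \<noteq> 0"
    using nz by (simp_all add: init_prob_def split: if_splits)
  have c: "i' + j' = j + i"
  proof (rule ccontr)
    assume "i' + j' \<noteq> j + i"
    then show False using R_spec_not_conserved[OF q valid o] nz' by simp
  qed
  have "0 \<le> b_spec q \<rho> j" "0 \<le> b_spec q \<rho>s j'" using b_spec_nonneg[OF q] valid o by auto
  moreover have "0 \<le> R_spec q \<rho> \<rho>s j j' i' i \<and> (0 < R_spec q \<rho> \<rho>s j j' i' i \<longleftrightarrow> \<not> Rbad \<rho> \<rho>s j j' i' i)"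
    by (rule R_spec_nonneg_pos[OF valid o occ(2,1) sg c])
  ultimately show ?thesis using o c nz' by linarith
qed

section \<open>Explicit initial probabilities\<close>

lemma Pi_spec_sg_sg:
  assumes "\<alpha> * \<beta> < 1"
  shows "Pi_spec q (sg \<alpha>) (sg \<beta>) = 1 / qpoch_inf (\<alpha> * \<beta>) q"
proof -
  have "qpoch_inf 0 q = 1" by (simp add: qpoch_inf_def)
  then show ?thesis using assms q by (subst Pi_spec_eq) (simp_all add: prod_lim_def)
qed

text \<open>Two of the four infinite products are 1, and the quotient of those at - v\<alpha> and -
  v\<alpha>q is the first factor 1 + v\<alpha>.\<close>

lemma Pi_spec_sg_sHL:
  assumes "0 \<le> \<alpha>" "0 \<le> v"
  shows "Pi_spec q (sg \<alpha>) (sHL v) = 1 + v * \<alpha>"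
proof -
  have 1: "qpoch_inf 0 q = 1" by (simp add: qpoch_inf_def)
  have "0 \<le> v * q" using assms q by simp
  then have le: "- (\<alpha> * v) < 1" "- (\<alpha> * (v * q)) < 1"
    using assms q mult_nonneg_nonneg[of \<alpha> v] mult_nonneg_nonneg[of \<alpha> "v * q"] by linarith+
  have "qpoch_inf (- (\<alpha> * v)) q = (1 + \<alpha> * v) * qpoch_inf (- (\<alpha> * (v * q))) q"
    using qpoch_inf_split[OF q le(1)] by (simp add: mult_ac)
  moreover have "qpoch_inf (- (\<alpha> * (v * q))) q > 0" by (rule qpoch_inf_pos[OF q le(2)])
  ultimately show ?thesis
    using assms q le 1 by (subst Pi_spec_eq) (simp_all add: prod_lim_def mult_ac)
qed

lemma Pi_spec_sHL_sg:
  assumes "0 \<le> \<beta>" "0 \<le> u"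
  shows "Pi_spec q (sHL u) (sg \<beta>) = 1 + u * \<beta>"
proof -
  have 1: "qpoch_inf 0 q = 1" by (simp add: qpoch_inf_def)
  have "0 \<le> u * q" using assms q by simp
  then have le: "- (u * \<beta>) < 1" "- (u * q * \<beta>) < 1"
    using assms q mult_nonneg_nonneg[of u \<beta>] mult_nonneg_nonneg[of "u * q" \<beta>] by linarith+
  have "qpoch_inf (- (u * \<beta>)) q = (1 + u * \<beta>) * qpoch_inf (- (u * q * \<beta>)) q"
    using qpoch_inf_split[OF q le(1)] by (simp add: mult_ac)
  moreover have "qpoch_inf (- (u * q * \<beta>)) q > 0" by (rule qpoch_inf_pos[OF q le(2)])
  ultimately show ?thesis
    using assms q le 1 by (subst Pi_spec_eq) (simp_all add: prod_lim_def)
qed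

text \<open>With z = uv the quotient has the product at zq squared over those at z and z q^2, so it
  telescopes.\<close>

lemma Pi_spec_sHL_sHL:
  assumes "0 \<le> u" "u < 1" "0 \<le> v" "v < 1"
  shows "Pi_spec q (sHL u) (sHL v) = (1 - u * v * q) / (1 - u * v)"
proof -
  define z where "z = u * v"
  have z: "z < 1" unfolding z_def using assms by (intro mult_less_one)
  have zq: "z * q < 1" "z * q * q < 1"
    using mult_power_less_one[OF q z, of 1] mult_power_less_one[OF q z, of 2] by (simp_all add: power2_eq_square)
  have e: "qpoch_inf z q = (1 - z) * qpoch_inf (z * q) q" "qpoch_inf (z * q) q = (1 - z * q) * qpoch_inf (z * q * q) q"
    using qpoch_inf_split[OF q] z zq by blast+
  have p: "qpoch_inf (z * q * q) q > 0" by (rule qpoch_inf_pos[OF q zq(2)])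
  have "Pi_spec q (sHL u) (sHL v) = qpoch_inf (z * q) q * qpoch_inf (z * q) q / (qpoch_inf z q * qpoch_inf (z * q * q) q)"
    using z zq q by (subst Pi_spec_eq) (simp_all add: prod_lim_def z_def mult_ac)
  also have "\<dots> = (1 - z * q) / (1 - z)"
    unfolding e using p z zq by simp
  finally show ?thesis by (simp add: z_def)
qed

text \<open>The two values of \<open>b\<close> give (\<alpha>\<beta>)^k over the square of (q; q)_k,
  and the entry (q; q)_k of \<open>R\<close> removes one of these factors.\<close>

lemma init_prob_sg_sg:
  assumes "0 \<le> \<alpha>" "0 \<le> \<beta>" "\<alpha> * \<beta> < 1"
  shows "init_prob q (sg \<alpha>) (sg \<beta>) 0 0 (k, k) = (\<alpha> * \<beta>) ^ k / qp q q k * qpoch_inf (\<alpha> * \<beta>) q"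
  using assms qp_q_pos[OF q q(2), of k]
  by (simp add: init_prob_def b_spec_sg R_spec_sg_sg[OF q] Pi_spec_sg_sg power_mult_distrib)

text \<open>For k - c in {0, 1} the quotient is (v\<alpha>)^(k - c) / (1 + v\<alpha>). Positivity of
  \<open>b\<close> at c is what permits cancelling \<alpha>^c; for \<alpha> = 0 it forces c =
  0.\<close>

lemma init_prob_sg_sHL:
  assumes v: "0 \<le> \<alpha>" "0 \<le> v" and b: "0 < b_spec q (sg \<alpha>) c" and k: "c \<le> k"
  shows "init_prob q (sg \<alpha>) (sHL v) 0 c (k, k - c) = step_prob (v * \<alpha> / (1 + v * \<alpha>)) c k"
proof -
  have d: "1 + v * \<alpha> > 0" using v by (simp add: add_pos_nonneg)
  then have compl: "1 - v * \<alpha> / (1 + v * \<alpha>) = 1 / (1 + v * \<alpha>)" by (simp add: field_simps)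
  have ac: "\<alpha> ^ c \<noteq> 0" using b unfolding b_spec_sg by (metis div_0 less_irrefl)
  have pos: "qp q q n > 0" for n using q by (simp add: qp_q_pos)
  consider "k = c" | "k = Suc c" | "k - c \<notin> {0, 1}" "k \<noteq> c" "k \<noteq> Suc c" using k by force
  then show ?thesis
  proof cases
    case 1
    have "R_spec q (sg \<alpha>) (sHL v) c 0 c 0 = 1"
      using R_spec_sg_sHL[OF q v, of c 0] pos[of c] by simp
    then show ?thesis
      using 1 d ac pos[of c] b_spec_sHL[OF q, of 0 v] Pi_spec_sg_sHL[OF v]
      by (simp add: init_prob_def step_prob_def b_spec_sg compl)
  next
    case 2
    have "R_spec q (sg \<alpha>) (sHL v) (Suc c) (Suc 0) c 0 = qp q q (Suc c) / qp q q c"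
      using R_spec_sg_sHL[OF q v, of c 1] by simp
    then show ?thesis
      using 2 d ac pos[of c] pos[of "Suc c"] b_spec_sHL[OF q, of 1 v] b_spec_sHL[OF q, of 0 v] Pi_spec_sg_sHL[OF v]
      by (simp add: init_prob_def step_prob_def b_spec_sg Suc_diff_le)
  next
    case 3
    then show ?thesis by (simp add: init_prob_def step_prob_def)
  qed
qed

lemma init_prob_sHL_sg:
  assumes u: "0 \<le> \<beta>" "0 \<le> u" and b: "0 < b_spec q (sg \<beta>) c" and k: "c \<le> k"
  shows "init_prob q (sHL u) (sg \<beta>) c 0 (k - c, k) = step_prob (u * \<beta> / (1 + u * \<beta>)) c k"
proof -
  have d: "1 + u * \<beta> > 0" using u by (simp add: add_pos_nonneg)
  then have compl: "1 - u * \<beta> / (1 + u * \<beta>) = 1 / (1 + u * \<beta>)" by (simp add: field_simps)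
  have ac: "\<beta> ^ c \<noteq> 0" using b unfolding b_spec_sg by (metis div_0 less_irrefl)
  have pos: "qp q q n > 0" for n using q by (simp add: qp_q_pos)
  consider "k = c" | "k = Suc c" | "k - c \<notin> {0, 1}" "k \<noteq> c" "k \<noteq> Suc c" using k by force
  then show ?thesis
  proof cases
    case 1
    have "R_spec q (sHL u) (sg \<beta>) 0 c 0 c = 1"
      using R_spec_sHL_sg[OF q u, of 0 c] pos[of c] by simp
    then show ?thesis
      using 1 d ac pos[of c] b_spec_sHL[OF q, of 0 u] Pi_spec_sHL_sg[OF u]
      by (simp add: init_prob_def step_prob_def b_spec_sg compl)
  next
    case 2
    have "R_spec q (sHL u) (sg \<beta>) (Suc 0) (Suc c) 0 c = qp q q (Suc c) / qp q q c"
      using R_spec_sHL_sg[OF q u, of 1 c] by simp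
    then show ?thesis
      using 2 d ac pos[of c] pos[of "Suc c"] b_spec_sHL[OF q, of 1 u] b_spec_sHL[OF q, of 0 u] Pi_spec_sHL_sg[OF u]
      by (simp add: init_prob_def step_prob_def b_spec_sg Suc_diff_le)
  next
    case 3
    then show ?thesis by (simp add: init_prob_def step_prob_def)
  qed
qed

text \<open>Here a, b, c are the lengths of \<kappa>, \<mu>, \<Lambda>. The value is the probability
  that the new length is one more than the maximum of b and c; when these differ, the new length is
  the maximum itself.\<close>

definition bulk_par :: "real \<Rightarrow> nat \<Rightarrow> nat \<Rightarrow> nat \<Rightarrow> real" where
  "bulk_par z a b c = (if b = c then if b = a then z * (1 - q) / (1 - q * z) else q * (1 - z) / (1 - q * z) else 0)"

text \<open>The ratio of \<open>R\<close> and Pi is a six vertex weight up to a factor uv, which the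
  values of \<open>b\<close> supply or cancel. Subtracting a from all lengths reduces the claim to a
  = 0, a check of four inputs.\<close>

lemma init_prob_sHL_sHL:
  assumes uv: "0 \<le> u" "u < 1" "0 \<le> v" "v < 1" and i: "i \<in> {0, 1}" "i' \<in> {0, 1}"
    and b: "0 < b_spec q (sHL v) i" "0 < b_spec q (sHL u) i'" and k: "a + max i i' \<le> k"
  shows "init_prob q (sHL u) (sHL v) i i' (k - (a + i), k - (a + i')) =
    step_prob (bulk_par (u * v) a (a + i) (a + i')) (max (a + i) (a + i')) k"
proof -
  define z where "z = u * v"
  have z: "z < 1" unfolding z_def using uv by (intro mult_less_one)
  have zq: "1 - z * q > 0" using mult_power_less_one[OF q z, of 1] by simp
  have nz: "1 - z \<noteq> 0" using z by simp
  note R = R_spec_sHL_sHL[OF q uv, folded z_def]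
  have P: "Pi_spec q (sHL u) (sHL v) = (1 - z * q) / (1 - z)"
    using Pi_spec_sHL_sHL[OF uv] by (simp add: z_def)
  have b01: "b_spec q (sHL w) 0 = 1" "b_spec q (sHL w) 1 = w" for w
    using b_spec_sHL[OF q, of 0 w] b_spec_sHL[OF q, of 1 w] by simp_all
  define n where "n = k - a"
  have n: "k - (a + i) = n - i" "k - (a + i') = n - i'" "k = a + n" "max i i' \<le> n" using k by (auto simp: n_def)
  have big: "init_prob q (sHL u) (sHL v) i i' (n - i, n - i') = 0" if "n \<noteq> max i i'" "n \<noteq> Suc (max i i')"
  proof -
    have "n - max i i' \<notin> {0, 1}" using that n(4) by auto
    then show ?thesis using n(4) by (auto simp: init_prob_def max_def split: if_splits)
  qed
  have *: "init_prob q (sHL u) (sHL v) i i' (n - i, n - i') =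
    step_prob (bulk_par z 0 i i') (max i i') n"
  proof (cases "n = max i i' \<or> n = Suc (max i i')")
    case False
    then show ?thesis using big by (simp add: step_prob_def)
  next
    case True
    consider "i = 0" "i' = 0" | "i = 1" "i' = 0" | "i = 0" "i' = 1" | "i = 1" "i' = 1" using i by blast
    then show ?thesis
    proof cases
      case 1
      then have "n = 0 \<or> n = 1" using True by auto
      moreover have "1 - z * (1 - q) / (1 - q * z) = (1 - z) / (1 - q * z)" using zq by (simp add: field_simps)
      ultimately show ?thesis using 1 nz zq R(1,2) P b01
        by (auto simp: init_prob_def step_prob_def bulk_par_def z_def mult_ac)
    next
      case 2
      then have "n = 1 \<or> n = 2" using True by auto
      then show ?thesis using 2 nz zq R(3) P b01 b
        by (auto simp: init_prob_def step_prob_def bulk_par_def)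
    next
      case 3
      then have "n = 1 \<or> n = 2" using True by auto
      then show ?thesis using 3 nz zq R(4) P b01 b
        by (auto simp: init_prob_def step_prob_def bulk_par_def)
    next
      case 4
      then have "n = 1 \<or> n = 2" using True by auto
      moreover have "1 - q * (1 - z) / (1 - q * z) = (1 - q) / (1 - q * z)" using zq by (simp add: field_simps)
      moreover have "u > 0" "v > 0" using b 4 b01 by auto
      ultimately show ?thesis using 4 nz zq R(5,6) P b01
        by (auto simp: init_prob_def step_prob_def bulk_par_def z_def mult_ac)
    qed
  qed
  show ?thesis
    unfolding n(1,2) * unfolding n(3) z_def[symmetric]
    by (auto simp: step_prob_def bulk_par_def max_def)
qed

end

section \<open>Admissible pairs of diagrams\<close>

lemma tail_size_rec: "tail_size \<nu> h = count \<nu> (Suc h) + tail_size \<nu> (Suc h)"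
proof -
  have "filter_mset ((<) h) \<nu> = filter_mset (\<lambda>r. r = Suc h) \<nu> + filter_mset ((<) (Suc h)) \<nu>"
    by (rule multiset_eqI) auto
  then have "tail_size \<nu> h = size (filter_mset (\<lambda>r. r = Suc h) \<nu>) + tail_size \<nu> (Suc h)"
    by (simp add: tail_size_def)
  then show ?thesis by (simp add: filter_eq_replicate_mset)
qed

lemma tail_size_empty [simp]: "tail_size {#} h = 0"
  by (simp add: tail_size_def)

lemma tail_size_0: "0 \<notin># \<nu> \<Longrightarrow> tail_size \<nu> 0 = size \<nu>"
  unfolding tail_size_def by (metis filter_mset_True filter_mset_cong not_gr_zero)

lemma eventually_tail_size: "\<forall>\<^sub>F h in sequentially. tail_size \<nu> h = 0"
proof -
  have "tail_size \<nu> h = 0" if "Max (insert 0 (set_mset \<nu>)) \<le> h" for h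
  proof -
    have "r \<le> h" if "r \<in># \<nu>" for r
      using that \<open>Max _ \<le> h\<close> by (meson Max_ge finite_insert finite_set_mset insertCI order_trans)
    then show ?thesis by (force simp: tail_size_def filter_mset_eq_conv intro: filter_mset_False)
  qed
  then show ?thesis unfolding eventually_sequentially by blast
qed

context yb_params
begin

text \<open>The differences of tails are the horizontal occupation numbers of the paths between two
  neighbouring diagrams. Positive \<open>b\<close> keeps the next initial law from dividing by 0.
  For \<open>sHL 0\<close> the conditions force equal tails.\<close>

definition adm :: "spec \<Rightarrow> diagram \<Rightarrow> diagram \<Rightarrow> bool" where
  "adm \<rho> \<mu> \<nu> \<longleftrightarrow> (\<forall>h. tail_size \<mu> h \<le> tail_size \<nu> h \<and> tail_size \<nu> h - tail_size \<mu> h \<in> occ \<rho>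
     \<and> \<not> wbad \<rho> (tail_size \<nu> h - tail_size \<mu> h) (tail_size \<nu> (Suc h) - tail_size \<mu> (Suc h)))
     \<and> 0 < b_spec q \<rho> (tail_size \<nu> 0 - tail_size \<mu> 0)"

lemma adm_empty: "adm \<rho> {#} {#}"
proof -
  have "0 \<in> occ \<rho>" by (cases \<rho>) auto
  then show ?thesis by (simp add: adm_def wbad_def b_spec_eq)
qed

text \<open>Going up in h, positivity is passed on, so each step does use a coupling and obeys
  conservation. Going down from a level beyond all parts, the conservation laws add up to identities
  for the tails, and \<open>adm\<close> can be read off.\<close>

lemma forward_adm:
  assumes valid: "valid \<rho>" "valid \<rho>s"
    and C: "\<And>c. boundary_data \<rho> \<rho>s c \<Longrightarrow> positive_sums q s \<rho> \<rho>s c \<Longrightarrow> is_coupling q s \<rho> \<rho>s c (C c)"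
    and adm: "adm \<rho>s \<kappa> \<mu>" "adm \<rho> \<kappa> \<Lambda>"
    and sg: "is_sg \<rho> \<Longrightarrow> \<kappa> = {#} \<and> \<mu> = {#}" "is_sg \<rho>s \<Longrightarrow> \<kappa> = {#} \<and> \<Lambda> = {#}"
    and nz: "\<And>H. forward_prob q s \<rho> \<rho>s C \<kappa> \<mu> \<Lambda> \<nu> j H \<noteq> 0"
    and j0: "\<forall>\<^sub>F h in sequentially. j h = (0, 0)"
  shows "adm \<rho> \<mu> \<nu> \<and> adm \<rho>s \<Lambda> \<nu> \<and> (\<forall>h. tail_size \<nu> h = tail_size \<mu> h + fst (j h) \<and> tail_size \<nu> h = tail_size \<Lambda> h + snd (j h))"
proof -
  define i where "i h = tail_size \<mu> h - tail_size \<kappa> h" for h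
  define i' where "i' h = tail_size \<Lambda> h - tail_size \<kappa> h" for h
  have le: "tail_size \<kappa> h \<le> tail_size \<mu> h" "tail_size \<kappa> h \<le> tail_size \<Lambda> h" for h
    using adm by (auto simp: adm_def)
  have occ: "i h \<in> occ \<rho>s" "i' h \<in> occ \<rho>" and bad: "\<not> wbad \<rho>s (i h) (i (Suc h))" "\<not> wbad \<rho> (i' h) (i' (Suc h))" for h
    using adm by (auto simp: adm_def i_def i'_def)
  have sg0: "is_sg \<rho> \<Longrightarrow> i h = 0" "is_sg \<rho>s \<Longrightarrow> i' h = 0" for h
    using sg by (auto simp: i_def i'_def)
  have init: "init_prob q \<rho> \<rho>s (i 0) (i' 0) (fst (j 0), snd (j 0)) \<noteq> 0"
    using nz[of 0] by (simp add: forward_prob_def i_def i'_def)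
  have step: "cond_step (C (fst (j h), snd (j h), count \<mu> (Suc h), i (Suc h), i' (Suc h), count \<Lambda> (Suc h)))
      (count \<kappa> (Suc h), i h, i' h) (count \<nu> (Suc h), fst (j (Suc h)), snd (j (Suc h))) \<noteq> 0" for h
    using nz[of "Suc h"] by (simp add: forward_prob_def i_def i'_def)
  \<comment> \<open>Together with \<open>occ\<close> and \<open>bad\<close> this makes the left term
    at (count of \<kappa>, i h, i' h) positive in the equation for level h + 1.\<close>
  define inv where "inv h \<longleftrightarrow> fst (j h) \<in> occ \<rho> \<and> snd (j h) \<in> occ \<rho>s \<and> i' h + snd (j h) = fst (j h) + i h
    \<and> \<not> Rbad \<rho> \<rho>s (fst (j h)) (snd (j h)) (i' h) (i h)" for h
  have inv_step: "inv (Suc h) \<and> count \<nu> (Suc h) + snd (j (Suc h)) = count \<Lambda> (Suc h) + snd (j h)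
    \<and> count \<nu> (Suc h) + fst (j (Suc h)) = count \<mu> (Suc h) + fst (j h)
    \<and> \<not> wbad \<rho>s (snd (j h)) (snd (j (Suc h))) \<and> \<not> wbad \<rho> (fst (j h)) (fst (j (Suc h)))"
    if "inv h" for h
  proof -
    define c where "c = (fst (j h), snd (j h), count \<mu> (Suc h), i (Suc h), i' (Suc h), count \<Lambda> (Suc h))"
    have o: "fst (j h) \<in> occ \<rho>" "snd (j h) \<in> occ \<rho>s" "i (Suc h) \<in> occ \<rho>s" "i' (Suc h) \<in> occ \<rho>" "i h \<in> occ \<rho>s" "i' h \<in> occ \<rho>"
      using that occ by (auto simp: inv_def)
    have cons: "i' h + snd (j h) = fst (j h) + i h"
      "count \<kappa> (Suc h) + i h = count \<mu> (Suc h) + i (Suc h)"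
      "count \<kappa> (Suc h) + i' h = count \<Lambda> (Suc h) + i' (Suc h)"
      using that le[of h] le[of "Suc h"] tail_size_rec[of \<kappa> h] tail_size_rec[of \<mu> h] tail_size_rec[of \<Lambda> h]
      unfolding inv_def i_def i'_def by linarith+
    have s: "is_sg \<rho> \<Longrightarrow> count \<mu> (Suc h) = 0 \<and> i (Suc h) = 0" "is_sg \<rho>s \<Longrightarrow> count \<Lambda> (Suc h) = 0 \<and> i' (Suc h) = 0"
      using sg sg0 by auto
    have "positive_sums q s \<rho> \<rho>s c"
      unfolding c_def by (rule yb_positive_sums[OF valid o cons s _ bad]) (use that in \<open>simp_all add: inv_def\<close>)
    moreover have "boundary_data \<rho> \<rho>s c" using o by (simp add: c_def)
    ultimately have "is_coupling q s \<rho> \<rho>s c (C c)" by (intro C)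
    from cond_step_nonzero[OF valid o cons s this[unfolded c_def] step]
    show ?thesis by (auto simp: inv_def)
  qed
  have init': "fst (j 0) \<in> occ \<rho> \<and> snd (j 0) \<in> occ \<rho>s \<and> i' 0 + snd (j 0) = fst (j 0) + i 0
    \<and> 0 < b_spec q \<rho> (fst (j 0)) \<and> 0 < b_spec q \<rho>s (snd (j 0)) \<and> \<not> Rbad \<rho> \<rho>s (fst (j 0)) (snd (j 0)) (i' 0) (i 0)"
    by (rule init_prob_nonzero[OF valid occ sg0 init])
  have inv: "inv h" for h
    by (induction h) (use init' inv_step in \<open>auto simp: inv_def\<close>)
  have ev: "\<forall>\<^sub>F h in sequentially. tail_size \<nu> h = tail_size \<mu> h + fst (j h) \<and> tail_size \<nu> h = tail_size \<Lambda> h + snd (j h)"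
    using eventually_tail_size[of \<nu>] eventually_tail_size[of \<mu>] eventually_tail_size[of \<Lambda>] j0
    by eventually_elim simp
  then obtain h0 where h0: "\<And>h. h0 \<le> h \<Longrightarrow> tail_size \<nu> h = tail_size \<mu> h + fst (j h) \<and> tail_size \<nu> h = tail_size \<Lambda> h + snd (j h)"
    by (auto simp: eventually_sequentially)
  have tails: "tail_size \<nu> h = tail_size \<mu> h + fst (j h) \<and> tail_size \<nu> h = tail_size \<Lambda> h + snd (j h)" for h
  proof (cases "h0 \<le> h")
    case True
    then show ?thesis by (rule h0)
  next
    case False
    then have "h \<le> h0" by simp
    then show ?thesis
    \<comment> \<open>Descending step: the tails at n exceed those at n + 1 by the multiplicities of
      n + 1, which \<open>inv_step\<close> relates to the occupation numbers at n and n + 1.\<close>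
    proof (induction rule: inc_induct)
      case base
      show ?case by (rule h0) simp
    next
      case (step n)
      then show ?case
        using inv_step[OF inv[of n]] tail_size_rec[of \<nu> n] tail_size_rec[of \<mu> n] tail_size_rec[of \<Lambda> n] by linarith
    qed
  qed
  have diff: "tail_size \<nu> h - tail_size \<mu> h = fst (j h)" "tail_size \<nu> h - tail_size \<Lambda> h = snd (j h)"
    "tail_size \<mu> h \<le> tail_size \<nu> h" "tail_size \<Lambda> h \<le> tail_size \<nu> h" for h
    using tails[of h] by linarith+
  have "adm \<rho> \<mu> \<nu>" "adm \<rho>s \<Lambda> \<nu>"
    unfolding adm_def diff using diff(3,4) inv inv_step init' by (auto simp: inv_def)
  then show ?thesis using tails by blast
qed

end

section \<open>Admissibility throughout the field\<close>

locale field_params = yb_params +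
  fixes \<alpha> \<beta> :: real and u v :: "nat \<Rightarrow> real"
  assumes u: "\<And>y. y \<ge> 1 \<Longrightarrow> 0 \<le> u y \<and> u y < 1"
    and v: "\<And>x. x \<ge> 1 \<Longrightarrow> 0 \<le> v x \<and> v x < 1"
    and \<alpha>: "0 \<le> \<alpha>" and \<beta>: "0 \<le> \<beta>" and \<alpha>\<beta>: "\<alpha> * \<beta> < 1"
begin

definition row_spec :: "nat \<Rightarrow> spec" where
  "row_spec y = (if y = 0 then sg \<alpha> else sHL (u y))"

definition col_spec :: "nat \<Rightarrow> spec" where
  "col_spec x = (if x = 0 then sg \<beta> else sHL (v x))"

lemma valid_row: "valid (row_spec y)" and valid_col: "valid (col_spec x)"
  using u[of y] v[of x] \<alpha> \<beta> by (simp_all add: row_spec_def col_spec_def)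

lemma is_sg_row: "is_sg (row_spec y) \<longleftrightarrow> y = 0" and is_sg_col: "is_sg (col_spec x) \<longleftrightarrow> x = 0"
  by (simp_all add: row_spec_def col_spec_def)

definition good :: "(nat \<Rightarrow> nat \<Rightarrow> diagram) \<Rightarrow> nat \<Rightarrow> nat \<Rightarrow> bool" where
  "good f x y \<longleftrightarrow> adm (row_spec y) (ext_empty f (int x) (int y - 1)) (f x y)
     \<and> adm (col_spec x) (ext_empty f (int x - 1) (int y)) (f x y)"

abbreviation transition_prob ::
  "(spec \<Rightarrow> spec \<Rightarrow> bdata \<Rightarrow> (triple \<times> triple) pmf) \<Rightarrow> (nat \<Rightarrow> nat \<Rightarrow> diagram) \<Rightarrow> nat \<Rightarrow> nat \<Rightarrow> (nat \<Rightarrow> nat \<times> nat) \<Rightarrow> nat \<Rightarrow> real"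
  where "transition_prob C f x y \<equiv> forward_prob q s (row_spec y) (col_spec x) (C (row_spec y) (col_spec x))
    (ext_empty f (int x - 1) (int y - 1)) (ext_empty f (int x) (int y - 1))
    (ext_empty f (int x - 1) (int y)) (f x y)"

text \<open>Induction on x + y: goodness at (x, y - 1) and (x - 1, y) is what
  \<open>forward_adm\<close> asks of the inputs, and outside the quadrant all diagrams are empty,
  hence admissible.\<close>

lemma field_good:
  assumes C: "\<And>x y c. boundary_data (row_spec y) (col_spec x) c \<Longrightarrow> positive_sums q s (row_spec y) (col_spec x) c \<Longrightarrow>
      is_coupling q s (row_spec y) (col_spec x) c (C (row_spec y) (col_spec x) c)"
    and nz: "\<And>x y H. transition_prob C f x y (j x y) H \<noteq> 0"
    and j0: "\<And>x y. \<forall>\<^sub>F h in sequentially. j x y h = (0, 0)"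
  shows "good f x y \<and>
    tail_size (f x y) h = tail_size (ext_empty f (int x) (int y - 1)) h + fst (j x y h) \<and>
    tail_size (f x y) h = tail_size (ext_empty f (int x - 1) (int y)) h + snd (j x y h)"
proof -
  have "good f x y \<and> (\<forall>h.
    tail_size (f x y) h = tail_size (ext_empty f (int x) (int y - 1)) h + fst (j x y h) \<and>
    tail_size (f x y) h = tail_size (ext_empty f (int x - 1) (int y)) h + snd (j x y h))"
  proof (induction "x + y" arbitrary: x y rule: less_induct)
    case less
    have "adm (col_spec x) (ext_empty f (int x - 1) (int y - 1)) (ext_empty f (int x) (int y - 1))"
    proof (cases "y = 0")
      case False
      then have "good f x (y - 1)" using less[of x "y - 1"] by simp
      then show ?thesis using False by (simp add: good_def ext_empty_def of_nat_diff nat_diff_distrib)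
    qed (simp add: ext_empty_def adm_empty)
    moreover have "adm (row_spec y) (ext_empty f (int x - 1) (int y - 1)) (ext_empty f (int x - 1) (int y))"
    proof (cases "x = 0")
      case False
      then have "good f (x - 1) y" using less[of "x - 1" y] by simp
      then show ?thesis using False by (simp add: good_def ext_empty_def of_nat_diff nat_diff_distrib)
    qed (simp add: ext_empty_def adm_empty)
    ultimately have "adm (row_spec y) (ext_empty f (int x) (int y - 1)) (f x y)
      \<and> adm (col_spec x) (ext_empty f (int x - 1) (int y)) (f x y) \<and> (\<forall>h.
      tail_size (f x y) h = tail_size (ext_empty f (int x) (int y - 1)) h + fst (j x y h) \<and>
      tail_size (f x y) h = tail_size (ext_empty f (int x - 1) (int y)) h + snd (j x y h))"
      by (intro forward_adm[OF valid_row valid_col C _ _ _ _ nz j0]) (simp_all add: is_sg_row is_sg_col ext_empty_def)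
    then show ?case unfolding good_def by blast
  qed
  then show ?thesis by blast
qed

end

section \<open>Discrete random fields\<close>

lemma countable_UNIV_multiset_nat: "countable (UNIV :: nat multiset set)"
proof -
  have "countable (range (mset :: nat list \<Rightarrow> nat multiset))" by simp
  then show ?thesis by (simp only: surj_mset)
qed

context prob_space
begin

lemma sets_fam_eq:
  assumes "finite I" "\<And>i. i \<in> I \<Longrightarrow> Y i \<in> measurable M (count_space UNIV)"
  shows "{\<omega> \<in> space M. \<forall>i\<in>I. Y i \<omega> = g i} \<in> sets M"
proof (rule sets.sets_Collect_finite_All[OF _ assms(1)])
  fix i assume "i \<in> I"
  then have "Y i -` {g i} \<inter> space M \<in> sets M"
    using assms(2) by (intro measurable_sets[of _ M "count_space UNIV"]) auto
  also have "Y i -` {g i} \<inter> space M = {\<omega> \<in> space M. Y i \<omega> = g i}" by auto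
  finally show "{\<omega> \<in> space M. Y i \<omega> = g i} \<in> sets M" .
qed

text \<open>There are only countably many value vectors, so the cells of probability 0 have a null
  union.\<close>

lemma AE_atom:
  assumes I: "finite I" and Y: "\<And>i. i \<in> I \<Longrightarrow> Y i \<in> measurable M (count_space UNIV)"
    and ct: "countable (UNIV :: 'c set)"
  shows "AE \<omega> in M. 0 < measure M {\<omega>' \<in> space M. \<forall>i\<in>I. Y i \<omega>' = (Y i \<omega> :: 'c)}"
proof -
  define A where "A g = {\<omega> \<in> space M. \<forall>i\<in>I. Y i \<omega> = g i}" for g
  define G where "G = {g \<in> PiE I (\<lambda>_. UNIV). measure M (A g) = 0}"
  have "countable (PiE I (\<lambda>_. UNIV :: 'c set))" using I ct by (intro countable_PiE) auto
  then have "countable G" unfolding G_def by (rule countable_subset[rotated]) auto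
  have "A g \<in> sets M" for g unfolding A_def by (rule sets_fam_eq[OF I Y])
  then have "(\<Union>g\<in>G. A g) \<in> null_sets M"
    by (intro null_sets_UN' \<open>countable G\<close>) (auto simp: null_sets_def G_def emeasure_eq_measure)
  then show ?thesis
  proof (rule AE_I')
    show "{\<omega> \<in> space M. \<not> 0 < measure M {\<omega>' \<in> space M. \<forall>i\<in>I. Y i \<omega>' = Y i \<omega>}} \<subseteq> (\<Union>g\<in>G. A g)"
    proof
      fix \<omega> assume \<omega>: "\<omega> \<in> {\<omega> \<in> space M. \<not> 0 < measure M {\<omega>' \<in> space M. \<forall>i\<in>I. Y i \<omega>' = Y i \<omega>}}"
      define g where "g = restrict (\<lambda>i. Y i \<omega>) I"
      have "A g = {\<omega>' \<in> space M. \<forall>i\<in>I. Y i \<omega>' = Y i \<omega>}" by (auto simp: A_def g_def)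
      then have "measure M (A g) = 0" using \<omega> by (simp add: not_less measure_le_0_iff)
      then have "g \<in> G" by (simp add: G_def g_def)
      moreover have "\<omega> \<in> A g" using \<omega> by (simp add: A_def g_def)
      ultimately show "\<omega> \<in> (\<Union>g\<in>G. A g)" by blast
    qed
  qed
qed

text \<open>The proportionality holds on each of the countably many cells where the family is
  constant, and is summed over them.\<close>

lemma measure_partition_eq:
  assumes I: "finite I" and Y: "\<And>i. i \<in> I \<Longrightarrow> Y i \<in> measurable M (count_space UNIV)"
    and ct: "countable (UNIV :: 'c set)"
    and E: "E \<in> sets M" and F: "F \<in> sets M" and c: "0 \<le> c"
    and eq: "\<And>g :: 'i \<Rightarrow> 'c. measure M (E \<inter> {\<omega> \<in> space M. \<forall>i\<in>I. Y i \<omega> = g i})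
        = c * measure M (F \<inter> {\<omega> \<in> space M. \<forall>i\<in>I. Y i \<omega> = g i})"
  shows "measure M E = c * measure M F"
proof -
  define A where "A g = {\<omega> \<in> space M. \<forall>i\<in>I. Y i \<omega> = g i}" for g
  define G where "G = PiE I (\<lambda>_. UNIV :: 'c set)"
  have ctG: "countable G" unfolding G_def using I ct by (intro countable_PiE) auto
  have A: "A g \<in> sets M" for g unfolding A_def by (rule sets_fam_eq[OF I Y])
  have dec: "emeasure M B = (\<integral>\<^sup>+g. emeasure M (B \<inter> A g) \<partial>count_space G)" if B: "B \<in> sets M" for B
  proof -
    have "B = (\<Union>g\<in>G. B \<inter> A g)"
    proof
      show "B \<subseteq> (\<Union>g\<in>G. B \<inter> A g)"
      proof
        fix \<omega> assume "\<omega> \<in> B"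
        then have "\<omega> \<in> A (restrict (\<lambda>i. Y i \<omega>) I)" using sets.sets_into_space[OF B] by (auto simp: A_def)
        then show "\<omega> \<in> (\<Union>g\<in>G. B \<inter> A g)" using \<open>\<omega> \<in> B\<close> by (auto simp: G_def)
      qed
    qed auto
    also have "emeasure M \<dots> = (\<integral>\<^sup>+g. emeasure M (B \<inter> A g) \<partial>count_space G)"
    proof (rule emeasure_UN_countable[OF _ ctG])
      show "disjoint_family_on (\<lambda>g. B \<inter> A g) G"
        unfolding disjoint_family_on_def
      proof (intro ballI impI)
        fix g h assume "g \<in> G" "h \<in> G" "g \<noteq> h"
        then have "\<exists>i\<in>I. g i \<noteq> h i" using PiE_ext[of g I _ h] unfolding G_def by blast
        then obtain i where "i \<in> I" "g i \<noteq> h i" by blast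
        then show "(B \<inter> A g) \<inter> (B \<inter> A h) = {}" by (auto simp: A_def)
      qed
    qed (use A B in auto)
    finally show ?thesis .
  qed
  have "emeasure M E = (\<integral>\<^sup>+g. ennreal c * emeasure M (F \<inter> A g) \<partial>count_space G)"
    unfolding dec[OF E]
    by (intro nn_integral_cong) (use eq c in \<open>simp add: A_def emeasure_eq_measure ennreal_mult\<close>)
  also have "\<dots> = ennreal c * emeasure M F"
    unfolding dec[OF F] by (rule nn_integral_cmult) simp
  finally show ?thesis
    using c by (simp add: emeasure_eq_measure flip: ennreal_mult)
qed

end

text \<open>A cylinder over a finite J is a countable union of points over any larger finite D. So
  point probabilities on a cofinal collection of sets D, later the squares, determine the
  law.\<close>

lemma distr_PiM_nat_eqI:
  fixes L :: "'i \<Rightarrow> 'a \<Rightarrow> nat" and L' :: "'i \<Rightarrow> 'b \<Rightarrow> nat"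
  assumes M: "prob_space M" and M': "prob_space M'"
    and L: "\<And>i. L i \<in> measurable M (count_space UNIV)" and L': "\<And>i. L' i \<in> measurable M' (count_space UNIV)"
    and cover: "\<And>J. finite J \<Longrightarrow> \<exists>D. finite D \<and> J \<subseteq> D \<and> (\<forall>g. measure M {\<omega> \<in> space M. \<forall>i\<in>D. L i \<omega> = g i}
       = measure M' {\<omega> \<in> space M'. \<forall>i\<in>D. L' i \<omega> = g i})"
  shows "distr M (PiM UNIV (\<lambda>_. count_space UNIV)) (\<lambda>\<omega> i. L i \<omega>) = distr M' (PiM UNIV (\<lambda>_. count_space UNIV)) (\<lambda>\<omega> i. L' i \<omega>)"
proof -
  let ?P = "PiM UNIV (\<lambda>_. count_space UNIV) :: ('i \<Rightarrow> nat) measure"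
  interpret M: prob_space M by fact
  interpret M': prob_space M' by fact
  have mL: "(\<lambda>\<omega> i. L i \<omega>) \<in> measurable M ?P"
    using L by (intro measurable_PiM_single') auto
  have mL': "(\<lambda>\<omega> i. L' i \<omega>) \<in> measurable M' ?P"
    using L' by (intro measurable_PiM_single') auto
  show ?thesis
  proof (rule measure_eqI_PiM_infinite)
    show "finite_measure (distr M ?P (\<lambda>\<omega> i. L i \<omega>))"
      using M.prob_space_distr[OF mL] by (simp add: prob_space_def)
    fix A :: "'i \<Rightarrow> nat set" and J :: "'i set"
    assume J: "finite J" "J \<subseteq> UNIV" and A: "\<And>i. i \<in> J \<Longrightarrow> A i \<in> sets (count_space UNIV)"
    obtain D where D: "finite D" "J \<subseteq> D" and eq: "\<And>g. measure M {\<omega> \<in> space M. \<forall>i\<in>D. L i \<omega> = g i}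
       = measure M' {\<omega> \<in> space M'. \<forall>i\<in>D. L' i \<omega> = g i}" using cover[OF J(1)] by blast
    define G where "G = PiE D (\<lambda>i. if i \<in> J then A i else UNIV)"
    have ct: "countable G" unfolding G_def using D by (intro countable_PiE) auto
    have dec: "emeasure N {\<omega> \<in> space N. \<forall>i\<in>J. X i \<omega> \<in> A i}
       = (\<integral>\<^sup>+g. emeasure N {\<omega> \<in> space N. \<forall>i\<in>D. X i \<omega> = g i} \<partial>count_space G)"
      if N: "prob_space N" and X: "\<And>i. X i \<in> measurable N (count_space UNIV)" for N :: "'c measure" and X :: "'i \<Rightarrow> 'c \<Rightarrow> nat"
    proof -
      have "{\<omega> \<in> space N. \<forall>i\<in>J. X i \<omega> \<in> A i} = (\<Union>g\<in>G. {\<omega> \<in> space N. \<forall>i\<in>D. X i \<omega> = g i})"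
      proof (intro equalityI subsetI)
        fix \<omega> assume "\<omega> \<in> {\<omega> \<in> space N. \<forall>i\<in>J. X i \<omega> \<in> A i}"
        then show "\<omega> \<in> (\<Union>g\<in>G. {\<omega> \<in> space N. \<forall>i\<in>D. X i \<omega> = g i})"
          by (intro UN_I[of "restrict (\<lambda>i. X i \<omega>) D"]) (auto simp: G_def)
      next
        fix \<omega> assume "\<omega> \<in> (\<Union>g\<in>G. {\<omega> \<in> space N. \<forall>i\<in>D. X i \<omega> = g i})"
        then obtain g where g: "g \<in> G" "\<omega> \<in> space N" "\<And>i. i \<in> D \<Longrightarrow> X i \<omega> = g i" by blast
        have "X i \<omega> \<in> A i" if "i \<in> J" for i
          using that g(3)[of i] D(2) PiE_mem[OF g(1)[unfolded G_def], of i] by auto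
        then show "\<omega> \<in> {\<omega> \<in> space N. \<forall>i\<in>J. X i \<omega> \<in> A i}" using g(2) by simp
      qed
      also have "emeasure N \<dots> = (\<integral>\<^sup>+g. emeasure N {\<omega> \<in> space N. \<forall>i\<in>D. X i \<omega> = g i} \<partial>count_space G)"
      proof (rule emeasure_UN_countable[OF _ ct])
        show "disjoint_family_on (\<lambda>g. {\<omega> \<in> space N. \<forall>i\<in>D. X i \<omega> = g i}) G"
          unfolding disjoint_family_on_def
        proof (intro ballI impI)
          fix g h assume "g \<in> G" "h \<in> G" "g \<noteq> h"
          then have "\<exists>i\<in>D. g i \<noteq> h i" using PiE_ext[of g D _ h] unfolding G_def by blast
          then obtain i where "i \<in> D" "g i \<noteq> h i" by blast
          then show "{\<omega> \<in> space N. \<forall>i\<in>D. X i \<omega> = g i} \<inter> {\<omega> \<in> space N. \<forall>i\<in>D. X i \<omega> = h i} = {}" by auto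
        qed
      qed (use prob_space.sets_fam_eq[OF N D(1) X] in auto)
      finally show ?thesis .
    qed
    have emb: "emeasure (distr N ?P (\<lambda>\<omega> i. X i \<omega>)) (prod_emb UNIV (\<lambda>_. count_space UNIV) J (Pi\<^sub>E J A))
        = emeasure N {\<omega> \<in> space N. \<forall>i\<in>J. X i \<omega> \<in> A i}"
      if "(\<lambda>\<omega> i. X i \<omega>) \<in> measurable N ?P" for N :: "'c measure" and X :: "'i \<Rightarrow> 'c \<Rightarrow> nat"
    proof -
      have "emeasure (distr N ?P (\<lambda>\<omega> i. X i \<omega>)) (prod_emb UNIV (\<lambda>_. count_space UNIV) J (Pi\<^sub>E J A))
        = emeasure N ((\<lambda>\<omega> i. X i \<omega>) -` prod_emb UNIV (\<lambda>_. count_space UNIV) J (Pi\<^sub>E J A) \<inter> space N)"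
        using J A by (intro emeasure_distr[OF that] sets_PiM_I) auto
      also have "(\<lambda>\<omega> i. X i \<omega>) -` prod_emb UNIV (\<lambda>_. count_space UNIV) J (Pi\<^sub>E J A) \<inter> space N
        = {\<omega> \<in> space N. \<forall>i\<in>J. X i \<omega> \<in> A i}"
        by (auto simp: prod_emb_def PiE_iff)
      finally show ?thesis .
    qed
    show "emeasure (distr M ?P (\<lambda>\<omega> i. L i \<omega>)) (prod_emb UNIV (\<lambda>_. count_space UNIV) J (Pi\<^sub>E J A))
      = emeasure (distr M' ?P (\<lambda>\<omega> i. L' i \<omega>)) (prod_emb UNIV (\<lambda>_. count_space UNIV) J (Pi\<^sub>E J A))"
      unfolding emb[OF mL] emb[OF mL'] dec[OF M L] dec[OF M' L']
      by (simp add: M.emeasure_eq_measure M'.emeasure_eq_measure eq)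
  qed simp_all
qed

context field_params
begin

section \<open>The kernel of the lengths and the laws it generates\<close>

definition diag_len :: "(nat \<Rightarrow> nat \<Rightarrow> nat) \<Rightarrow> nat \<Rightarrow> nat \<Rightarrow> nat" where
  "diag_len g x y = (if x = 0 \<or> y = 0 then 0 else g (x - 1) (y - 1))"

definition below_len :: "(nat \<Rightarrow> nat \<Rightarrow> nat) \<Rightarrow> nat \<Rightarrow> nat \<Rightarrow> nat" where
  "below_len g x y = (if y = 0 then 0 else g x (y - 1))"

definition left_len :: "(nat \<Rightarrow> nat \<Rightarrow> nat) \<Rightarrow> nat \<Rightarrow> nat \<Rightarrow> nat" where
  "left_len g x y = (if x = 0 then 0 else g (x - 1) y)"

definition step_par :: "(nat \<Rightarrow> nat \<Rightarrow> nat) \<Rightarrow> nat \<Rightarrow> nat \<Rightarrow> real" where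
  "step_par g x y = (if y = 0 then v x * \<alpha> / (1 + v x * \<alpha>)
     else if x = 0 then u y * \<beta> / (1 + u y * \<beta>)
     else bulk_par (u y * v x) (diag_len g x y) (below_len g x y) (left_len g x y))"

text \<open>The conditional law of the length at (x, y) given the three preceding ones: q-Poisson at
  the origin, a Bernoulli step elsewhere.\<close>

definition kern :: "(nat \<Rightarrow> nat \<Rightarrow> nat) \<Rightarrow> nat \<Rightarrow> nat \<Rightarrow> real" where
  "kern g x y = (if x = 0 \<and> y = 0 then (\<alpha> * \<beta>) ^ g 0 0 / qp q q (g 0 0) * qpoch_inf (\<alpha> * \<beta>) q
     else step_prob (step_par g x y) (max (below_len g x y) (left_len g x y)) (g x y))"

definition has_law :: "'a measure \<Rightarrow> (nat \<Rightarrow> nat \<Rightarrow> 'a \<Rightarrow> nat) \<Rightarrow> (nat \<times> nat) set \<Rightarrow> bool" where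
  "has_law M L D \<longleftrightarrow> (\<forall>g. measure M {\<omega> \<in> space M. \<forall>(x, y)\<in>D. L x y \<omega> = g x y} = (\<Prod>(x, y)\<in>D. kern g x y))"

definition down_closed :: "(nat \<times> nat) set \<Rightarrow> bool" where
  "down_closed D \<longleftrightarrow> (\<forall>x y x' y'. (x, y) \<in> D \<longrightarrow> x' \<le> x \<longrightarrow> y' \<le> y \<longrightarrow> (x', y') \<in> D)"

lemma kern_cong:
  assumes "\<And>x' y'. x' \<le> x \<Longrightarrow> y' \<le> y \<Longrightarrow> g x' y' = h x' y'"
  shows "kern g x y = kern h x y"
proof -
  have "g x y = h x y" "diag_len g x y = diag_len h x y" "below_len g x y = below_len h x y" "left_len g x y = left_len h x y"
    using assms by (auto simp: diag_len_def below_len_def left_len_def)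
  then show ?thesis using assms[of 0 0] by (simp add: kern_def step_par_def)
qed

lemma measurable_fam:
  fixes L :: "nat \<Rightarrow> nat \<Rightarrow> 'a \<Rightarrow> nat"
  assumes "prob_space M" "\<And>x y. L x y \<in> measurable M (count_space UNIV)" "finite D"
  shows "{\<omega> \<in> space M. \<forall>(x, y)\<in>D. L x y \<omega> = g x y} \<in> sets M"
  using prob_space.sets_fam_eq[OF assms(1,3), of "\<lambda>(x, y). L x y" "\<lambda>(x, y). g x y"] assms(2)
  by (simp add: case_prod_unfold)

text \<open>Summing over the value at a maximal point: the transition probabilities add up to 1.\<close>

lemma has_law_remove:
  fixes L :: "nat \<Rightarrow> nat \<Rightarrow> 'a \<Rightarrow> nat"
  assumes M: "prob_space M" and L: "\<And>x y. L x y \<in> measurable M (count_space UNIV)"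
    and D: "finite D" "down_closed D" and p: "(x0, y0) \<notin> D" "(x0, y0) \<noteq> (0, 0)"
    and law: "has_law M L (insert (x0, y0) D)"
  shows "has_law M L D"
  unfolding has_law_def
proof
  fix g :: "nat \<Rightarrow> nat \<Rightarrow> nat"
  interpret prob_space M by fact
  define n where "n = max (below_len g x0 y0) (left_len g x0 y0)"
  define r where "r = step_par g x0 y0"
  define P where "P = (\<Prod>(x, y)\<in>D. kern g x y)"
  define A where "A = {\<omega> \<in> space M. \<forall>(x, y)\<in>D. L x y \<omega> = g x y}"
  define B where "B k = {\<omega> \<in> space M. \<forall>(x, y)\<in>D. L x y \<omega> = g x y} \<inter> {\<omega> \<in> space M. L x0 y0 \<omega> = k}" for k
  have A: "A \<in> sets M" unfolding A_def by (rule measurable_fam[OF M L D(1)])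
  have B: "measure M (B k) = step_prob r n k * P" and Bm: "B k \<in> sets M" for k
  proof -
    define h where "h = (\<lambda>x y. if (x, y) = (x0, y0) then k else g x y)"
    have hg: "h x y = g x y" if "(x, y) \<in> D" for x y using that p by (auto simp: h_def)
    have "kern h x y = kern g x y" if "(x, y) \<in> D" for x y
      by (intro kern_cong hg) (use D(2) that in \<open>unfold down_closed_def, blast\<close>)
    then have "(\<Prod>(x, y)\<in>D. kern h x y) = P"
      unfolding P_def by (intro prod.cong) auto
    moreover have "kern h x0 y0 = step_prob r n k"
    proof -
      have "diag_len h x0 y0 = diag_len g x0 y0" "below_len h x0 y0 = below_len g x0 y0" "left_len h x0 y0 = left_len g x0 y0"
        by (auto simp: h_def diag_len_def below_len_def left_len_def)
      then show ?thesis using p(2) by (auto simp: kern_def step_par_def r_def n_def h_def)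
    qed
    moreover have eqB: "B k = {\<omega> \<in> space M. \<forall>(x, y)\<in>insert (x0, y0) D. L x y \<omega> = h x y}"
      using hg by (fastforce simp: B_def h_def)
    moreover have "measure M {\<omega> \<in> space M. \<forall>(x, y)\<in>insert (x0, y0) D. L x y \<omega> = h x y}
        = (\<Prod>(x, y)\<in>insert (x0, y0) D. kern h x y)"
      using law unfolding has_law_def by blast
    ultimately show "measure M (B k) = step_prob r n k * P"
      using D(1) p(1) by simp
    show "B k \<in> sets M"
      unfolding eqB by (rule measurable_fam[OF M L]) (use D in simp)
  qed
  \<comment> \<open>Only the values n and n + 1 have positive step probability, so the sum over the
    value at the removed point has two terms.\<close>
  have "AE \<omega> in M. \<forall>k. k \<noteq> n \<longrightarrow> k \<noteq> Suc n \<longrightarrow> \<omega> \<notin> B k"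
  proof (subst AE_all_countable, rule allI)
    fix k
    show "AE \<omega> in M. k \<noteq> n \<longrightarrow> k \<noteq> Suc n \<longrightarrow> \<omega> \<notin> B k"
    proof (cases "k = n \<or> k = Suc n")
      case False
      then have "measure M (B k) = 0" unfolding B by (simp add: step_prob_def)
      then have "B k \<in> null_sets M" using Bm by (simp add: null_sets_def emeasure_eq_measure)
      then show ?thesis by (rule AE_mp[OF AE_not_in]) simp
    qed auto
  qed
  then have "measure M A = measure M (B n \<union> B (Suc n))"
    by (intro measure_eq_AE A sets.Un Bm) (auto elim!: eventually_mono simp: A_def B_def)
  also have "\<dots> = measure M (B n) + measure M (B (Suc n))"
    by (intro finite_measure_Union Bm) (auto simp: B_def)
  also have "\<dots> = P" unfolding B by (simp add: step_prob_def algebra_simps)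
  finally show "measure M {\<omega> \<in> space M. \<forall>(x, y)\<in>D. L x y \<omega> = g x y} = (\<Prod>(x, y)\<in>D. kern g x y)"
    by (simp add: A_def P_def)
qed

text \<open>Serves to pass from a triangle to a square inside it. A point of T - D with least x + y
  can be added to D without losing down-closedness; induction gives the law there, and
  \<open>has_law_remove\<close> takes the point away.\<close>

lemma has_law_subset:
  fixes L :: "nat \<Rightarrow> nat \<Rightarrow> 'a \<Rightarrow> nat"
  assumes M: "prob_space M" and L: "\<And>x y. L x y \<in> measurable M (count_space UNIV)"
    and T: "finite T" "down_closed T" "has_law M L T"
    and D: "D \<subseteq> T" "down_closed D" "(0, 0) \<in> D"
  shows "has_law M L D"
  using D
proof (induction "card (T - D)" arbitrary: D rule: less_induct)
  case less
  show ?case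
  proof (cases "T - D = {}")
    case True
    then show ?thesis using less.prems T by (metis Diff_eq_empty_iff subset_antisym)
  next
    case False
    define p where "p = arg_min_on (\<lambda>(x, y). x + y) (T - D)"
    have fin: "finite (T - D)" using T by simp
    have p: "p \<in> T - D" unfolding p_def by (rule arg_min_if_finite(1)[OF fin False])
    have min: "(case p of (x, y) \<Rightarrow> x + y) \<le> (case p' of (x, y) \<Rightarrow> x + y)" if "p' \<in> T - D" for p'
      unfolding p_def by (rule arg_min_least[OF fin False that])
    obtain x0 y0 where p0: "p = (x0, y0)" by (cases p)
    have "(x', y') \<in> insert p D" if "x' \<le> x0" "y' \<le> y0" for x' y'
    proof (rule ccontr)
      assume "(x', y') \<notin> insert p D"
      moreover have "(x', y') \<in> T" using T(2) p p0 that unfolding down_closed_def by blast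
      ultimately have "x0 + y0 \<le> x' + y'" "(x', y') \<noteq> (x0, y0)" using min[of "(x', y')"] p0 by auto
      then show False using that by auto
    qed
    then have "down_closed (insert p D)"
      using less.prems(2) unfolding down_closed_def p0 by blast
    moreover have "card (T - insert p D) < card (T - D)"
      using p fin by (metis Diff_insert card_Diff1_less)
    ultimately have "has_law M L (insert p D)"
      using less p by (intro less.hyps) auto
    moreover have "finite D" using less.prems T(1) finite_subset by blast
    moreover have "(x0, y0) \<notin> D" using p p0 by auto
    moreover from this have "(x0, y0) \<noteq> (0, 0)" using less.prems(3) by metis
    ultimately show ?thesis
      unfolding p0 using less.prems(2) by (intro has_law_remove[OF M L, of D x0 y0])
  qed
qed

end

lemma (in prob_space) AE_obtain:
  assumes "AE \<omega> in M. P \<omega>" "0 < measure M A"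
  shows "\<exists>\<omega>\<in>A. P \<omega>"
proof (rule ccontr)
  assume n: "\<not> (\<exists>\<omega>\<in>A. P \<omega>)"
  have "A \<in> sets M" using assms(2) measure_notin_sets[of A M] by auto
  have "AE \<omega> in M. \<omega> \<notin> A" using assms(1) by eventually_elim (use n in auto)
  then have "measure M A = 0"
    using \<open>A \<in> sets M\<close> by (metis AE_iff_null_sets measure_eq_0_null_sets)
  then show False using assms(2) by simp
qed

text \<open>Two families with different value types are merged into one with values in a sum
  type.\<close>

lemma (in prob_space) AE_atom_mixed:
  fixes Y1 :: "'i \<Rightarrow> 'a \<Rightarrow> 'c" and Y2 :: "'j \<Rightarrow> 'a \<Rightarrow> 'd"
  assumes "finite I" "finite K"
    and "\<And>i. i \<in> I \<Longrightarrow> Y1 i \<in> measurable M (count_space UNIV)"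
    and "\<And>i. i \<in> K \<Longrightarrow> Y2 i \<in> measurable M (count_space UNIV)"
    and "countable (UNIV :: 'c set)" "countable (UNIV :: 'd set)"
  shows "AE \<omega> in M. 0 < measure M {\<omega>' \<in> space M. (\<forall>i\<in>I. Y1 i \<omega>' = Y1 i \<omega>) \<and> (\<forall>i\<in>K. Y2 i \<omega>' = Y2 i \<omega>)}"
proof -
  define Y where "Y k \<omega> = (case k of Inl i \<Rightarrow> Inl (Y1 i \<omega>) | Inr i \<Rightarrow> Inr (Y2 i \<omega>))" for k \<omega>
  have "Y k \<in> measurable M (count_space UNIV)" if "k \<in> Inl ` I \<union> Inr ` K" for k
  proof -
    from that consider i where "i \<in> I" "k = Inl i" | i where "i \<in> K" "k = Inr i" by blast
    then show ?thesis
    proof cases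
      case 1
      then have "Y k = (\<lambda>\<omega>. Inl (Y1 i \<omega>))" by (auto simp: Y_def)
      then show ?thesis using measurable_compose[OF assms(3)[OF 1(1)] measurable_count_space] by simp
    next
      case 2
      then have "Y k = (\<lambda>\<omega>. Inr (Y2 i \<omega>))" by (auto simp: Y_def)
      then show ?thesis using measurable_compose[OF assms(4)[OF 2(1)] measurable_count_space] by simp
    qed
  qed
  moreover have "countable (UNIV :: ('c + 'd) set)"
    using countable_Plus[OF assms(5,6)] by simp
  ultimately have "AE \<omega> in M. 0 < measure M {\<omega>' \<in> space M. \<forall>k\<in>Inl ` I \<union> Inr ` K. Y k \<omega>' = Y k \<omega>}"
    using assms(1,2) by (intro AE_atom) auto
  then show ?thesis by (simp add: Y_def ball_Un)
qed

context field_params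
begin

section \<open>The law of the lengths of the field\<close>

lemma kern_nonneg: "0 \<le> kern g x y"
proof -
  have frac: "0 \<le> a / (1 + a) \<and> a / (1 + a) \<le> 1" if "0 \<le> a" for a :: real
    using that by (simp add: field_simps)
  have step: "0 \<le> step_prob p n k" if "0 \<le> p \<and> p \<le> 1" for p n k
    using that by (simp add: step_prob_def)
  show ?thesis
  proof (cases "x = 0 \<and> y = 0")
    case True
    then show ?thesis
      using \<alpha> \<beta> qp_q_pos[OF q q(2), of "g 0 0"] qpoch_inf_pos[OF q \<alpha>\<beta>] by (simp add: kern_def)
  next
    case False
    have "0 \<le> step_par g x y \<and> step_par g x y \<le> 1"
    proof -
      consider "y = 0" "x \<noteq> 0" | "x = 0" "y \<noteq> 0" | "x \<noteq> 0" "y \<noteq> 0" using False by metis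
      then show ?thesis
      proof cases
        case 1
        then show ?thesis using v[of x] \<alpha> frac[of "v x * \<alpha>"] by (simp add: step_par_def)
      next
        case 2
        then show ?thesis using u[of y] \<beta> frac[of "u y * \<beta>"] by (simp add: step_par_def)
      next
        case 3
        define z where "z = u y * v x"
        have z: "0 \<le> z" "z < 1" using u[of y] v[of x] 3 mult_less_one by (auto simp: z_def)
        have zq: "q * z < 1" using mult_power_less_one[OF q z(2), of 1] by (simp add: mult.commute)
        have "0 \<le> (1 - q) * (1 - z)" using q z by simp
        then have "z * (1 - q) \<le> 1 - q * z" "q * (1 - z) \<le> 1 - q * z"
          using z q by (simp_all add: algebra_simps)
        then have "0 \<le> bulk_par z a b c \<and> bulk_par z a b c \<le> 1" for a b c
          using q z zq by (simp add: bulk_par_def)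
        then show ?thesis using 3 by (simp add: step_par_def z_def)
      qed
    qed
    then show ?thesis using False by (auto simp: kern_def step)
  qed
qed

lemma good_preds:
  assumes "\<And>x y. good f x y"
  shows "adm (col_spec x) (ext_empty f (int x - 1) (int y - 1)) (ext_empty f (int x) (int y - 1))"
    and "adm (row_spec y) (ext_empty f (int x - 1) (int y - 1)) (ext_empty f (int x - 1) (int y))"
proof -
  show "adm (col_spec x) (ext_empty f (int x - 1) (int y - 1)) (ext_empty f (int x) (int y - 1))"
  proof (cases "y = 0")
    case False
    then show ?thesis using assms[of x "y - 1"] by (simp add: good_def ext_empty_def of_nat_diff nat_diff_distrib)
  qed (simp add: ext_empty_def adm_empty)
  show "adm (row_spec y) (ext_empty f (int x - 1) (int y - 1)) (ext_empty f (int x - 1) (int y))"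
  proof (cases "x = 0")
    case False
    then show ?thesis using assms[of "x - 1" y] by (simp add: good_def ext_empty_def of_nat_diff nat_diff_distrib)
  qed (simp add: ext_empty_def adm_empty)
qed

text \<open>Admissibility of the inputs provides what the four explicit computations require:
  occupation numbers in range and positive values of \<open>b\<close>.\<close>

lemma init_prob_kern:
  assumes adm: "adm (col_spec x) \<kappa> \<mu>" "adm (row_spec y) \<kappa> \<Lambda>"
    and len: "tail_size \<kappa> 0 = diag_len g x y" "tail_size \<mu> 0 = below_len g x y" "tail_size \<Lambda> 0 = left_len g x y"
    and k: "max (below_len g x y) (left_len g x y) \<le> g x y"
  shows "init_prob q (row_spec y) (col_spec x) (tail_size \<mu> 0 - tail_size \<kappa> 0) (tail_size \<Lambda> 0 - tail_size \<kappa> 0)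
     (g x y - below_len g x y, g x y - left_len g x y) = kern g x y"
proof -
  have a: "tail_size \<kappa> 0 \<le> tail_size \<mu> 0" "tail_size \<mu> 0 - tail_size \<kappa> 0 \<in> occ (col_spec x)" "0 < b_spec q (col_spec x) (tail_size \<mu> 0 - tail_size \<kappa> 0)"
    "tail_size \<kappa> 0 \<le> tail_size \<Lambda> 0" "tail_size \<Lambda> 0 - tail_size \<kappa> 0 \<in> occ (row_spec y)" "0 < b_spec q (row_spec y) (tail_size \<Lambda> 0 - tail_size \<kappa> 0)"
    using adm by (auto simp: adm_def)
  consider "x = 0" "y = 0" | "x \<noteq> 0" "y = 0" | "x = 0" "y \<noteq> 0" | "x \<noteq> 0" "y \<noteq> 0" by blast
  then show ?thesis
  proof cases
    case 1
    then show ?thesis using init_prob_sg_sg[OF \<alpha> \<beta> \<alpha>\<beta>, of "g 0 0"] len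
      by (simp add: row_spec_def col_spec_def kern_def diag_len_def below_len_def left_len_def)
  next
    case 2
    then show ?thesis using init_prob_sg_sHL[OF \<alpha>, of "v x" "left_len g x y" "g x y"] v[of x] len k a
      by (simp add: row_spec_def col_spec_def kern_def step_par_def diag_len_def below_len_def)
  next
    case 3
    then show ?thesis using init_prob_sHL_sg[OF \<beta>, of "u y" "below_len g x y" "g x y"] u[of y] len k a
      by (simp add: row_spec_def col_spec_def kern_def step_par_def diag_len_def left_len_def)
  next
    case 4
    define i where "i = tail_size \<mu> 0 - tail_size \<kappa> 0"
    define i' where "i' = tail_size \<Lambda> 0 - tail_size \<kappa> 0"
    have e: "below_len g x y = diag_len g x y + i" "left_len g x y = diag_len g x y + i'"
      using a(1,4) len by (auto simp: i_def i'_def)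
    have uv: "0 \<le> u y" "u y < 1" "0 \<le> v x" "v x < 1" using u[of y] v[of x] 4 by auto
    have "init_prob q (sHL (u y)) (sHL (v x)) i i' (g x y - (diag_len g x y + i), g x y - (diag_len g x y + i')) =
       step_prob (bulk_par (u y * v x) (diag_len g x y) (diag_len g x y + i) (diag_len g x y + i'))
         (max (diag_len g x y + i) (diag_len g x y + i')) (g x y)"
      using a(2,3,5,6) k 4 unfolding e by (intro init_prob_sHL_sHL[OF uv]) (auto simp: i_def i'_def row_spec_def col_spec_def)
    then show ?thesis unfolding i_def[symmetric] i'_def[symmetric] e
      using 4 e by (simp add: row_spec_def col_spec_def kern_def step_par_def)
  qed
qed

lemma ext_empty_len:
  assumes "\<And>x y. 0 \<notin># f x y"
  shows "tail_size (ext_empty f (int x) (int y - 1)) 0 = below_len (\<lambda>x y. size (f x y)) x y"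
    and "tail_size (ext_empty f (int x - 1) (int y)) 0 = left_len (\<lambda>x y. size (f x y)) x y"
    and "tail_size (ext_empty f (int x - 1) (int y - 1)) 0 = diag_len (\<lambda>x y. size (f x y)) x y"
  using assms by (auto simp: ext_empty_def below_len_def left_len_def diag_len_def tail_size_0 nat_diff_distrib)

context
  fixes M :: "'a measure" and \<eta> :: "nat \<Rightarrow> nat \<Rightarrow> 'a \<Rightarrow> diagram"
    and C :: "spec \<Rightarrow> spec \<Rightarrow> bdata \<Rightarrow> (triple \<times> triple) pmf"
    and J :: "nat \<Rightarrow> nat \<Rightarrow> nat \<Rightarrow> 'a \<Rightarrow> nat \<times> nat"
  assumes M: "prob_space M"
    and \<eta>: "\<And>x y. \<eta> x y \<in> measurable M (count_space UNIV)"
    and pos: "\<And>x y \<omega>. \<omega> \<in> space M \<Longrightarrow> 0 \<notin># \<eta> x y \<omega>"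
    and C: "\<And>x y c. boundary_data (row_spec y) (col_spec x) c \<Longrightarrow> positive_sums q s (row_spec y) (col_spec x) c \<Longrightarrow>
      is_coupling q s (row_spec y) (col_spec x) c (C (row_spec y) (col_spec x) c)"
    and J: "\<And>x y h. J x y h \<in> measurable M (count_space UNIV)"
    and J0: "AE \<omega> in M. \<forall>x y. \<forall>\<^sub>F h in sequentially. J x y h \<omega> = (0, 0)"
    and law: "\<And>N H f j. measure M {\<omega> \<in> space M.
              (\<forall>x y. x + y < N \<longrightarrow> \<eta> x y \<omega> = f x y) \<and>
              (\<forall>x y. x + y = N \<longrightarrow>
                 (\<forall>h \<in> {1..H}. count (\<eta> x y \<omega>) h = count (f x y) h) \<and>
                 (\<forall>h \<le> H. J x y h \<omega> = j x y h))}
          = measure M {\<omega> \<in> space M. \<forall>x y. x + y < N \<longrightarrow> \<eta> x y \<omega> = f x y} *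
            (\<Prod>(x, y) \<in> {(x, y). x + y = N}.
               transition_prob C f x y (j x y) H)"
begin

interpretation prob_space M by (fact M)

lemma finite_antidiagonals: "finite {(x, y). x + y < (N::nat)}" "finite {(x, y). x + y = (N::nat)}"
  by (rule finite_subset[of _ "{..N} \<times> {..N}"]; auto)+

text \<open>Almost every \<omega> lies in a cylinder of positive probability, for all N and H at
  once. The sampling rule writes that probability as a product containing the transition
  probabilities at \<omega>, so none of them is 0.\<close>

lemma AE_forward_prob_nonzero:
  "AE \<omega> in M. \<forall>x y H. transition_prob C (\<lambda>x y. \<eta> x y \<omega>) x y (\<lambda>h. J x y h \<omega>) H \<noteq> 0"
proof -
  have "AE \<omega> in M. 0 < measure M {\<omega>' \<in> space M.
              (\<forall>x y. x + y < N \<longrightarrow> \<eta> x y \<omega>' = \<eta> x y \<omega>) \<and>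
              (\<forall>x y. x + y = N \<longrightarrow>
                 (\<forall>h \<in> {1..H}. count (\<eta> x y \<omega>') h = count (\<eta> x y \<omega>) h) \<and>
                 (\<forall>h \<le> H. J x y h \<omega>' = J x y h \<omega>))}" for N H
  proof -
    \<comment> \<open>A dummy 0 stands in for the multiplicity at h = 0: the sampling rule fixes
      \<open>J\<close> from h = 0 on, but multiplicities only from h = 1 on.\<close>
    have "AE \<omega> in M. 0 < measure M {\<omega>' \<in> space M.
       (\<forall>p\<in>{(x, y). x + y < N}. (case p of (x, y) \<Rightarrow> \<eta> x y) \<omega>' = (case p of (x, y) \<Rightarrow> \<eta> x y) \<omega>) \<and>
       (\<forall>p\<in>{(x, y). x + y = N} \<times> {..H}. (case p of ((x, y), h) \<Rightarrow> \<lambda>\<omega>. (if h = 0 then 0 else count (\<eta> x y \<omega>) h, J x y h \<omega>)) \<omega>'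
          = (case p of ((x, y), h) \<Rightarrow> \<lambda>\<omega>. (if h = 0 then 0 else count (\<eta> x y \<omega>) h, J x y h \<omega>)) \<omega>)}"
    proof (rule AE_atom_mixed)
      fix p :: "(nat \<times> nat) \<times> nat"
      have "(\<lambda>\<omega>. if h = 0 then 0 else count (\<eta> x y \<omega>) h) \<in> measurable M (count_space UNIV)" for x y h
        by (rule measurable_compose[OF \<eta> measurable_count_space])
      then have "(\<lambda>\<omega>. (if h = 0 then 0 else count (\<eta> x y \<omega>) h, J x y h \<omega>)) \<in> measurable M (count_space UNIV \<Otimes>\<^sub>M count_space UNIV)" for x y h
        using J by (intro measurable_Pair) auto
      then show "(case p of ((x, y), h) \<Rightarrow> \<lambda>\<omega>. (if h = 0 then 0 else count (\<eta> x y \<omega>) h, J x y h \<omega>)) \<in> measurable M (count_space UNIV)"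
        by (cases p) (auto simp: pair_measure_countable)
    qed (use \<eta> countable_UNIV_multiset_nat finite_antidiagonals in auto)
    moreover have "{\<omega>' \<in> space M.
       (\<forall>p\<in>{(x, y). x + y < N}. (case p of (x, y) \<Rightarrow> \<eta> x y) \<omega>' = (case p of (x, y) \<Rightarrow> \<eta> x y) \<omega>) \<and>
       (\<forall>p\<in>{(x, y). x + y = N} \<times> {..H}. (case p of ((x, y), h) \<Rightarrow> \<lambda>\<omega>. (if h = 0 then 0 else count (\<eta> x y \<omega>) h, J x y h \<omega>)) \<omega>'
          = (case p of ((x, y), h) \<Rightarrow> \<lambda>\<omega>. (if h = 0 then 0 else count (\<eta> x y \<omega>) h, J x y h \<omega>)) \<omega>)}
      = {\<omega>' \<in> space M.
              (\<forall>x y. x + y < N \<longrightarrow> \<eta> x y \<omega>' = \<eta> x y \<omega>) \<and>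
              (\<forall>x y. x + y = N \<longrightarrow>
                 (\<forall>h \<in> {1..H}. count (\<eta> x y \<omega>') h = count (\<eta> x y \<omega>) h) \<and>
                 (\<forall>h \<le> H. J x y h \<omega>' = J x y h \<omega>))}" for \<omega>
    proof (intro Collect_cong conj_cong refl)
      fix \<omega>'
      have ball_iff: "(\<forall>p\<in>{(x, y). x + y = N} \<times> {..H}. R p) \<longleftrightarrow> (\<forall>x y. x + y = N \<longrightarrow> (\<forall>h\<le>H. R ((x, y), h)))"
        for R :: "(nat \<times> nat) \<times> nat \<Rightarrow> bool" by auto
      have "(\<forall>h\<le>H. (if h = 0 then 0 else count (\<eta> x y \<omega>') h) = (if h = 0 then 0 else count (\<eta> x y \<omega>) h) \<and> J x y h \<omega>' = J x y h \<omega>)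
        \<longleftrightarrow> (\<forall>h \<in> {1..H}. count (\<eta> x y \<omega>') h = count (\<eta> x y \<omega>) h) \<and> (\<forall>h \<le> H. J x y h \<omega>' = J x y h \<omega>)" for x y
        by (auto simp: Suc_le_eq)
      then show "(\<forall>p\<in>{(x, y). x + y = N} \<times> {..H}. (case p of ((x, y), h) \<Rightarrow> \<lambda>\<omega>. (if h = 0 then 0 else count (\<eta> x y \<omega>) h, J x y h \<omega>)) \<omega>'
          = (case p of ((x, y), h) \<Rightarrow> \<lambda>\<omega>. (if h = 0 then 0 else count (\<eta> x y \<omega>) h, J x y h \<omega>)) \<omega>)
        \<longleftrightarrow> (\<forall>x y. x + y = N \<longrightarrow> (\<forall>h \<in> {1..H}. count (\<eta> x y \<omega>') h = count (\<eta> x y \<omega>) h) \<and> (\<forall>h \<le> H. J x y h \<omega>' = J x y h \<omega>))"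
        unfolding ball_iff by simp
    qed auto
    ultimately show ?thesis by simp
  qed
  then have "AE \<omega> in M. \<forall>N H. 0 < measure M {\<omega>' \<in> space M.
              (\<forall>x y. x + y < N \<longrightarrow> \<eta> x y \<omega>' = \<eta> x y \<omega>) \<and>
              (\<forall>x y. x + y = N \<longrightarrow>
                 (\<forall>h \<in> {1..H}. count (\<eta> x y \<omega>') h = count (\<eta> x y \<omega>) h) \<and>
                 (\<forall>h \<le> H. J x y h \<omega>' = J x y h \<omega>))}"
    by (simp add: AE_all_countable)
  then show ?thesis
  proof eventually_elim
    case (elim \<omega>)
    show ?case
    proof (intro allI)
      fix x y H
      have "(\<Prod>(x', y') \<in> {(x', y'). x' + y' = x + y}.
               transition_prob C (\<lambda>x y. \<eta> x y \<omega>) x' y' (\<lambda>h. J x' y' h \<omega>) H) \<noteq> 0"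
        using elim[rule_format, of "x + y" H] unfolding law by auto
      then have "\<forall>p \<in> {(x', y'). x' + y' = x + y}. (case p of (x', y') \<Rightarrow> 
               transition_prob C (\<lambda>x y. \<eta> x y \<omega>) x' y' (\<lambda>h. J x' y' h \<omega>) H) \<noteq> 0"
        by (subst (asm) prod_zero_iff[OF finite_antidiagonals(2)]) blast
      from bspec[OF this, of "(x, y)"]
      show "transition_prob C (\<lambda>x y. \<eta> x y \<omega>) x y (\<lambda>h. J x y h \<omega>) H \<noteq> 0" by simp
    qed
  qed
qed

lemma AE_good:
  "AE \<omega> in M. \<forall>x y. good (\<lambda>x y. \<eta> x y \<omega>) x y
     \<and> size (\<eta> x y \<omega>) = below_len (\<lambda>x y. size (\<eta> x y \<omega>)) x y + fst (J x y 0 \<omega>)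
     \<and> size (\<eta> x y \<omega>) = left_len (\<lambda>x y. size (\<eta> x y \<omega>)) x y + snd (J x y 0 \<omega>)"
  using AE_forward_prob_nonzero J0 AE_space
proof eventually_elim
  case (elim \<omega>)
  have p: "0 \<notin># \<eta> x y \<omega>" for x y using pos elim(3) by blast
  show ?case
  proof (intro allI)
    fix x y
    have "good (\<lambda>x y. \<eta> x y \<omega>) x y \<and>
      tail_size (\<eta> x y \<omega>) 0 = tail_size (ext_empty (\<lambda>x y. \<eta> x y \<omega>) (int x) (int y - 1)) 0 + fst (J x y 0 \<omega>) \<and>
      tail_size (\<eta> x y \<omega>) 0 = tail_size (ext_empty (\<lambda>x y. \<eta> x y \<omega>) (int x - 1) (int y)) 0 + snd (J x y 0 \<omega>)"
      by (rule field_good[where f = "\<lambda>x y. \<eta> x y \<omega>" and j = "\<lambda>x y h. J x y h \<omega>" and C = C]) (use C elim in auto)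
    then show "good (\<lambda>x y. \<eta> x y \<omega>) x y
     \<and> size (\<eta> x y \<omega>) = below_len (\<lambda>x y. size (\<eta> x y \<omega>)) x y + fst (J x y 0 \<omega>)
     \<and> size (\<eta> x y \<omega>) = left_len (\<lambda>x y. size (\<eta> x y \<omega>)) x y + snd (J x y 0 \<omega>)"
      unfolding ext_empty_len[OF p] tail_size_0[OF p] .
  qed
qed

lemma measurable_size: "(\<lambda>\<omega>. size (\<eta> x y \<omega>)) \<in> measurable M (count_space UNIV)"
  by (rule measurable_compose[OF \<eta> measurable_count_space])

text \<open>The sampling rule is used with H = 0, since by \<open>AE_good\<close> the pair
  \<open>J x y 0\<close> already determines the length. The factor in front depends on f only
  through the lengths g.\<close>

lemma field_cylinder:
  assumes g: "\<And>x y. x + y < N \<Longrightarrow> size (f x y) = g x y"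
    and A: "A = {\<omega> \<in> space M. \<forall>x y. x + y < N \<longrightarrow> \<eta> x y \<omega> = f x y}"
  shows "measure M {\<omega> \<in> A. \<forall>x y. x + y = N \<longrightarrow> size (\<eta> x y \<omega>) = g x y}
    = (\<Prod>(x, y)\<in>{(x, y). x + y = N}. kern g x y) * measure M A"
proof -
  have "A = {\<omega> \<in> space M. \<forall>p\<in>{(x, y). x + y < N}. (\<lambda>(x, y). \<eta> x y) p \<omega> = (\<lambda>(x, y). f x y) p}"
    by (auto simp: A)
  also have "\<dots> \<in> sets M"
    by (rule sets_fam_eq[OF finite_antidiagonals(1)]) (use \<eta> in auto)
  finally have sets_A: "A \<in> sets M" .
  have "{\<omega> \<in> A. \<forall>x y. x + y = N \<longrightarrow> size (\<eta> x y \<omega>) = g x y}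
     = A \<inter> {\<omega> \<in> space M. \<forall>(x, y)\<in>{(x, y). x + y = N}. size (\<eta> x y \<omega>) = g x y}"
    by (auto simp: A)
  also have "\<dots> \<in> sets M"
    by (intro sets.Int sets_A measurable_fam[OF M measurable_size finite_antidiagonals(2)])
  finally have sets_E: "{\<omega> \<in> A. \<forall>x y. x + y = N \<longrightarrow> size (\<eta> x y \<omega>) = g x y} \<in> sets M" .
  show ?thesis
  proof (cases "measure M A = 0")
    case True
    have "measure M {\<omega> \<in> A. \<forall>x y. x + y = N \<longrightarrow> size (\<eta> x y \<omega>) = g x y} \<le> measure M A"
      by (intro finite_measure_mono sets_A) auto
    then show ?thesis using True by (simp add: measure_le_0_iff)
  next
    case False
    then have "0 < measure M A" by (simp add: zero_less_measure_iff)
    \<comment> \<open>One good point of A suffices: on the earlier antidiagonals its diagrams are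
      those of f, which shows that f provides admissible inputs.\<close>
    from AE_obtain[OF AE_conjI[OF AE_good AE_space] this] obtain \<omega>0 where \<omega>0: "\<omega>0 \<in> A"
      "\<And>x y. good (\<lambda>x y. \<eta> x y \<omega>0) x y" "\<omega>0 \<in> space M" by blast
    have f0: "\<eta> x y \<omega>0 = f x y" if "x + y < N" for x y using \<omega>0(1) that by (simp add: A)
    define b where "b = below_len g"
    define c where "c = left_len g"
    have ext: "ext_empty (\<lambda>x y. \<eta> x y \<omega>0) (int x - 1) (int y - 1) = ext_empty f (int x - 1) (int y - 1)"
        "ext_empty (\<lambda>x y. \<eta> x y \<omega>0) (int x) (int y - 1) = ext_empty f (int x) (int y - 1)"
        "ext_empty (\<lambda>x y. \<eta> x y \<omega>0) (int x - 1) (int y) = ext_empty f (int x - 1) (int y)"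
      if "x + y = N" for x y
      using f0[of "x - 1" "y - 1"] f0[of x "y - 1"] f0[of "x - 1" y] that
      by (auto simp: ext_empty_def nat_diff_distrib)
    have p: "0 \<notin># \<eta> x y \<omega>0" for x y using pos \<omega>0(3) by blast
    have lens: "diag_len (\<lambda>x y. size (\<eta> x y \<omega>)) x y = diag_len g x y"
        "below_len (\<lambda>x y. size (\<eta> x y \<omega>)) x y = below_len g x y"
        "left_len (\<lambda>x y. size (\<eta> x y \<omega>)) x y = left_len g x y"
      if "x + y = N" "\<omega> \<in> A" for x y \<omega>
      using that by (simp_all add: diag_len_def below_len_def left_len_def A g)
    show ?thesis
    proof (cases "\<forall>x y. x + y = N \<longrightarrow> max (b x y) (c x y) \<le> g x y")
      case True
      let ?B = "{\<omega> \<in> space M.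
                (\<forall>x y. x + y < N \<longrightarrow> \<eta> x y \<omega> = f x y) \<and>
                (\<forall>x y. x + y = N \<longrightarrow>
                   (\<forall>h \<in> {1..0}. count (\<eta> x y \<omega>) h = count (f x y) h) \<and>
                   (\<forall>h \<le> 0. J x y h \<omega> = (g x y - b x y, g x y - c x y)))}"
      have "measure M {\<omega> \<in> A. \<forall>x y. x + y = N \<longrightarrow> size (\<eta> x y \<omega>) = g x y} = measure M ?B"
      proof (rule measure_eq_AE)
        show "AE \<omega> in M. (\<omega> \<in> {\<omega> \<in> A. \<forall>x y. x + y = N \<longrightarrow> size (\<eta> x y \<omega>) = g x y}) = (\<omega> \<in> ?B)"
          using AE_good AE_space
        proof eventually_elim
          case (elim \<omega>)
          \<comment> \<open>Either component of \<open>J\<close> at 0 gives the length and is given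
            by it; the bounds from \<open>True\<close> make the subtractions exact.\<close>
          have eq: "(size (\<eta> x y \<omega>) = g x y) = (J x y 0 \<omega> = (g x y - b x y, g x y - c x y))"
            if "x + y = N" "\<omega> \<in> A" for x y
          proof -
            have "size (\<eta> x y \<omega>) = b x y + fst (J x y 0 \<omega>)" "size (\<eta> x y \<omega>) = c x y + snd (J x y 0 \<omega>)"
              using elim(1)[rule_format, of x y] lens[OF that] unfolding b_def c_def by linarith+
            moreover have "max (b x y) (c x y) \<le> g x y" using True that by blast
            then have "b x y \<le> g x y" "c x y \<le> g x y" by simp_all
            moreover have "n = k \<longleftrightarrow> m1 = k - n1 \<and> m2 = k - n2"
              if "n = n1 + m1" "n = n2 + m2" "n1 \<le> k" "n2 \<le> k" for n k m1 m2 n1 n2 :: nat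
              using that by auto
            ultimately have "size (\<eta> x y \<omega>) = g x y \<longleftrightarrow> fst (J x y 0 \<omega>) = g x y - b x y \<and> snd (J x y 0 \<omega>) = g x y - c x y"
              by blast
            then show ?thesis by (simp only: prod_eq_iff fst_conv snd_conv)
          qed
          have B: "\<omega> \<in> ?B \<longleftrightarrow> \<omega> \<in> A \<and> (\<forall>x y. x + y = N \<longrightarrow> J x y 0 \<omega> = (g x y - b x y, g x y - c x y))"
            by (simp add: A)
          show ?case
            by (subst B, subst mem_Collect_eq, intro conj_cong refl iff_allI imp_cong, rule eq)
        qed
        show "{\<omega> \<in> A. \<forall>x y. x + y = N \<longrightarrow> size (\<eta> x y \<omega>) = g x y} \<in> sets M" by (rule sets_E)
        have "?B = A \<inter> {\<omega> \<in> space M. \<forall>p\<in>{(x, y). x + y = N}.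
            (\<lambda>(x, y). J x y 0) p \<omega> = (\<lambda>(x, y). (g x y - b x y, g x y - c x y)) p}"
          by (rule set_eqI) (simp add: A, blast)
        also have "\<dots> \<in> sets M"
          by (intro sets.Int sets_A sets_fam_eq[OF finite_antidiagonals(2)]) (use J in auto)
        finally show "?B \<in> sets M" .
      qed
      also have "\<dots> = measure M A * (\<Prod>(x, y) \<in> {(x, y). x + y = N}.
                 transition_prob C f x y (\<lambda>h. (g x y - b x y, g x y - c x y)) 0)"
        unfolding law A ..
      also have "(\<Prod>(x, y) \<in> {(x, y). x + y = N}.
                 transition_prob C f x y (\<lambda>h. (g x y - b x y, g x y - c x y)) 0)
         = (\<Prod>(x, y)\<in>{(x, y). x + y = N}. kern g x y)"
      proof (rule prod.cong[OF refl], clarify)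
        fix x y assume N: "N = x + y"
        have "init_prob q (row_spec y) (col_spec x)
            (tail_size (ext_empty f (int x) (int y - 1)) 0 - tail_size (ext_empty f (int x - 1) (int y - 1)) 0)
            (tail_size (ext_empty f (int x - 1) (int y)) 0 - tail_size (ext_empty f (int x - 1) (int y - 1)) 0)
            (g x y - below_len g x y, g x y - left_len g x y) = kern g x y"
        proof (rule init_prob_kern)
          show "adm (col_spec x) (ext_empty f (int x - 1) (int y - 1)) (ext_empty f (int x) (int y - 1))"
            "adm (row_spec y) (ext_empty f (int x - 1) (int y - 1)) (ext_empty f (int x - 1) (int y))"
            using good_preds[of "\<lambda>x y. \<eta> x y \<omega>0", OF \<omega>0(2), where x = x and y = y] N by (simp_all add: ext)
          show "tail_size (ext_empty f (int x - 1) (int y - 1)) 0 = diag_len g x y"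
            "tail_size (ext_empty f (int x) (int y - 1)) 0 = below_len g x y"
            "tail_size (ext_empty f (int x - 1) (int y)) 0 = left_len g x y"
            using ext_empty_len[of "\<lambda>x y. \<eta> x y \<omega>0", OF p, where x = x and y = y]
              lens[OF N[symmetric] \<omega>0(1)] N by (simp_all add: ext)
          show "max (below_len g x y) (left_len g x y) \<le> g x y" using True N by (simp add: b_def c_def)
        qed
        then show "transition_prob C f x y (\<lambda>h. (g x y - b x y, g x y - c x y)) 0 = kern g x y"
          by (simp add: forward_prob_def b_def c_def)
      qed
      finally show ?thesis by (simp add: mult.commute)
    next
      \<comment> \<open>A length below that of a neighbour is impossible on both sides: the kernel
        is 0 there, and by \<open>AE_good\<close> lengths do not decrease upwards or to the
        right.\<close>
      case False
      then obtain x y where xy: "x + y = N" "\<not> max (b x y) (c x y) \<le> g x y" by blast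
      then have xy': "g x y < max (b x y) (c x y)" by linarith
      have "kern g x y = 0"
        using xy' by (auto simp: kern_def step_prob_def b_def c_def below_len_def left_len_def)
      then have "(\<Prod>(x, y)\<in>{(x, y). x + y = N}. kern g x y) = 0"
        using xy(1) by (intro prod_zero finite_antidiagonals) auto
      moreover have "measure M {\<omega> \<in> A. \<forall>x y. x + y = N \<longrightarrow> size (\<eta> x y \<omega>) = g x y} = measure M {}"
      proof (rule measure_eq_AE)
        show "AE \<omega> in M. (\<omega> \<in> {\<omega> \<in> A. \<forall>x y. x + y = N \<longrightarrow> size (\<eta> x y \<omega>) = g x y}) = (\<omega> \<in> {})"
          using AE_good
        proof eventually_elim
          case (elim \<omega>)
          have "size (\<eta> x y \<omega>) \<noteq> g x y" if "\<omega> \<in> A"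
            using elim[rule_format, of x y] lens[OF xy(1) that] xy' unfolding b_def c_def by linarith
          then show ?case using xy(1) by blast
        qed
      qed (simp_all add: sets_E)
      ultimately show ?thesis by simp
    qed
  qed
qed

text \<open>Antidiagonals are added one at a time. The factor from \<open>field_cylinder\<close> is
  the same for all diagrams f with the prescribed lengths, so \<open>measure_partition_eq\<close>
  sums it over f.\<close>

lemma field_law: "has_law M (\<lambda>x y \<omega>. size (\<eta> x y \<omega>)) {(x, y). x + y < N}"
proof (induction N)
  case 0
  then show ?case by (simp add: has_law_def prob_space)
next
  case (Suc N)
  show ?case unfolding has_law_def
  proof
    fix g
    let ?T = "\<lambda>N. {\<omega> \<in> space M. \<forall>(x, y)\<in>{(x, y). x + y < N}. size (\<eta> x y \<omega>) = g x y}"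
    let ?P = "\<Prod>(x, y)\<in>{(x, y). x + y = N}. kern g x y"
    have sets: "?T n \<in> sets M" for n
      by (rule measurable_fam[OF M measurable_size finite_antidiagonals(1)])
    have "0 \<le> ?P" by (intro prod_nonneg) (auto simp: kern_nonneg)
    have "measure M (?T (Suc N)) = ?P * measure M (?T N)"
    proof (rule measure_partition_eq[where Y = "\<lambda>(x, y). \<eta> x y", OF finite_antidiagonals(1) _ countable_UNIV_multiset_nat sets sets \<open>0 \<le> ?P\<close>])
      fix f' :: "nat \<times> nat \<Rightarrow> diagram"
      define f where "f x y = f' (x, y)" for x y
      define A where "A = {\<omega> \<in> space M. \<forall>x y. x + y < N \<longrightarrow> \<eta> x y \<omega> = f x y}"
      have A': "{\<omega> \<in> space M. \<forall>i\<in>{(x, y). x + y < N}. (case i of (x, y) \<Rightarrow> \<eta> x y) \<omega> = f' i} = A"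
        by (rule set_eqI) (simp add: A_def f_def)
      show "measure M (?T (Suc N) \<inter> {\<omega> \<in> space M. \<forall>i\<in>{(x, y). x + y < N}. (case i of (x, y) \<Rightarrow> \<eta> x y) \<omega> = f' i})
        = ?P * measure M (?T N \<inter> {\<omega> \<in> space M. \<forall>i\<in>{(x, y). x + y < N}. (case i of (x, y) \<Rightarrow> \<eta> x y) \<omega> = f' i})"
        unfolding A'
      proof (cases "\<forall>x y. x + y < N \<longrightarrow> size (f x y) = g x y")
        case True
        have mem: "\<omega> \<in> ?T n \<longleftrightarrow> \<omega> \<in> space M \<and> (\<forall>x y. x + y < n \<longrightarrow> size (\<eta> x y \<omega>) = g x y)" for \<omega> n
          by simp
        have sz: "\<omega> \<in> space M \<and> (\<forall>x y. x + y < N \<longrightarrow> size (\<eta> x y \<omega>) = g x y)" if "\<omega> \<in> A" for \<omega>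
          using that True by (simp add: A_def)
        have "?T N \<inter> A = A"
          by (rule set_eqI) (use sz mem in blast)
        moreover have "?T (Suc N) \<inter> A = {\<omega> \<in> A. \<forall>x y. x + y = N \<longrightarrow> size (\<eta> x y \<omega>) = g x y}"
          by (rule set_eqI) (unfold Int_iff mem less_Suc_eq mem_Collect_eq, use sz in blast)
        moreover have "measure M {\<omega> \<in> A. \<forall>x y. x + y = N \<longrightarrow> size (\<eta> x y \<omega>) = g x y} = ?P * measure M A"
          by (rule field_cylinder[OF _ A_def]) (use True in blast)
        ultimately show "measure M (?T (Suc N) \<inter> A) = ?P * measure M (?T N \<inter> A)"
          by (simp only:)
      next
        case False
        then obtain x y where xy: "x + y < N" "size (f x y) \<noteq> g x y" by blast
        have "\<omega> \<notin> ?T n" if "\<omega> \<in> A" "x + y < n" for \<omega> n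
        proof
          assume "\<omega> \<in> ?T n"
          then have "size (\<eta> x y \<omega>) = g x y" using that(2) by blast
          moreover have "\<eta> x y \<omega> = f x y" using that(1) xy(1) unfolding A_def by blast
          ultimately show False using xy(2) by simp
        qed
        then have "?T N \<inter> A = {}" "?T (Suc N) \<inter> A = {}" using xy(1) less_SucI by blast+
        then show "measure M (?T (Suc N) \<inter> A) = ?P * measure M (?T N \<inter> A)" by simp
      qed
    qed (use \<eta> in auto)
    also have "measure M (?T N) = (\<Prod>(x, y)\<in>{(x, y). x + y < N}. kern g x y)"
      using Suc unfolding has_law_def by blast
    also have "?P * \<dots> = (\<Prod>(x, y)\<in>{(x, y). x + y = N} \<union> {(x, y). x + y < N}. kern g x y)"
      by (intro prod.union_disjoint[symmetric] finite_antidiagonals) auto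
    also have "{(x, y). x + y = N} \<union> {(x, y). x + y < N} = {(x, y). x + y < Suc N}"
      by (rule set_eqI) (simp add: split_beta less_Suc_eq disj_commute)
    finally show "measure M (?T (Suc N)) = (\<Prod>(x, y)\<in>{(x, y). x + y < Suc N}. kern g x y)" .
  qed
qed

end

end

section \<open>The stochastic six vertex model\<close>

lemma L6V_nonzero:
  assumes "L6V q z i1 j1 i2 j2 \<noteq> 0"
  shows "i1 \<le> 1 \<and> j1 \<le> 1 \<and> i2 \<le> 1 \<and> j2 \<le> 1 \<and> i1 + j1 = i2 + j2"
  using assms unfolding L6V_def by (auto split: if_splits)

lemma card_filter_Suc:
  "card {k \<in> {1..Suc n}. P k} = card {k \<in> {1..n}. P k} + (if P (Suc n) then 1 else 0)"
proof -
  have "{k \<in> {1..Suc n}. P k} = (if P (Suc n) then insert (Suc n) {k \<in> {1..n}. P k} else {k \<in> {1..n}. P k})"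
    by (auto simp: le_Suc_eq)
  then show ?thesis by simp
qed

lemma card_filter_le: "card {k \<in> {1..n}. P k} \<le> (n::nat)"
proof -
  have "card {k \<in> {1..n}. P k} \<le> card {1..n}" by (rule card_mono) auto
  then show ?thesis by simp
qed

text \<open>Counterpart of the length of the diagram: y minus the shifted height, written without
  negative terms as \<M> plus the paths entering from below plus the empty ones among the first y
  horizontal edges.\<close>

definition six_len :: "(nat \<Rightarrow> nat \<Rightarrow> 'a \<Rightarrow> nat) \<Rightarrow> (nat \<Rightarrow> nat \<Rightarrow> 'a \<Rightarrow> nat) \<Rightarrow> ('a \<Rightarrow> nat) \<Rightarrow> nat \<Rightarrow> nat \<Rightarrow> 'a \<Rightarrow> nat" where
  "six_len V E Q x y \<omega> = Q \<omega> + (\<Sum>k = 1..x. V k 1 \<omega>) + (y - card {k \<in> {1..y}. E (x + 1) k \<omega> = 1})"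

lemma six_len_height: "int y - int (six_len V E Q x y \<omega>) = height_6V V E x y \<omega> - int (Q \<omega>)"
  using card_filter_le[where P = "\<lambda>k. E (x + 1) k \<omega> = 1" and n = y]
  by (simp add: six_len_def height_6V_def of_nat_diff)

lemma six_len_origin: "six_len V E Q 0 0 \<omega> = Q \<omega>"
  by (simp add: six_len_def)

lemma six_len_up:
  assumes "E (Suc x) (Suc y) \<omega> \<le> 1"
  shows "six_len V E Q x (Suc y) \<omega> + E (Suc x) (Suc y) \<omega> = six_len V E Q x y \<omega> + 1"
proof -
  have "E (Suc x) (Suc y) \<omega> = 0 \<or> E (Suc x) (Suc y) \<omega> = 1" using assms by linarith
  then show ?thesis
    using card_filter_le[where P = "\<lambda>k. E (x + 1) k \<omega> = 1" and n = y]
      card_filter_Suc[where P = "\<lambda>k. E (x + 1) k \<omega> = 1" and n = y]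
    unfolding six_len_def by auto
qed

text \<open>At y = 0 this is the definition. Going up by one, both lengths count an empty edge, and
  conservation at the vertex between these edges balances the change of \<open>V\<close>.\<close>

lemma six_len_right:
  assumes le: "\<And>x y. E (Suc x) (Suc y) \<omega> \<le> 1"
    and cons: "\<And>x y. V (Suc x) (Suc y) \<omega> + E (Suc x) (Suc y) \<omega> = V (Suc x) (Suc (Suc y)) \<omega> + E (Suc (Suc x)) (Suc y) \<omega>"
  shows "six_len V E Q (Suc x) y \<omega> = six_len V E Q x y \<omega> + V (Suc x) (Suc y) \<omega>"
proof (induction y)
  case 0
  then show ?case by (simp add: six_len_def)
next
  case (Suc y)
  then show ?case
    using six_len_up[of E "Suc x" y \<omega> V Q, OF le] six_len_up[of E x y \<omega> V Q, OF le] cons[of x y] by linarith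
qed

context field_params
begin

text \<open>Both laws vanish outside this set of length functions, and inside it the natural
  subtractions that recover the edges are exact.\<close>

definition unit_steps :: "(nat \<Rightarrow> nat \<Rightarrow> nat) \<Rightarrow> nat \<Rightarrow> bool" where
  "unit_steps g N \<longleftrightarrow>
     (\<forall>x y. Suc x \<le> N \<longrightarrow> y \<le> N \<longrightarrow> g x y \<le> g (Suc x) y \<and> g (Suc x) y \<le> Suc (g x y)) \<and>
     (\<forall>x y. x \<le> N \<longrightarrow> Suc y \<le> N \<longrightarrow> g x y \<le> g x (Suc y) \<and> g x (Suc y) \<le> Suc (g x y))"

lemma step_prob_nonzero: "step_prob p n k \<noteq> 0 \<Longrightarrow> k = n \<or> k = Suc n \<and> p \<noteq> 0"
  by (auto simp: step_prob_def split: if_splits)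

text \<open>In the bulk a step beyond the maximum of b and c happens only for b = c. As b and c lie
  within one of a by induction, the new length exceeds neither of them by more than one.\<close>

lemma kern_unit_steps:
  assumes nz: "\<And>x y. x \<le> N \<Longrightarrow> y \<le> N \<Longrightarrow> kern g x y \<noteq> 0"
  shows "unit_steps g N"
proof -
  have "x \<le> N \<Longrightarrow> y \<le> N \<Longrightarrow>
     (x \<noteq> 0 \<longrightarrow> g (x - 1) y \<le> g x y \<and> g x y \<le> Suc (g (x - 1) y)) \<and>
     (y \<noteq> 0 \<longrightarrow> g x (y - 1) \<le> g x y \<and> g x y \<le> Suc (g x (y - 1)))" for x y
  proof (induction "x + y" arbitrary: x y rule: less_induct)
    case less
    consider "x = 0" "y = 0" | "x \<noteq> 0" "y = 0" | "x = 0" "y \<noteq> 0" | "x \<noteq> 0" "y \<noteq> 0" by metis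
    then show ?case
    proof cases
      case 1
      then show ?thesis by simp
    next
      case 2
      then have "step_prob (step_par g x y) (g (x - 1) y) (g x y) \<noteq> 0"
        using nz[OF less.prems] by (simp add: kern_def below_len_def left_len_def)
      then show ?thesis using 2 step_prob_nonzero by fastforce
    next
      case 3
      then have "step_prob (step_par g x y) (g x (y - 1)) (g x y) \<noteq> 0"
        using nz[OF less.prems] by (simp add: kern_def below_len_def left_len_def)
      then show ?thesis using 3 step_prob_nonzero by fastforce
    next
      case 4
      define a b c where "a = g (x - 1) (y - 1)" and "b = g x (y - 1)" and "c = g (x - 1) y"
      have "a \<le> b \<and> b \<le> Suc a"
        using less.hyps[of x "y - 1"] 4 less.prems by (simp add: a_def b_def)
      moreover have "a \<le> c \<and> c \<le> Suc a"
        using less.hyps[of "x - 1" y] 4 less.prems by (simp add: a_def c_def)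
      moreover have "step_prob (bulk_par (u y * v x) a b c) (max b c) (g x y) \<noteq> 0"
        using nz[OF less.prems] 4
        by (simp add: kern_def step_par_def below_len_def left_len_def diag_len_def a_def b_def c_def)
      then have "g x y = max b c \<or> g x y = Suc (max b c) \<and> b = c"
        using step_prob_nonzero by (metis bulk_par_def)
      ultimately have "c \<le> g x y \<and> g x y \<le> Suc c \<and> b \<le> g x y \<and> g x y \<le> Suc b" by linarith
      then show ?thesis by (simp add: b_def c_def)
    qed
  qed
  note steps = this
  show ?thesis
    unfolding unit_steps_def
  proof (intro conjI allI impI)
    fix x y
    show "g x y \<le> g (Suc x) y" "g (Suc x) y \<le> Suc (g x y)" if "Suc x \<le> N" "y \<le> N"
      using steps[OF that] by simp_all
    show "g x y \<le> g x (Suc y)" "g x (Suc y) \<le> Suc (g x y)" if "x \<le> N" "Suc y \<le> N"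
      using steps[OF that] by simp_all
  qed
qed

text \<open>The edges at a vertex are the increments of the length around a cell: vertical edges
  carry the increments to the right, b - a and k - c, and horizontal edges the complements of the
  upward ones.\<close>

lemma L6V_step_prob:
  assumes z: "0 \<le> z" "z < 1" and le: "a \<le> b" "b \<le> Suc a" "a \<le> c" "c \<le> Suc a" "b \<le> k" "k \<le> Suc b" "c \<le> k" "k \<le> Suc c"
  shows "L6V q z (b - a) (Suc a - c) (k - c) (Suc b - k) = step_prob (bulk_par z a b c) (max b c) k"
proof -
  have zq: "1 - q * z > 0" using mult_power_less_one[OF q z(2), of 1] by (simp add: mult.commute)
  have e: "1 - z * (1 - q) / (1 - q * z) = (1 - z) / (1 - q * z)" "1 - q * (1 - z) / (1 - q * z) = (1 - q) / (1 - q * z)"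
    using zq by (auto simp: field_simps)
  consider "b = a" "c = a" "k = a" | "b = a" "c = a" "k = Suc a" | "b = Suc a" "c = a" "k = Suc a"
    | "b = a" "c = Suc a" "k = Suc a" | "b = Suc a" "c = Suc a" "k = Suc a" | "b = Suc a" "c = Suc a" "k = Suc (Suc a)"
  proof -
    have "b = a \<or> b = Suc a" "c = a \<or> c = Suc a" using le by linarith+
    moreover have "k = max b c \<or> k = Suc (max b c) \<and> b = c" using le by linarith
    ultimately show thesis using that by (elim disjE) auto
  qed
  then show ?thesis
  proof cases
    case 1
    then show ?thesis by (simp add: L6V_def step_prob_def bulk_par_def e(1))
  next
    case 2
    then show ?thesis by (simp add: L6V_def step_prob_def bulk_par_def)
  next
    case 3
    then show ?thesis by (simp add: L6V_def step_prob_def bulk_par_def)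
  next
    case 4
    then show ?thesis by (simp add: L6V_def step_prob_def bulk_par_def)
  next
    case 5
    then show ?thesis by (simp add: L6V_def step_prob_def bulk_par_def e(2))
  next
    case 6
    then show ?thesis by (simp add: L6V_def step_prob_def bulk_par_def)
  qed
qed

lemma bern_step_prob:
  assumes "n \<le> k"
  shows "bern p (k - n) = step_prob p n k"
proof -
  obtain d where "k = n + d" using assms le_Suc_ex by blast
  then show ?thesis by (simp add: bern_def step_prob_def)
qed

text \<open>An occupied horizontal edge is an upward step that does not increase the length, hence
  the complementary parameter.\<close>

lemma bern_compl_step_prob:
  assumes "n \<le> k" "k \<le> Suc n"
  shows "bern (1 - p) (Suc n - k) = step_prob p n k"
proof -
  consider "k = n" | "k = Suc n" using assms by linarith
  then show ?thesis by cases (auto simp: bern_def step_prob_def)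
qed

lemma kern_square_prod:
  assumes "unit_steps g N"
  shows "(\<Prod>(x, y)\<in>{..N} \<times> {..N}. kern g x y) =
    (\<alpha> * \<beta>) ^ g 0 0 / qp q q (g 0 0) * qpoch_inf (\<alpha> * \<beta>) q *
    ((\<Prod>x = 1..N. bern (v x * \<alpha> / (1 + v x * \<alpha>)) (g x 0 - g (x - 1) 0)) *
     (\<Prod>y = 1..N. bern (1 / (1 + u y * \<beta>)) (Suc (g 0 (y - 1)) - g 0 y)) *
     (\<Prod>x = 1..N. \<Prod>y = 1..N. L6V q (u y * v x) (g x (y - 1) - g (x - 1) (y - 1)) (Suc (g (x - 1) (y - 1)) - g (x - 1) y)
        (g x y - g (x - 1) y) (Suc (g x (y - 1)) - g x y)))"
proof -
  have right: "g (x - 1) y \<le> g x y" "g x y \<le> Suc (g (x - 1) y)" if "x \<in> {1..N}" "y \<le> N" for x y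
    using assms that unfolding unit_steps_def by (cases x; simp)+
  have up: "g x (y - 1) \<le> g x y" "g x y \<le> Suc (g x (y - 1))" if "x \<le> N" "y \<in> {1..N}" for x y
    using assms that unfolding unit_steps_def by (cases y; simp)+
  have row0: "kern g x 0 = bern (v x * \<alpha> / (1 + v x * \<alpha>)) (g x 0 - g (x - 1) 0)" if "x \<in> {1..N}" for x
    using that right[OF that, of 0] by (simp add: bern_step_prob kern_def step_par_def below_len_def left_len_def)
  have col0: "kern g 0 y = bern (1 / (1 + u y * \<beta>)) (Suc (g 0 (y - 1)) - g 0 y)" if "y \<in> {1..N}" for y
  proof -
    have "1 + u y * \<beta> > 0" using u[of y] \<beta> that by (simp add: add_pos_nonneg)
    then have "1 / (1 + u y * \<beta>) = 1 - u y * \<beta> / (1 + u y * \<beta>)" by (simp add: field_simps)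
    then show ?thesis
      using that up[OF _ that, of 0] by (simp add: bern_compl_step_prob kern_def step_par_def below_len_def left_len_def)
  qed
  have bulk: "kern g x y = L6V q (u y * v x) (g x (y - 1) - g (x - 1) (y - 1)) (Suc (g (x - 1) (y - 1)) - g (x - 1) y)
        (g x y - g (x - 1) y) (Suc (g x (y - 1)) - g x y)" if "x \<in> {1..N}" "y \<in> {1..N}" for x y
  proof -
    have z: "0 \<le> u y * v x" "u y * v x < 1" using u[of y] v[of x] that mult_less_one by auto
    have "kern g x y = step_prob (bulk_par (u y * v x) (g (x - 1) (y - 1)) (g x (y - 1)) (g (x - 1) y))
        (max (g x (y - 1)) (g (x - 1) y)) (g x y)"
      using that by (simp add: kern_def step_par_def below_len_def left_len_def diag_len_def)
    moreover have "x - 1 \<le> N" "y - 1 \<le> N" "x \<le> N" "y \<le> N" using that by auto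
    ultimately show ?thesis
      using right[OF that(1), of y] right[OF that(1), of "y - 1"] up[OF _ that(2), of x] up[OF _ that(2), of "x - 1"]
      by (simp add: L6V_step_prob[OF z])
  qed
  have split: "(\<Prod>x\<le>N. F x) = F 0 * (\<Prod>x = 1..N. F x)" for F :: "nat \<Rightarrow> real"
    by (simp add: atMost_atLeast0 prod.atLeast_Suc_atMost)
  have "(\<Prod>(x, y)\<in>{..N} \<times> {..N}. kern g x y) = (\<Prod>x\<le>N. kern g x 0 * (\<Prod>y = 1..N. kern g x y))"
    by (simp add: prod.cartesian_product[symmetric] split)
  also have "\<dots> = kern g 0 0 * (\<Prod>y = 1..N. kern g 0 y) * ((\<Prod>x = 1..N. kern g x 0) * (\<Prod>x = 1..N. \<Prod>y = 1..N. kern g x y))"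
    by (simp add: split prod.distrib)
  also have "(\<Prod>y = 1..N. kern g 0 y) = (\<Prod>y = 1..N. bern (1 / (1 + u y * \<beta>)) (Suc (g 0 (y - 1)) - g 0 y))"
    by (intro prod.cong refl col0)
  also have "(\<Prod>x = 1..N. kern g x 0) = (\<Prod>x = 1..N. bern (v x * \<alpha> / (1 + v x * \<alpha>)) (g x 0 - g (x - 1) 0))"
    by (intro prod.cong refl row0)
  also have "(\<Prod>x = 1..N. \<Prod>y = 1..N. kern g x y) = (\<Prod>x = 1..N. \<Prod>y = 1..N.
      L6V q (u y * v x) (g x (y - 1) - g (x - 1) (y - 1)) (Suc (g (x - 1) (y - 1)) - g (x - 1) y)
        (g x y - g (x - 1) y) (Suc (g x (y - 1)) - g x y))"
    by (intro prod.cong refl bulk)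
  also have "kern g 0 0 = (\<alpha> * \<beta>) ^ g 0 0 / qp q q (g 0 0) * qpoch_inf (\<alpha> * \<beta>) q"
    by (simp add: kern_def)
  finally show ?thesis by (simp only: mult_ac)
qed

end

context field_params
begin

context
  fixes M :: "'b measure" and V E :: "nat \<Rightarrow> nat \<Rightarrow> 'b \<Rightarrow> nat" and Mq :: "'b \<Rightarrow> nat"
  assumes sixv: "six_vertex M q u v \<alpha> \<beta> V E"
    and Mq_law: "\<And>k. measure M {\<omega> \<in> space M. Mq \<omega> = k} = (\<alpha> * \<beta>) ^ k / qpoch q q k * qpoch_inf (\<alpha> * \<beta>) q"
    and indep: "indep_rv M (count_space UNIV) Mq
                  (PiM ({1..} \<times> {1..}) (\<lambda>_. count_space UNIV))
                  (\<lambda>\<omega>. \<lambda>(x, y) \<in> {1..} \<times> {1..}. (V x y \<omega>, E x y \<omega>))"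
begin

interpretation prob_space M
  using sixv unfolding six_vertex_def by (rule conjunct1)

lemma measurable_VE:
  assumes "1 \<le> x" "1 \<le> y"
  shows "V x y \<in> measurable M (count_space UNIV)" "E x y \<in> measurable M (count_space UNIV)"
proof -
  have "\<forall>x\<ge>1. \<forall>y\<ge>1. V x y \<in> measurable M (count_space UNIV) \<and> E x y \<in> measurable M (count_space UNIV)"
    using sixv unfolding six_vertex_def by (elim conjE)
  then show "V x y \<in> measurable M (count_space UNIV)" "E x y \<in> measurable M (count_space UNIV)"
    using assms by blast+
qed

lemma measurable_Mq: "Mq \<in> measurable M (count_space UNIV)"
  using indep unfolding indep_rv_def by (rule conjunct1)

text \<open>The edges leaving the square are included, hence the ranges up to \<open>Suc N\<close>:
  vertical edges at height N + 1 and horizontal ones at abscissa N + 1.\<close>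

definition config :: "nat \<Rightarrow> (nat \<Rightarrow> nat \<Rightarrow> nat) \<Rightarrow> (nat \<Rightarrow> nat \<Rightarrow> nat) \<Rightarrow> 'b set" where
  "config N f g = {\<omega> \<in> space M. (\<forall>p\<in>{1..N} \<times> {1..Suc N}. V (fst p) (snd p) \<omega> = f (fst p) (snd p))
     \<and> (\<forall>p\<in>{1..Suc N} \<times> {1..N}. E (fst p) (snd p) \<omega> = g (fst p) (snd p))}"

lemma ball_nat_split: "(\<forall>y\<in>{1..Suc N}. P y) \<longleftrightarrow> P 1 \<and> (\<forall>y\<in>{1..N}. P (y + 1))"
proof
  assume r: "P 1 \<and> (\<forall>y\<in>{1..N}. P (y + 1))"
  have "P y" if "y \<in> {1..Suc N}" for y
  proof (cases "y = 1")
    case False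
    then have "y - 1 \<in> {1..N}" "y - 1 + 1 = y" using that by auto
    then show ?thesis using r by metis
  qed (use r in blast)
  then show "\<forall>y\<in>{1..Suc N}. P y" by blast
next
  assume l: "\<forall>y\<in>{1..Suc N}. P y"
  have "P 1" using l by (rule bspec) simp
  moreover have "P (y + 1)" if "y \<in> {1..N}" for y
    using l by (rule bspec) (use that in simp)
  ultimately show "P 1 \<and> (\<forall>y\<in>{1..N}. P (y + 1))" by blast
qed

lemma measure_config:
  "measure M (config N f g) = (\<Prod>x = 1..N. bern (v x * \<alpha> / (1 + v x * \<alpha>)) (f x 1)) *
          (\<Prod>y = 1..N. bern (1 / (1 + u y * \<beta>)) (g 1 y)) *
          (\<Prod>x = 1..N. \<Prod>y = 1..N.
             L6V q (u y * v x) (f x y) (g x y) (f x (y + 1)) (g (x + 1) y))"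
proof -
  have prod: "(\<forall>p\<in>A \<times> B. R (fst p) (snd p)) \<longleftrightarrow> (\<forall>x\<in>A. \<forall>y\<in>B. R x y)" for A B :: "nat set" and R
    by auto
  have V: "(\<forall>p\<in>{1..N} \<times> {1..Suc N}. V (fst p) (snd p) \<omega> = f (fst p) (snd p)) \<longleftrightarrow>
      (\<forall>x\<in>{1..N}. V x 1 \<omega> = f x 1) \<and> (\<forall>x\<in>{1..N}. \<forall>y\<in>{1..N}. V x (y + 1) \<omega> = f x (y + 1))" for \<omega>
    unfolding prod[of _ _ "\<lambda>x y. V x y \<omega> = f x y"]
    by (subst ball_nat_split) (rule ball_conj_distrib)
  have E: "(\<forall>p\<in>{1..Suc N} \<times> {1..N}. E (fst p) (snd p) \<omega> = g (fst p) (snd p)) \<longleftrightarrow>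
      (\<forall>y\<in>{1..N}. E 1 y \<omega> = g 1 y) \<and> (\<forall>x\<in>{1..N}. \<forall>y\<in>{1..N}. E (x + 1) y \<omega> = g (x + 1) y)" for \<omega>
    unfolding prod[of _ _ "\<lambda>x y. E x y \<omega> = g x y"]
    by (rule ball_nat_split)
  have "config N f g = {\<omega> \<in> space M. (\<forall>x \<in> {1..N}. V x 1 \<omega> = f x 1) \<and> (\<forall>y \<in> {1..N}. E 1 y \<omega> = g 1 y) \<and>
            (\<forall>x \<in> {1..N}. \<forall>y \<in> {1..N}. V x (y + 1) \<omega> = f x (y + 1) \<and> E (x + 1) y \<omega> = g (x + 1) y)}"
    unfolding config_def V E ball_conj_distrib by (simp only: conj_ac)
  then show ?thesis using sixv unfolding six_vertex_def by (elim conjE) (simp only:)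
qed

lemma prod_nonzero_member: "prod F A \<noteq> (0::real) \<Longrightarrow> finite A \<Longrightarrow> a \<in> A \<Longrightarrow> F a \<noteq> 0"
  using prod_zero[of A F] by blast

text \<open>For every N almost every \<omega> has a configuration of positive probability in the
  square, and a positive product has no vanishing vertex weight. This gives conservation at all
  vertices.\<close>

lemma AE_vertex:
  "AE \<omega> in M. \<forall>x y. L6V q (u (Suc y) * v (Suc x)) (V (Suc x) (Suc y) \<omega>) (E (Suc x) (Suc y) \<omega>)
     (V (Suc x) (Suc (Suc y)) \<omega>) (E (Suc (Suc x)) (Suc y) \<omega>) \<noteq> 0"
proof -
  have "AE \<omega> in M. 0 < measure M (config N (\<lambda>x y. V x y \<omega>) (\<lambda>x y. E x y \<omega>))" for N
    unfolding config_def
    by (rule AE_atom_mixed[where ?Y1.0 = "\<lambda>p. V (fst p) (snd p)" and ?Y2.0 = "\<lambda>p. E (fst p) (snd p)"])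
      (auto intro!: measurable_VE)
  then have "AE \<omega> in M. \<forall>N. 0 < measure M (config N (\<lambda>x y. V x y \<omega>) (\<lambda>x y. E x y \<omega>))"
    by (simp add: AE_all_countable)
  then show ?thesis
  proof eventually_elim
    case (elim \<omega>)
    show ?case
    proof (intro allI)
      fix x y :: nat
      define N where "N = Suc (max x y)"
      have xy: "Suc x \<in> {1..N}" "Suc y \<in> {1..N}" by (auto simp: N_def)
      have "(\<Prod>x = 1..N. \<Prod>y = 1..N. L6V q (u y * v x) (V x y \<omega>) (E x y \<omega>) (V x (y + 1) \<omega>) (E (x + 1) y \<omega>)) \<noteq> 0"
      proof
        assume "(\<Prod>x = 1..N. \<Prod>y = 1..N. L6V q (u y * v x) (V x y \<omega>) (E x y \<omega>) (V x (y + 1) \<omega>) (E (x + 1) y \<omega>)) = 0"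
        then have "measure M (config N (\<lambda>x y. V x y \<omega>) (\<lambda>x y. E x y \<omega>)) = 0"
          unfolding measure_config by (simp only: mult_zero_right)
        then show False using elim[rule_format, of N] by linarith
      qed
      from prod_nonzero_member[OF prod_nonzero_member[OF this finite_atLeastAtMost xy(1)] finite_atLeastAtMost xy(2)]
      show "L6V q (u (Suc y) * v (Suc x)) (V (Suc x) (Suc y) \<omega>) (E (Suc x) (Suc y) \<omega>)
         (V (Suc x) (Suc (Suc y)) \<omega>) (E (Suc (Suc x)) (Suc y) \<omega>) \<noteq> 0"
        unfolding Suc_eq_plus1 .
    qed
  qed
qed

lemma AE_six_len:
  "AE \<omega> in M. six_len V E Mq 0 0 \<omega> = Mq \<omega>
     \<and> (\<forall>x y. six_len V E Mq (Suc x) y \<omega> = six_len V E Mq x y \<omega> + V (Suc x) (Suc y) \<omega> \<and> V (Suc x) (Suc y) \<omega> \<le> 1)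
     \<and> (\<forall>x y. six_len V E Mq x (Suc y) \<omega> + E (Suc x) (Suc y) \<omega> = six_len V E Mq x y \<omega> + 1 \<and> E (Suc x) (Suc y) \<omega> \<le> 1)"
  using AE_vertex
proof eventually_elim
  case (elim \<omega>)
  have L: "V (Suc x) (Suc y) \<omega> \<le> 1 \<and> E (Suc x) (Suc y) \<omega> \<le> 1 \<and> V (Suc x) (Suc (Suc y)) \<omega> \<le> 1 \<and> E (Suc (Suc x)) (Suc y) \<omega> \<le> 1 \<and>
      V (Suc x) (Suc y) \<omega> + E (Suc x) (Suc y) \<omega> = V (Suc x) (Suc (Suc y)) \<omega> + E (Suc (Suc x)) (Suc y) \<omega>" for x y
    using L6V_nonzero[OF elim[THEN spec, THEN spec, of y x]] .
  have r: "six_len V E Mq (Suc x) y \<omega> = six_len V E Mq x y \<omega> + V (Suc x) (Suc y) \<omega>" for x y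
  proof (rule six_len_right)
    fix x y
    show "E (Suc x) (Suc y) \<omega> \<le> 1" using L[of x y] by (elim conjE)
    show "V (Suc x) (Suc y) \<omega> + E (Suc x) (Suc y) \<omega> = V (Suc x) (Suc (Suc y)) \<omega> + E (Suc (Suc x)) (Suc y) \<omega>"
      using L[of x y] by (elim conjE)
  qed
  have up: "six_len V E Mq x (Suc y) \<omega> + E (Suc x) (Suc y) \<omega> = six_len V E Mq x y \<omega> + 1" for x y
  proof (rule six_len_up)
    show "E (Suc x) (Suc y) \<omega> \<le> 1" using L[of x y] by (elim conjE)
  qed
  have Vle: "V (Suc x) (Suc y) \<omega> \<le> 1" for x y using L[of x y] by (rule conjunct1)
  have Ele: "E (Suc x) (Suc y) \<omega> \<le> 1" for x y using L[of x y] by (elim conjE)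
  show ?case by (intro conjI allI six_len_origin r up Vle Ele)
qed

lemma measurable_nat_op:
  fixes X Y :: "'b \<Rightarrow> nat" and F :: "nat \<Rightarrow> nat \<Rightarrow> nat"
  assumes "X \<in> measurable M (count_space UNIV)" "Y \<in> measurable M (count_space UNIV)"
  shows "(\<lambda>\<omega>. F (X \<omega>) (Y \<omega>)) \<in> measurable M (count_space UNIV)"
proof -
  have "(\<lambda>\<omega>. (X \<omega>, Y \<omega>)) \<in> measurable M (count_space UNIV \<Otimes>\<^sub>M count_space UNIV)"
    using assms by (rule measurable_Pair)
  then have "(\<lambda>\<omega>. (X \<omega>, Y \<omega>)) \<in> measurable M (count_space UNIV)"
    by (simp add: pair_measure_countable)
  from measurable_compose[OF this measurable_count_space, of "\<lambda>p. F (fst p) (snd p)"] show ?thesis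
    by (simp only: fst_conv snd_conv)
qed

lemma measurable_nat_sum:
  fixes X :: "nat \<Rightarrow> 'b \<Rightarrow> nat"
  assumes "\<And>k. k \<in> {1..n} \<Longrightarrow> X k \<in> measurable M (count_space UNIV)"
  shows "(\<lambda>\<omega>. \<Sum>k = 1..n. X k \<omega>) \<in> measurable M (count_space UNIV)"
  using assms
proof (induction n)
  case (Suc n)
  have "(\<lambda>\<omega>. \<Sum>k = 1..n. X k \<omega>) \<in> measurable M (count_space UNIV)"
    by (rule Suc.IH) (use Suc.prems in simp)
  moreover have "X (Suc n) \<in> measurable M (count_space UNIV)"
    by (rule Suc.prems) simp
  ultimately have "(\<lambda>\<omega>. (\<Sum>k = 1..n. X k \<omega>) + X (Suc n) \<omega>) \<in> measurable M (count_space UNIV)"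
    by (rule measurable_nat_op)
  then show ?case by simp
qed simp

lemma measurable_six_len: "six_len V E Mq x y \<in> measurable M (count_space UNIV)"
proof -
  have "card {k \<in> {1..y}. E (x + 1) k \<omega> = 1} = (\<Sum>k = 1..y. if E (x + 1) k \<omega> = 1 then 1 else 0)" for \<omega>
    by (simp add: sum.If_cases Int_def)
  then have "six_len V E Mq x y = (\<lambda>\<omega>. (Mq \<omega> + (\<Sum>k = 1..x. V k 1 \<omega>)) + (y - (\<Sum>k = 1..y. if E (x + 1) k \<omega> = 1 then 1 else 0)))"
    by (simp add: six_len_def fun_eq_iff)
  also have "\<dots> \<in> measurable M (count_space UNIV)"
  proof (rule measurable_nat_op[of _ _ "(+)"])
    show "(\<lambda>\<omega>. Mq \<omega> + (\<Sum>k = 1..x. V k 1 \<omega>)) \<in> measurable M (count_space UNIV)"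
      by (rule measurable_nat_op[of _ _ "(+)", OF measurable_Mq measurable_nat_sum], rule measurable_VE(1)) simp_all
    have "(\<lambda>\<omega>. if E (x + 1) k \<omega> = 1 then 1 else 0 :: nat) \<in> measurable M (count_space UNIV)" if "k \<in> {1..y}" for k
      using that measurable_compose[OF measurable_VE(2)[of "x + 1" k] measurable_count_space, of "\<lambda>n. if n = 1 then 1 else 0"]
      by simp
    then have "(\<lambda>\<omega>. \<Sum>k = 1..y. if E (x + 1) k \<omega> = 1 then 1 else 0 :: nat) \<in> measurable M (count_space UNIV)"
      by (rule measurable_nat_sum)
    then show "(\<lambda>\<omega>. y - (\<Sum>k = 1..y. if E (x + 1) k \<omega> = 1 then 1 else 0)) \<in> measurable M (count_space UNIV)"
      by (rule measurable_compose[OF _ measurable_count_space])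
  qed
  finally show ?thesis .
qed

text \<open>The event \<open>config\<close> constrains finitely many coordinates, so it is the
  preimage of a measurable set B of edge fields.\<close>

lemma indep_config:
  "measure M ({\<omega> \<in> space M. Mq \<omega> = k} \<inter> config N f g) = measure M {\<omega> \<in> space M. Mq \<omega> = k} * measure M (config N f g)"
proof -
  let ?P = "PiM ({1..} \<times> {1..}) (\<lambda>_. count_space UNIV) :: (nat \<times> nat \<Rightarrow> nat \<times> nat) measure"
  let ?Y = "\<lambda>\<omega>. \<lambda>(x, y) \<in> {1..} \<times> {1..}. (V x y \<omega>, E x y \<omega>)"
  define B where "B = {\<phi> \<in> space ?P. (\<forall>p\<in>{1..N} \<times> {1..Suc N}. fst (\<phi> p) = f (fst p) (snd p))
     \<and> (\<forall>p\<in>{1..Suc N} \<times> {1..N}. snd (\<phi> p) = g (fst p) (snd p))}"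
  have coord: "{\<phi> \<in> space ?P. R (\<phi> p)} \<in> sets ?P" if "p \<in> {1..} \<times> {1..}" for p R
  proof -
    have "(\<lambda>\<phi>. \<phi> p) -` {c. R c} \<inter> space ?P \<in> sets ?P"
      by (rule measurable_sets[OF measurable_component_singleton[OF that]]) simp
    also have "(\<lambda>\<phi>. \<phi> p) -` {c. R c} \<inter> space ?P = {\<phi> \<in> space ?P. R (\<phi> p)}" by blast
    finally show ?thesis .
  qed
  have B: "B \<in> sets ?P"
    unfolding B_def
    by (intro sets.sets_Collect_conj sets.sets_Collect_finite_All coord) auto
  have "?Y -` B \<inter> space M = config N f g"
  proof (rule set_eqI)
    fix \<omega>
    have "?Y \<omega> \<in> space ?P" by (simp add: space_PiM)
    moreover have "(\<forall>p\<in>{1..N} \<times> {1..Suc N}. fst (?Y \<omega> p) = f (fst p) (snd p)) \<longleftrightarrow>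
        (\<forall>p\<in>{1..N} \<times> {1..Suc N}. V (fst p) (snd p) \<omega> = f (fst p) (snd p))"
      by (intro ball_cong refl) auto
    moreover have "(\<forall>p\<in>{1..Suc N} \<times> {1..N}. snd (?Y \<omega> p) = g (fst p) (snd p)) \<longleftrightarrow>
        (\<forall>p\<in>{1..Suc N} \<times> {1..N}. E (fst p) (snd p) \<omega> = g (fst p) (snd p))"
      by (intro ball_cong refl) auto
    ultimately show "\<omega> \<in> ?Y -` B \<inter> space M \<longleftrightarrow> \<omega> \<in> config N f g"
      by (simp only: B_def config_def vimage_eq Int_iff mem_Collect_eq simp_thms conj_ac)
  qed
  moreover have "Mq -` {k} \<inter> space M = {\<omega> \<in> space M. Mq \<omega> = k}" by auto
  moreover have ind: "indep_set {Mq -` A \<inter> space M | A. A \<in> sets (count_space UNIV)} {?Y -` B \<inter> space M | B. B \<in> sets ?P}"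
    using indep by (simp only: indep_rv_def)
  moreover have "measure M ((Mq -` {k} \<inter> space M) \<inter> (?Y -` B \<inter> space M)) = measure M (Mq -` {k} \<inter> space M) * measure M (?Y -` B \<inter> space M)"
  proof (rule indep_setD[OF ind])
    show "Mq -` {k} \<inter> space M \<in> {Mq -` A \<inter> space M | A. A \<in> sets (count_space UNIV)}"
      by (intro CollectI exI[of _ "{k}"] conjI refl) simp
    show "?Y -` B \<inter> space M \<in> {?Y -` B \<inter> space M | B. B \<in> sets ?P}"
      by (intro CollectI exI[of _ B] conjI refl B)
  qed
  ultimately show ?thesis by simp
qed

lemma sets_config: "config N f g \<in> sets M"
proof -
  have "{\<omega> \<in> space M. \<forall>p\<in>{1..N} \<times> {1..Suc N}. V (fst p) (snd p) \<omega> = f (fst p) (snd p)} \<in> sets M"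
    by (rule sets_fam_eq) (auto intro: measurable_VE)
  moreover have "{\<omega> \<in> space M. \<forall>p\<in>{1..Suc N} \<times> {1..N}. E (fst p) (snd p) \<omega> = g (fst p) (snd p)} \<in> sets M"
    by (rule sets_fam_eq) (auto intro: measurable_VE)
  ultimately show ?thesis
    unfolding config_def by (intro sets.sets_Collect_conj)
qed

text \<open>Lengths on a square and the data of \<open>Mq\<close> with the edges determine each
  other almost surely. The event for g thus becomes one for \<open>Mq\<close> and
  \<open>config\<close>, which are independent with known probabilities.\<close>

lemma six_vertex_law: "has_law M (six_len V E Mq) ({..N} \<times> {..N})"
  unfolding has_law_def
proof
  fix g :: "nat \<Rightarrow> nat \<Rightarrow> nat"
  let ?A = "{\<omega> \<in> space M. \<forall>(x, y)\<in>{..N} \<times> {..N}. six_len V E Mq x y \<omega> = g x y}"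
  have A: "?A \<in> sets M"
    by (rule measurable_fam[OF prob_space_axioms measurable_six_len]) simp
  show "measure M ?A = (\<Prod>(x, y)\<in>{..N} \<times> {..N}. kern g x y)"
  proof (cases "unit_steps g N")
    \<comment> \<open>Off the unit steps the kernel vanishes somewhere on the square, and almost
      surely \<open>six_len\<close> does not take such values.\<close>
    case False
    have "\<exists>x y. x \<le> N \<and> y \<le> N \<and> kern g x y = 0"
      using kern_unit_steps[of N g] False by blast
    then have "(\<Prod>(x, y)\<in>{..N} \<times> {..N}. kern g x y) = 0"
      by (intro prod_zero) auto
    moreover have "measure M ?A = measure M {}"
    proof (rule measure_eq_AE[OF _ A sets.empty_sets])
      show "AE \<omega> in M. (\<omega> \<in> ?A) = (\<omega> \<in> {})"
        using AE_six_len
      proof eventually_elim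
        case (elim \<omega>)
        have "unit_steps g N" if "\<omega> \<in> ?A"
        proof -
          have g: "g x y = six_len V E Mq x y \<omega>" if "x \<le> N" "y \<le> N" for x y
            using \<open>\<omega> \<in> ?A\<close> that by auto
          show ?thesis
            unfolding unit_steps_def
          proof (intro conjI allI impI)
            fix x y
            show "g x y \<le> g (Suc x) y" "g (Suc x) y \<le> Suc (g x y)" if "Suc x \<le> N" "y \<le> N"
            proof -
              have "six_len V E Mq (Suc x) y \<omega> = six_len V E Mq x y \<omega> + V (Suc x) (Suc y) \<omega> \<and> V (Suc x) (Suc y) \<omega> \<le> 1"
                by (rule elim[THEN conjunct2, THEN conjunct1, THEN spec, THEN spec])
              then show "g x y \<le> g (Suc x) y" "g (Suc x) y \<le> Suc (g x y)"
                using g[of x y] g[of "Suc x" y] that by linarith+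
            qed
            show "g x y \<le> g x (Suc y)" "g x (Suc y) \<le> Suc (g x y)" if "x \<le> N" "Suc y \<le> N"
            proof -
              have "six_len V E Mq x (Suc y) \<omega> + E (Suc x) (Suc y) \<omega> = six_len V E Mq x y \<omega> + 1 \<and> E (Suc x) (Suc y) \<omega> \<le> 1"
                by (rule elim[THEN conjunct2, THEN conjunct2, THEN spec, THEN spec])
              then show "g x y \<le> g x (Suc y)" "g x (Suc y) \<le> Suc (g x y)"
                using g[of x y] g[of x "Suc y"] that by linarith+
            qed
          qed
        qed
        then show ?case using False by blast
      qed
    qed
    ultimately show ?thesis by simp
  next
    case True
    \<comment> \<open>\<open>V x y\<close> is the increment of the length from x - 1 to x at height
      y - 1, and \<open>E x y\<close> is the complement of its increment from y - 1 to y at abscissa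
      x - 1; hence the shifts.\<close>
    define f where "f x y = g x (y - 1) - g (x - 1) (y - 1)" for x y
    define h where "h x y = Suc (g (x - 1) (y - 1)) - g (x - 1) y" for x y
    have steps: "Suc x \<le> N \<Longrightarrow> y \<le> N \<Longrightarrow> g x y \<le> g (Suc x) y"
      "x \<le> N \<Longrightarrow> Suc y \<le> N \<Longrightarrow> g x (Suc y) \<le> Suc (g x y)" for x y
      using True by (auto simp: unit_steps_def)
    have "measure M ?A = measure M ({\<omega> \<in> space M. Mq \<omega> = g 0 0} \<inter> config N f h)"
    proof (rule measure_eq_AE[OF _ A])
      show "{\<omega> \<in> space M. Mq \<omega> = g 0 0} \<inter> config N f h \<in> sets M"
        using sets_fam_eq[of "{()}" "\<lambda>_. Mq" "\<lambda>_. g 0 0"] measurable_Mq sets_config by auto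
      show "AE \<omega> in M. (\<omega> \<in> ?A) = (\<omega> \<in> {\<omega> \<in> space M. Mq \<omega> = g 0 0} \<inter> config N f h)"
        using AE_six_len AE_space
      proof eventually_elim
        case (elim \<omega>)
        define L where "L x y = six_len V E Mq x y \<omega>" for x y
        have L0: "L 0 0 = Mq \<omega>"
          unfolding L_def by (rule elim(1)[THEN conjunct1])
        have LV: "L (Suc x) y = L x y + V (Suc x) (Suc y) \<omega>" for x y
          unfolding L_def by (rule elim(1)[THEN conjunct2, THEN conjunct1, THEN spec, THEN spec, THEN conjunct1])
        have LE: "L x (Suc y) + E (Suc x) (Suc y) \<omega> = L x y + 1" for x y
          unfolding L_def by (rule elim(1)[THEN conjunct2, THEN conjunct2, THEN spec, THEN spec, THEN conjunct1])
        have main: "(\<forall>x\<le>N. \<forall>y\<le>N. L x y = g x y) \<longleftrightarrow> Mq \<omega> = g 0 0 \<and>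
          (\<forall>x y. Suc x \<le> N \<longrightarrow> y \<le> N \<longrightarrow> V (Suc x) (Suc y) \<omega> = g (Suc x) y - g x y) \<and>
          (\<forall>x y. x \<le> N \<longrightarrow> Suc y \<le> N \<longrightarrow> E (Suc x) (Suc y) \<omega> = Suc (g x y) - g x (Suc y))"
          (is "?l \<longleftrightarrow> ?r")
        proof
          assume l: ?l
          show ?r
          proof (intro conjI allI impI)
            have "L 0 0 = g 0 0" using l by blast
            then show "Mq \<omega> = g 0 0" using L0 by linarith
            fix x y
            show "V (Suc x) (Suc y) \<omega> = g (Suc x) y - g x y" if "Suc x \<le> N" "y \<le> N"
            proof -
              have "L x y = g x y" "L (Suc x) y = g (Suc x) y" using l that Suc_leD by blast+
              then show ?thesis using LV[of x y] by linarith
            qed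
            show "E (Suc x) (Suc y) \<omega> = Suc (g x y) - g x (Suc y)" if "x \<le> N" "Suc y \<le> N"
            proof -
              have "L x y = g x y" "L x (Suc y) = g x (Suc y)" using l that Suc_leD by blast+
              then show ?thesis using LE[of x y] by linarith
            qed
          qed
        next
          assume r: ?r
          \<comment> \<open>The lengths are rebuilt from the origin: along the bottom by the
            vertical edges, then up each column by the horizontal ones.\<close>
          have bottom: "L x 0 = g x 0" if "x \<le> N" for x
            using that
          proof (induction x)
            case 0
            show ?case using r[THEN conjunct1] L0 by linarith
          next
            case (Suc x)
            have "L x 0 = g x 0" using Suc.IH Suc.prems by linarith
            moreover have "V (Suc x) (Suc 0) \<omega> = g (Suc x) 0 - g x 0"
              by (rule r[THEN conjunct2, THEN conjunct1, rule_format, OF Suc.prems]) simp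
            ultimately show ?case using LV[of x 0] steps(1)[OF Suc.prems, of 0] by linarith
          qed
          have "L x y = g x y" if "x \<le> N" "y \<le> N" for x y
            using that(2)
          proof (induction y)
            case 0
            then show ?case using bottom that by blast
          next
            case (Suc y)
            have "L x y = g x y" using Suc.IH Suc.prems by linarith
            moreover have "E (Suc x) (Suc y) \<omega> = Suc (g x y) - g x (Suc y)"
              by (rule r[THEN conjunct2, THEN conjunct2, rule_format, OF that(1) Suc.prems])
            ultimately show ?case using LE[of x y] steps(2)[OF that(1) Suc.prems] by linarith
          qed
          then show ?l by blast
        qed
        have A_iff: "\<omega> \<in> ?A \<longleftrightarrow> (\<forall>x\<le>N. \<forall>y\<le>N. L x y = g x y)"
          using elim(2) by (auto simp: L_def)
        have C_iff: "\<omega> \<in> config N f h \<longleftrightarrow>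
          (\<forall>x y. Suc x \<le> N \<longrightarrow> y \<le> N \<longrightarrow> V (Suc x) (Suc y) \<omega> = g (Suc x) y - g x y) \<and>
          (\<forall>x y. x \<le> N \<longrightarrow> Suc y \<le> N \<longrightarrow> E (Suc x) (Suc y) \<omega> = Suc (g x y) - g x (Suc y))"
        proof -
          have ball: "(\<forall>p\<in>{1..m} \<times> {1..n}. R (fst p) (snd p)) \<longleftrightarrow> (\<forall>x y. Suc x \<le> m \<longrightarrow> Suc y \<le> n \<longrightarrow> R (Suc x) (Suc y))"
            for m n and R :: "nat \<Rightarrow> nat \<Rightarrow> bool"
          proof
            assume *: "\<forall>x y. Suc x \<le> m \<longrightarrow> Suc y \<le> n \<longrightarrow> R (Suc x) (Suc y)"
            have "R x y" if "x \<in> {1..m}" "y \<in> {1..n}" for x y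
              using *[rule_format, of "x - 1" "y - 1"] that by simp
            then show "\<forall>p\<in>{1..m} \<times> {1..n}. R (fst p) (snd p)" by auto
          qed auto
          show ?thesis
            unfolding config_def mem_Collect_eq
            using elim(2) ball[of N "Suc N" "\<lambda>x y. V x y \<omega> = f x y"] ball[of "Suc N" N "\<lambda>x y. E x y \<omega> = h x y"]
            by (simp add: f_def h_def)
        qed
        have "(\<omega> \<in> {\<omega> \<in> space M. Mq \<omega> = g 0 0} \<inter> config N f h) \<longleftrightarrow> Mq \<omega> = g 0 0 \<and>
          (\<forall>x y. Suc x \<le> N \<longrightarrow> y \<le> N \<longrightarrow> V (Suc x) (Suc y) \<omega> = g (Suc x) y - g x y) \<and>
          (\<forall>x y. x \<le> N \<longrightarrow> Suc y \<le> N \<longrightarrow> E (Suc x) (Suc y) \<omega> = Suc (g x y) - g x (Suc y))"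
          by (simp only: Int_iff mem_Collect_eq C_iff elim(2) simp_thms)
        from trans[OF trans[OF A_iff main] this[symmetric]] show ?case .
      qed
    qed
    also have "\<dots> = measure M {\<omega> \<in> space M. Mq \<omega> = g 0 0} * measure M (config N f h)"
      by (rule indep_config)
    also have "\<dots> = (\<Prod>(x, y)\<in>{..N} \<times> {..N}. kern g x y)"
      unfolding kern_square_prod[OF True] measure_config Mq_law qpoch_of_nat
      by (simp add: f_def h_def)
    finally show ?thesis .
  qed
qed

end

end

theorem theorem7p12:
  fixes q s \<alpha> \<beta> :: real and u v :: "nat \<Rightarrow> real"
    and M1 :: "'a measure" and \<eta> :: "nat \<Rightarrow> nat \<Rightarrow> 'a \<Rightarrow> nat multiset"
    and M2 :: "'b measure" and V E :: "nat \<Rightarrow> nat \<Rightarrow> 'b \<Rightarrow> nat" and Mq :: "'b \<Rightarrow> nat"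
  assumes q: "0 < q" "q < 1"
    and s: "-1 < s" "s < 0"
    and u: "\<And>y. y \<ge> 1 \<Longrightarrow> 0 \<le> u y \<and> u y < 1"
    and v: "\<And>x. x \<ge> 1 \<Longrightarrow> 0 \<le> v x \<and> v x < 1"
    and \<alpha>: "0 \<le> \<alpha>" "\<alpha> \<le> - inverse s"
    and \<beta>: "0 \<le> \<beta>" "\<beta> \<le> - inverse s"
    and \<alpha>\<beta>: "\<alpha> * \<beta> < 1"
    and field: "yb_field M1 q s
                  (\<lambda>y. if y = 0 then sg \<alpha> else sHL (u y)) (\<lambda>x. if x = 0 then sg \<beta> else sHL (v x)) \<eta>"
    and six_vertex: "six_vertex M2 q u v \<alpha> \<beta> V E"
    and Mq_law: "\<And>k. measure M2 {\<omega> \<in> space M2. Mq \<omega> = k}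
                       = (\<alpha> * \<beta>) ^ k / qpoch q q k * qpoch_inf (\<alpha> * \<beta>) q"
    and indep: "indep_rv M2 (count_space UNIV) Mq
                  (PiM ({1..} \<times> {1..}) (\<lambda>_. count_space UNIV))
                  (\<lambda>\<omega>. \<lambda>(x, y) \<in> {1..} \<times> {1..}. (V x y \<omega>, E x y \<omega>))"
  shows "distr M1 (PiM UNIV (\<lambda>_. count_space UNIV)) (\<lambda>\<omega> (x, y). int y - int (size (\<eta> x y \<omega>)))
         = distr M2 (PiM UNIV (\<lambda>_. count_space UNIV)) (\<lambda>\<omega> (x, y). height_6V V E x y \<omega> - int (Mq \<omega>))"
proof -
  interpret field_params q s \<alpha> \<beta> u v
    by unfold_locales (use q s u v \<alpha> \<beta> \<alpha>\<beta> in auto)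
  have rows: "(\<lambda>y. if y = 0 then sg \<alpha> else sHL (u y)) = row_spec" and cols: "(\<lambda>x. if x = 0 then sg \<beta> else sHL (v x)) = col_spec"
    by (simp_all add: row_spec_def col_spec_def fun_eq_iff)
  note field' = field[unfolded rows cols yb_field_def]
  have M1: "prob_space M1" and \<eta>: "\<And>x y. \<eta> x y \<in> measurable M1 (count_space UNIV)"
    and pos: "\<And>x y \<omega>. \<omega> \<in> space M1 \<Longrightarrow> 0 \<notin># \<eta> x y \<omega>"
    using field' by blast+
  from field'[THEN conjunct2, THEN conjunct2, THEN conjunct2] obtain C J where
    C: "\<forall>x y c. boundary_data (row_spec y) (col_spec x) c \<longrightarrow> positive_sums q s (row_spec y) (col_spec x) c \<longrightarrow>
      is_coupling q s (row_spec y) (col_spec x) c (C (row_spec y) (col_spec x) c)"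
    and J: "\<forall>x y h. J x y h \<in> measurable M1 (count_space UNIV)"
    and J0: "AE \<omega> in M1. \<forall>x y. \<forall>\<^sub>F h in sequentially. J x y h \<omega> = (0, 0)"
    and law: "\<forall>N H f j. measure M1 {\<omega> \<in> space M1.
              (\<forall>x y. x + y < N \<longrightarrow> \<eta> x y \<omega> = f x y) \<and>
              (\<forall>x y. x + y = N \<longrightarrow>
                 (\<forall>h \<in> {1..H}. count (\<eta> x y \<omega>) h = count (f x y) h) \<and>
                 (\<forall>h \<le> H. J x y h \<omega> = j x y h))}
          = measure M1 {\<omega> \<in> space M1. \<forall>x y. x + y < N \<longrightarrow> \<eta> x y \<omega> = f x y} *
            (\<Prod>(x, y) \<in> {(x, y). x + y = N}.
               transition_prob C f x y (j x y) H)"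
    by (elim exE conjE) (rule that; assumption)
  have size_meas: "(\<lambda>\<omega>. size (\<eta> x y \<omega>)) \<in> measurable M1 (count_space UNIV)" for x y
    by (rule measurable_compose[OF \<eta> measurable_count_space])
  have M2: "prob_space M2" using six_vertex unfolding six_vertex_def by (rule conjunct1)
  have six_meas: "six_len V E Mq x y \<in> measurable M2 (count_space UNIV)" for x y
    by (rule measurable_six_len[OF six_vertex Mq_law indep])
  \<comment> \<open>The square fits into a triangle: x, y \<le> N gives x + y < 2N + 1.\<close>
  have "has_law M1 (\<lambda>x y \<omega>. size (\<eta> x y \<omega>)) ({..N} \<times> {..N})" for N
  proof (rule has_law_subset[OF M1 size_meas])
    show "has_law M1 (\<lambda>x y \<omega>. size (\<eta> x y \<omega>)) {(x, y). x + y < Suc (2 * N)}"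
      by (rule field_law[OF M1 \<eta> pos C[THEN spec, THEN spec, THEN spec, THEN mp, THEN mp]
        J[THEN spec, THEN spec, THEN spec] J0 law[THEN spec, THEN spec, THEN spec, THEN spec]])
    show "finite {(x, y). x + y < Suc (2 * N)}"
      by (rule finite_subset[of _ "{..2 * N} \<times> {..2 * N}"]) auto
  qed (auto simp: down_closed_def)
  moreover have "has_law M2 (six_len V E Mq) ({..N} \<times> {..N})" for N
    by (rule six_vertex_law[OF six_vertex Mq_law indep])
  ultimately have eq: "measure M1 {\<omega> \<in> space M1. \<forall>(x, y)\<in>{..N} \<times> {..N}. size (\<eta> x y \<omega>) = g x y}
      = measure M2 {\<omega> \<in> space M2. \<forall>(x, y)\<in>{..N} \<times> {..N}. six_len V E Mq x y \<omega> = g x y}" for N g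
    unfolding has_law_def by simp
  let ?L1 = "\<lambda>i \<omega>. size (\<eta> (fst i) (snd i) \<omega>)" and ?L2 = "\<lambda>i \<omega>. six_len V E Mq (fst i) (snd i) \<omega>"
  let ?PN = "PiM UNIV (\<lambda>_. count_space UNIV) :: (nat \<times> nat \<Rightarrow> nat) measure"
  let ?PZ = "PiM UNIV (\<lambda>_. count_space UNIV) :: (nat \<times> nat \<Rightarrow> int) measure"
  have lengths: "distr M1 ?PN (\<lambda>\<omega> i. ?L1 i \<omega>) = distr M2 ?PN (\<lambda>\<omega> i. ?L2 i \<omega>)"
  proof (rule distr_PiM_nat_eqI[OF M1 M2 size_meas six_meas])
    fix D :: "(nat \<times> nat) set" assume "finite D"
    then have "bdd_above (fst ` D)" "bdd_above (snd ` D)" by simp_all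
    then obtain m n where mn: "\<And>p. p \<in> D \<Longrightarrow> fst p \<le> m" "\<And>p. p \<in> D \<Longrightarrow> snd p \<le> n"
      unfolding bdd_above_def by blast
    have "D \<subseteq> {..max m n} \<times> {..max m n}"
      using mn by (force simp: le_max_iff_disj)
    moreover have "measure M1 {\<omega> \<in> space M1. \<forall>i\<in>{..max m n} \<times> {..max m n}. ?L1 i \<omega> = g i}
       = measure M2 {\<omega> \<in> space M2. \<forall>i\<in>{..max m n} \<times> {..max m n}. ?L2 i \<omega> = g i}" for g
      using eq[of "max m n" "\<lambda>x y. g (x, y)"] by (simp add: case_prod_unfold)
    ultimately show "\<exists>T. finite T \<and> D \<subseteq> T \<and> (\<forall>g. measure M1 {\<omega> \<in> space M1. \<forall>i\<in>T. ?L1 i \<omega> = g i}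
       = measure M2 {\<omega> \<in> space M2. \<forall>i\<in>T. ?L2 i \<omega> = g i})"
      by (intro exI[of _ "{..max m n} \<times> {..max m n}"]) simp
  qed
  \<comment> \<open>Both fields of the claim are images of the lengths under this one measurable
    map.\<close>
  define F :: "(nat \<times> nat \<Rightarrow> nat) \<Rightarrow> nat \<times> nat \<Rightarrow> int" where "F = (\<lambda>\<phi> i. int (snd i) - int (\<phi> i))"
  have F: "F \<in> measurable ?PN ?PZ"
    unfolding F_def
  proof (rule measurable_PiM_single')
    fix i :: "nat \<times> nat"
    have "(\<lambda>\<phi>. \<phi> i) \<in> measurable ?PN (count_space UNIV)"
      using measurable_component_singleton[of i UNIV "\<lambda>_. count_space UNIV :: nat measure"] by simp
    from measurable_compose[OF this measurable_count_space, of "\<lambda>n. int (snd i) - int n"]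
    show "(\<lambda>\<phi>. int (snd i) - int (\<phi> i)) \<in> measurable ?PN (count_space UNIV)" .
  qed (simp add: space_PiM)
  have L1: "(\<lambda>\<omega> i. ?L1 i \<omega>) \<in> measurable M1 ?PN" and L2: "(\<lambda>\<omega> i. ?L2 i \<omega>) \<in> measurable M2 ?PN"
    using size_meas six_meas by (auto intro!: measurable_PiM_single')
  have "distr M1 ?PZ (\<lambda>\<omega> (x, y). int y - int (size (\<eta> x y \<omega>))) = distr (distr M1 ?PN (\<lambda>\<omega> i. ?L1 i \<omega>)) ?PZ F"
    unfolding distr_distr[OF F L1] by (simp add: F_def comp_def case_prod_unfold)
  also have "\<dots> = distr M2 ?PZ (\<lambda>\<omega> (x, y). height_6V V E x y \<omega> - int (Mq \<omega>))"
    unfolding lengths distr_distr[OF F L2] by (simp add: F_def comp_def case_prod_unfold six_len_height)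
  finally show ?thesis .
qed

end
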